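(* Let $\Phi=(A;\{E_i\}_{i=0}^d;A^*;\{E^*_i\}_{i=0}^d)$ be a Leonard system in $\mathcal{A}$ with parameter array $(\{\theta_i\}_{i=0}^d;\{\theta^*_i\}_{i=0}^d;\{\varphi_i\}_{i=1}^d;\{\phi_i\}_{i=1}^d)$. Let $S$ denote the switching element for $\Phi$. Fix a nonzero $v^*_0\in E^*_0V$ and for $X\in\mathcal{A}$ let $X^\natural\in\mathrm{Mat}_{d+1}(\mathbb{K})$ denote the matrix representing $X$ with respect to the basis $\{\tau_i(A)v^*_0\}_{i=0}^d$ of $V$. Then each of $S^\natural$, $(S^{-1})^\natural$ is lower triangular. Moreover for $0\le j\le i\le d$ their $(i,j)$ entries are $$S^\natural_{i,j}=\frac{[j,i-j,d-i]_q\,\phi_d\phi_{d-1}\cdots\phi_{d-j+1}\,\tau^*_{i-j}(\theta^*_d)}{\varphi_1\varphi_2\cdots\varphi_i},$$ $$(S^{-1})^\natural_{i,j}=\frac{[j,i-j,d-i]_q\,\varphi_1\varphi_2\cdots\varphi_j\,\eta^*_{i-j}(\theta^*_0)}{\phi_d\phi_{d-1}\cdots\phi_{d-i+1}}.$$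
   Context: $\mathbb{K}$ is a field, $d\ge 0$ an integer, $\mathcal{A}$ a $\mathbb{K}$-algebra isomorphic to $\mathrm{Mat}_{d+1}(\mathbb{K})$ (matrices have rows and columns indexed by $0,1,\ldots,d$), $I$ its identity, and $V$ a simple left $\mathcal{A}$-module (so $\dim V=d+1$). The symbol $A^*$ is just a name for a second element (not a conjugate transpose). A matrix $Y$ represents $X\in\mathcal{A}$ with respect to a basis $\{v_i\}_{i=0}^d$ of $V$ if $Xv_j=\sum_{i=0}^dY_{ij}v_i$ for $0\le j\le d$. An element $A\in\mathcal{A}$ is multiplicity-free if it has $d+1$ mutually distinct eigenvalues in $\mathbb{K}$. For an ordering $\{\theta_i\}_{i=0}^d$ of these eigenvalues, the primitive idempotent of $A$ associated with $\theta_i$ is $E_i=\prod_{0\le j\le d,\,j\ne i}\frac{A-\theta_jI}{\theta_i-\theta_j}$. A Leonard system in $\mathcal{A}$ is a sequence $\Phi=(A;\{E_i\}_{i=0}^d;A^*;\{E^*_i\}_{i=0}^d)$ such that $A,A^*\in\mathcal{A}$ are multiplicity-free; $\{E_i\}_{i=0}^d$ (resp. $\{E^*_i\}_{i=0}^d$) is an ordering of the primitive idempotents of $A$ (resp. $A^*$); and for $0\le i,j\le d$ both $E_iA^*E_j$ and $E^*_iAE^*_j$ are zero if $|i-j|>1$ and nonzero if $|i-j|=1$. Let $\theta_i$ (resp. $\theta^*_i$) be the eigenvalue of $A$ (resp. $A^*$) associated with $E_i$ (resp. $E^*_i$). For $0\le i\le d$ put $\tau_i=(\lambda-\theta_0)\cdots(\lambda-\theta_{i-1})$,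 $\eta_i=(\lambda-\theta_d)(\lambda-\theta_{d-1})\cdots(\lambda-\theta_{d-i+1})$, $\tau^*_i=(\lambda-\theta^*_0)\cdots(\lambda-\theta^*_{i-1})$, $\eta^*_i=(\lambda-\theta^*_d)(\lambda-\theta^*_{d-1})\cdots(\lambda-\theta^*_{d-i+1})$. The first and second split sequences of $\Phi$ are, for $1\le i\le d$, $\varphi_i=(\theta^*_0-\theta^*_i)\frac{\mathrm{tr}(\tau_i(A)E^*_0)}{\mathrm{tr}(\tau_{i-1}(A)E^*_0)}$ and $\phi_i=(\theta^*_0-\theta^*_i)\frac{\mathrm{tr}(\eta_i(A)E^*_0)}{\mathrm{tr}(\eta_{i-1}(A)E^*_0)}$ (the denominators are known to be nonzero, and all $\varphi_i,\phi_i$ are known to be nonzero). The parameter array of $\Phi$ is $(\{\theta_i\}_{i=0}^d;\{\theta^*_i\}_{i=0}^d;\{\varphi_i\}_{i=1}^d;\{\phi_i\}_{i=1}^d)$. The switching element for $\Phi$ is $S=\sum_{r=0}^d\frac{\phi_d\phi_{d-1}\cdots\phi_{d-r+1}}{\varphi_1\varphi_2\cdots\varphi_r}E_r$; it is invertible. The vectors $\tau_i(A)v^*_0$ $(0\le i\le d)$ are known to form a basis of $V$. Scalars $[r,s,t]_q$. It is known that $\frac{\theta_{i-2}-\theta_{i+1}}{\theta_{i-1}-\theta_i}$ and $\frac{\theta^*_{i-2}-\theta^*_{i+1}}{\theta^*_{i-1}-\theta^*_i}$ are equal and independent of $i$ for $2\le i\le d-1$; $q$ is a nonzero scalar in the algebraic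 closure of $\mathbb{K}$ such that $q+q^{-1}+1$ is this common value. For nonnegative integers $r,s,t$ with $r+s+t\le d$ the scalar $[r,s,t]_q\in\mathbb{K}$ is defined as follows. If at least one of $r,s,t$ is $0$ (in particular whenever $d\le2$, where $q$ plays no role), $[r,s,t]_q=1$. Otherwise: if $q\ne1$ and $q\neq-1$, $[r,s,t]_q=\frac{(q;q)_{r+s}(q;q)_{r+t}(q;q)_{s+t}}{(q;q)_r(q;q)_s(q;q)_t(q;q)_{r+s+t}}$ with $(a;q)_n=(1-a)(1-aq)\cdots(1-aq^{n-1})$; if $q=1$ and $\mathrm{char}\,\mathbb{K}\ne2$, $[r,s,t]_q=\frac{(r+s)!(r+t)!(s+t)!}{r!\,s!\,t!\,(r+s+t)!}$; if $q=-1$ and $\mathrm{char}\,\mathbb{K}\neq2$, $[r,s,t]_q=0$ when $r,s,t$ are all odd and otherwise $[r,s,t]_q=\frac{\lfloor(r+s)/2\rfloor!\,\lfloor(r+t)/2\rfloor!\,\lfloor(s+t)/2\rfloor!}{\lfloor r/2\rfloor!\,\lfloor s/2\rfloor!\,\lfloor t/2\rfloor!\,\lfloor(r+s+t)/2\rfloor!}$; if $q=1$ and $\mathrm{char}\,\mathbb{K}=2$ (then $d\le3$, so $r=s=t=1$), $[r,s,t]_q=0$. (All denominators are nonzero in $\mathbb{K}$, respectively its algebraic closure.) *)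

theory Defs
  imports
    "Jordan_Normal_Form.Char_Poly"
    "HOL-Algebra.Algebraic_Closure_Type"
begin

section \<open>Full matrix algebras and simple modules\<close>

text \<open>Multiplication and unit of the algebra are those of the class \<open>ring_1\<close>; the scalar
  multiplication is a locale parameter.\<close>

locale algebra_over_field = vector_space scaleA
  for scaleA :: "'k::field \<Rightarrow> 'a::ring_1 \<Rightarrow> 'a" +
  assumes scale_mult_left: "scaleA c x * y = scaleA c (x * y)"
    and scale_mult_right: "x * scaleA c y = scaleA c (x * y)"

text \<open>The isomorphism \<open>\<rho>\<close> onto the matrix algebra is an arbitrary one. It is used to read off
  eigenvalues and traces of elements of the algebra, which do not depend on its choice.\<close>

locale matrix_algebra = algebra_over_field scaleA
  for scaleA :: "'k::field \<Rightarrow> 'a::ring_1 \<Rightarrow> 'a" +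
  fixes d :: nat and \<rho> :: "'a \<Rightarrow> 'k mat"
  assumes rho_bij: "bij_betw \<rho> UNIV (carrier_mat (d + 1) (d + 1))"
    and rho_add: "\<rho> (x + y) = \<rho> x + \<rho> y"
    and rho_mult: "\<rho> (x * y) = \<rho> x * \<rho> y"
    and rho_one: "\<rho> 1 = 1\<^sub>m (d + 1)"
    and rho_scale: "\<rho> (scaleA c x) = c \<cdot>\<^sub>m \<rho> x"

locale left_module_over_algebra =
  alg: algebra_over_field scaleA + vs: vector_space scaleV
  for scaleA :: "'k::field \<Rightarrow> 'a::ring_1 \<Rightarrow> 'a"
    and scaleV :: "'k \<Rightarrow> 'v::ab_group_add \<Rightarrow> 'v" +
  fixes act :: "'a \<Rightarrow> 'v \<Rightarrow> 'v"
  assumes act_add_left: "act (x + y) v = act x v + act y v"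
    and act_add_right: "act x (v + w) = act x v + act x w"
    and act_mult: "act (x * y) v = act x (act y v)"
    and act_one: "act 1 v = v"
    and act_scale: "act (scaleA c x) v = scaleV c (act x v)"

text \<open>Additive subgroups stable under the action are automatically stable under scalars, because
  \<open>scaleV c v = act (scaleA c 1) v\<close>, and under negation.\<close>

definition submodule_of :: "('a \<Rightarrow> 'v::ab_group_add \<Rightarrow> 'v) \<Rightarrow> 'v set \<Rightarrow> bool" where
  "submodule_of act W \<longleftrightarrow>
     0 \<in> W \<and> (\<forall>v\<in>W. \<forall>w\<in>W. v + w \<in> W) \<and> (\<forall>x. \<forall>v\<in>W. act x v \<in> W)"

locale simple_left_module = left_module_over_algebra scaleA scaleV act
  for scaleA :: "'k::field \<Rightarrow> 'a::ring_1 \<Rightarrow> 'a"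
    and scaleV :: "'k \<Rightarrow> 'v::ab_group_add \<Rightarrow> 'v"
    and act :: "'a \<Rightarrow> 'v \<Rightarrow> 'v" +
  assumes nontrivial: "\<exists>v::'v. v \<noteq> 0"
    and simple: "submodule_of act W \<Longrightarrow> W = {0} \<or> W = UNIV"

definition (in vector_space) indexed_basis :: "nat \<Rightarrow> (nat \<Rightarrow> 'b) \<Rightarrow> bool" where
  "indexed_basis d v \<longleftrightarrow>
     inj_on v {0..d} \<and> independent (v ` {0..d}) \<and> span (v ` {0..d}) = UNIV"

definition represents ::
  "nat \<Rightarrow> ('k::field \<Rightarrow> 'v::ab_group_add \<Rightarrow> 'v) \<Rightarrow> ('a \<Rightarrow> 'v \<Rightarrow> 'v) \<Rightarrow>
   (nat \<Rightarrow> 'v) \<Rightarrow> 'k mat \<Rightarrow> 'a \<Rightarrow> bool" where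
  "represents d scaleV act v Y x \<longleftrightarrow>
     vector_space.indexed_basis scaleV d v \<and> Y \<in> carrier_mat (d + 1) (d + 1) \<and>
     (\<forall>j\<le>d. act x (v j) = (\<Sum>i=0..d. scaleV (Y $$ (i, j)) (v i)))"

definition matrix_wrt ::
  "nat \<Rightarrow> ('k::field \<Rightarrow> 'v::ab_group_add \<Rightarrow> 'v) \<Rightarrow> ('a \<Rightarrow> 'v \<Rightarrow> 'v) \<Rightarrow>
   (nat \<Rightarrow> 'v) \<Rightarrow> 'a \<Rightarrow> 'k mat" where
  "matrix_wrt d scaleV act v x = (THE Y. represents d scaleV act v Y x)"

definition lower_triangular_mat :: "'k::zero mat \<Rightarrow> bool" where
  "lower_triangular_mat Y \<longleftrightarrow> (\<forall>i<dim_row Y. \<forall>j<dim_col Y. i < j \<longrightarrow> Y $$ (i, j) = 0)"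

definition alg_inverse :: "'a::ring_1 \<Rightarrow> 'a" where
  "alg_inverse x = (THE y. x * y = 1 \<and> y * x = 1)"

definition alg_trace :: "('a \<Rightarrow> 'k::field mat) \<Rightarrow> 'a \<Rightarrow> 'k" where
  "alg_trace \<rho> x = (\<Sum>i<dim_row (\<rho> x). \<rho> x $$ (i, i))"

definition alg_poly :: "('k::field \<Rightarrow> 'a::ring_1 \<Rightarrow> 'a) \<Rightarrow> 'k poly \<Rightarrow> 'a \<Rightarrow> 'a" where
  "alg_poly scaleA p x = (\<Sum>n\<le>Polynomial.degree p. scaleA (Polynomial.coeff p n) (x ^ n))"


section \<open>Leonard systems\<close>

definition multiplicity_free :: "nat \<Rightarrow> ('a \<Rightarrow> 'k::field mat) \<Rightarrow> 'a \<Rightarrow> bool" where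
  "multiplicity_free d \<rho> A \<longleftrightarrow> card {t. eigenvalue (\<rho> A) t} = d + 1"

definition eigenvalue_ordering ::
  "nat \<Rightarrow> ('a \<Rightarrow> 'k::field mat) \<Rightarrow> 'a \<Rightarrow> (nat \<Rightarrow> 'k) \<Rightarrow> bool" where
  "eigenvalue_ordering d \<rho> A \<theta> \<longleftrightarrow> bij_betw \<theta> {0..d} {t. eigenvalue (\<rho> A) t}"

text \<open>A list product, as the algebra is not commutative; the factors commute with each other, so
  their order is immaterial.\<close>

definition primitive_idempotent ::
  "nat \<Rightarrow> ('k::field \<Rightarrow> 'a::ring_1 \<Rightarrow> 'a) \<Rightarrow> 'a \<Rightarrow> (nat \<Rightarrow> 'k) \<Rightarrow> nat \<Rightarrow> 'a" where
  "primitive_idempotent d scaleA A \<theta> i =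
     (\<Prod>j\<leftarrow>filter (\<lambda>j. j \<noteq> i) [0..<d + 1].
        scaleA (inverse (\<theta> i - \<theta> j)) (A - scaleA (\<theta> j) 1))"

text \<open>\<open>\<theta>\<close> is an ordering of the eigenvalues of \<open>A\<close>, and \<open>E i\<close> is the primitive idempotent
  associated with \<open>\<theta> i\<close>.\<close>

definition idempotents_for ::
  "nat \<Rightarrow> ('k::field \<Rightarrow> 'a::ring_1 \<Rightarrow> 'a) \<Rightarrow> ('a \<Rightarrow> 'k mat) \<Rightarrow>
   'a \<Rightarrow> (nat \<Rightarrow> 'k) \<Rightarrow> (nat \<Rightarrow> 'a) \<Rightarrow> bool" where
  "idempotents_for d scaleA \<rho> A \<theta> E \<longleftrightarrow>
     eigenvalue_ordering d \<rho> A \<theta> \<and> (\<forall>i\<le>d. E i = primitive_idempotent d scaleA A \<theta> i)"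

definition leonard_system ::
  "nat \<Rightarrow> ('k::field \<Rightarrow> 'a::ring_1 \<Rightarrow> 'a) \<Rightarrow> ('a \<Rightarrow> 'k mat) \<Rightarrow>
   'a \<Rightarrow> (nat \<Rightarrow> 'a) \<Rightarrow> 'a \<Rightarrow> (nat \<Rightarrow> 'a) \<Rightarrow> bool" where
  "leonard_system d scaleA \<rho> A E As Es \<longleftrightarrow>
     multiplicity_free d \<rho> A \<and> multiplicity_free d \<rho> As \<and>
     (\<exists>\<theta>. idempotents_for d scaleA \<rho> A \<theta> E) \<and>
     (\<exists>\<theta>s. idempotents_for d scaleA \<rho> As \<theta>s Es) \<and>
     (\<forall>i\<le>d. \<forall>j\<le>d.
        (\<bar>int i - int j\<bar> > 1 \<longrightarrow> E i * As * E j = 0 \<and> Es i * A * Es j = 0) \<and>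
        (\<bar>int i - int j\<bar> = 1 \<longrightarrow> E i * As * E j \<noteq> 0 \<and> Es i * A * Es j \<noteq> 0))"

definition tau_poly :: "(nat \<Rightarrow> 'k::field) \<Rightarrow> nat \<Rightarrow> 'k poly" where
  "tau_poly \<theta> i = (\<Prod>h<i. [:- \<theta> h, 1:])"

definition eta_poly :: "nat \<Rightarrow> (nat \<Rightarrow> 'k::field) \<Rightarrow> nat \<Rightarrow> 'k poly" where
  "eta_poly d \<theta> i = (\<Prod>h<i. [:- \<theta> (d - h), 1:])"

text \<open>\<open>vphi\<close> and \<open>phi\<close> are the first and second split sequence; only their values at
  \<open>1, \<dots>, d\<close> matter.\<close>

definition parameter_array ::
  "nat \<Rightarrow> ('k::field \<Rightarrow> 'a::ring_1 \<Rightarrow> 'a) \<Rightarrow> ('a \<Rightarrow> 'k mat) \<Rightarrow>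
   'a \<Rightarrow> (nat \<Rightarrow> 'a) \<Rightarrow> 'a \<Rightarrow> (nat \<Rightarrow> 'a) \<Rightarrow>
   (nat \<Rightarrow> 'k) \<Rightarrow> (nat \<Rightarrow> 'k) \<Rightarrow> (nat \<Rightarrow> 'k) \<Rightarrow> (nat \<Rightarrow> 'k) \<Rightarrow> bool" where
  "parameter_array d scaleA \<rho> A E As Es \<theta> \<theta>s vphi phi \<longleftrightarrow>
     idempotents_for d scaleA \<rho> A \<theta> E \<and> idempotents_for d scaleA \<rho> As \<theta>s Es \<and>
     (\<forall>i\<in>{1..d}.
        vphi i = (\<theta>s 0 - \<theta>s i) *
          (alg_trace \<rho> (alg_poly scaleA (tau_poly \<theta> i) A * Es 0) /
           alg_trace \<rho> (alg_poly scaleA (tau_poly \<theta> (i - 1)) A * Es 0)) \<and>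
        phi i = (\<theta>s 0 - \<theta>s i) *
          (alg_trace \<rho> (alg_poly scaleA (eta_poly d \<theta> i) A * Es 0) /
           alg_trace \<rho> (alg_poly scaleA (eta_poly d \<theta> (i - 1)) A * Es 0)))"

definition switching_element ::
  "nat \<Rightarrow> ('k::field \<Rightarrow> 'a::ring_1 \<Rightarrow> 'a) \<Rightarrow> (nat \<Rightarrow> 'a) \<Rightarrow>
   (nat \<Rightarrow> 'k) \<Rightarrow> (nat \<Rightarrow> 'k) \<Rightarrow> 'a" where
  "switching_element d scaleA E vphi phi =
     (\<Sum>r=0..d. scaleA ((\<Prod>h<r. phi (d - h)) / (\<Prod>h=1..r. vphi h)) (E r))"


section \<open>The scalars \<open>[r,s,t]\<^sub>q\<close>\<close>

text \<open>For \<open>d \<le> 2\<close> the quantifier is empty and \<open>q\<close> is an arbitrary nonzero scalar.\<close>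

definition admissible_q ::
  "nat \<Rightarrow> (nat \<Rightarrow> 'k::field) \<Rightarrow> (nat \<Rightarrow> 'k) \<Rightarrow> 'k alg_closure \<Rightarrow> bool" where
  "admissible_q d \<theta> \<theta>s q \<longleftrightarrow> q \<noteq> 0 \<and>
     (\<forall>i. 2 \<le> i \<and> i + 1 \<le> d \<longrightarrow>
        to_ac ((\<theta> (i - 2) - \<theta> (i + 1)) / (\<theta> (i - 1) - \<theta> i)) = q + inverse q + 1 \<and>
        to_ac ((\<theta>s (i - 2) - \<theta>s (i + 1)) / (\<theta>s (i - 1) - \<theta>s i)) = q + inverse q + 1)"

definition q_pochhammer :: "'b::field \<Rightarrow> 'b \<Rightarrow> nat \<Rightarrow> 'b" where
  "q_pochhammer a q n = (\<Prod>k<n. 1 - a * q ^ k)"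

text \<open>In the generic case the quotient is formed in the algebraic closure; it lies in the image of
  the base field, and \<open>of_ac\<close> takes it back. The last branch is \<open>q = 1\<close> in characteristic 2
  (where \<open>1 = -1\<close>).\<close>

definition q_bracket :: "'k::field alg_closure \<Rightarrow> nat \<Rightarrow> nat \<Rightarrow> nat \<Rightarrow> 'k" where
  "q_bracket q r s t =
     (if r = 0 \<or> s = 0 \<or> t = 0 then 1
      else if q \<noteq> 1 \<and> q \<noteq> -1 then
        of_ac ((q_pochhammer q q (r + s) * q_pochhammer q q (r + t) * q_pochhammer q q (s + t)) /
          (q_pochhammer q q r * q_pochhammer q q s * q_pochhammer q q t *
           q_pochhammer q q (r + s + t)))
      else if q = 1 \<and> CHAR('k) \<noteq> 2 then
        of_nat (fact (r + s) * fact (r + t) * fact (s + t)) /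
        of_nat (fact r * fact s * fact t * fact (r + s + t))
      else if q = -1 \<and> CHAR('k) \<noteq> 2 then
        (if odd r \<and> odd s \<and> odd t then 0
         else of_nat (fact ((r + s) div 2) * fact ((r + t) div 2) * fact ((s + t) div 2)) /
              of_nat (fact (r div 2) * fact (s div 2) * fact (t div 2) *
                      fact ((r + s + t) div 2)))
      else 0)"

end

theory Submission
  imports Defs
begin

text \<open>
  The vectors \<open>E\<^sub>r v\<^sub>0\<close> form a basis of \<open>V\<close>. In the coordinates it provides, \<open>V\<close> consists of
  functions on \<open>{0..d}\<close>, \<open>p(A) v\<^sub>0\<close> is the function \<open>r \<mapsto> p(\<theta>\<^sub>r)\<close>, \<open>A\<close> multiplies by \<open>\<theta>\<close>, \<open>S\<close>
  multiplies by a function \<open>s\<close>, and \<open>A\<^sup>*\<close> is a tridiagonal matrix \<open>T\<close>. Both families \<open>\<tau>\<^sub>i\<close> and \<open>\<eta>\<^sub>i\<close>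
  make \<open>T\<close> bidiagonal, with the two split sequences as off-diagonal entries. The bilinear form with
  weights \<open>1 / (s\<^sub>r \<omega>\<^sub>r)\<close>, where \<open>\<omega>\<^sub>r\<close> is the product of the \<open>\<theta>\<^sub>r - \<theta>\<^sub>k\<close> over \<open>k \<noteq> r\<close>, makes \<open>T\<close>
  self-adjoint, and by Lagrange interpolation \<open>s \<tau>\<^sub>j\<close> is dual to \<open>\<eta>\<^sub>d\<^sub>-\<^sub>j\<close>. Hence \<open>T\<close> is also
  bidiagonal on the functions \<open>s \<tau>\<^sub>j\<close>, with diagonal \<open>\<theta>\<^sup>*\<^sub>d\<^sub>-\<^sub>j\<close>. Comparing this with the action of
  \<open>T\<close> on the expansion \<open>s \<tau>\<^sub>j = \<Sum>\<^sub>i M\<^sub>i\<^sub>j \<tau>\<^sub>i\<close> gives a recurrence that determines \<open>M\<close>. The claimed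
  entries satisfy it because of an identity relating \<open>[r,s,t]\<^sub>q\<close> to the \<open>\<theta>\<^sup>*\<^sub>i\<close> alone. Exchanging
  the roles of \<open>\<tau>\<^sub>j\<close> and \<open>s \<tau>\<^sub>j\<close>, and reversing the order of the \<open>\<theta>\<^sup>*\<^sub>i\<close>, gives the inverse.
\<close>

section \<open>The scalars \<open>[r,s,t]\<^sub>q\<close>\<close>

definition gfact :: "(nat \<Rightarrow> 'b::field) \<Rightarrow> nat \<Rightarrow> 'b" where
  "gfact g n = (\<Prod>k<n. g (Suc k))"

text \<open>The nonzero branches of \<open>q_bracket\<close> become instances:
  \<open>g k = 1 - q ^ k\<close>, \<open>g = of_nat\<close>, and \<open>g = half_int\<close> away
  from the all-odd triples.\<close>

definition gbracket :: "(nat \<Rightarrow> 'b::field) \<Rightarrow> nat \<Rightarrow> nat \<Rightarrow> nat \<Rightarrow> 'b" where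
  "gbracket g r s t = gfact g (r + s) * gfact g (r + t) * gfact g (s + t) /
     (gfact g r * gfact g s * gfact g t * gfact g (r + s + t))"

lemma gfact_0 [simp]: "gfact g 0 = 1"
  by (simp add: gfact_def)

lemma gfact_Suc [simp]: "gfact g (Suc n) = gfact g n * g (Suc n)"
  by (simp add: gfact_def)

lemma gfact_nonzero: "(\<And>k. 1 \<le> k \<Longrightarrow> k \<le> n \<Longrightarrow> g k \<noteq> 0) \<Longrightarrow> gfact g n \<noteq> 0"
  by (auto simp: gfact_def)

lemma gbracket_eq_1:
  assumes "\<And>k. 1 \<le> k \<Longrightarrow> k \<le> r + s + t \<Longrightarrow> g k \<noteq> 0" and "r = 0 \<or> s = 0 \<or> t = 0"
  shows "gbracket g r s t = 1"
proof -
  have "gfact g n \<noteq> 0" if "n \<le> r + s + t" for n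
    using assms(1) that by (intro gfact_nonzero) auto
  then show ?thesis
    using assms(2) by (auto simp: gbracket_def)
qed

text \<open>After division by \<open>gbracket g (Suc r) s (Suc t)\<close> only ratios of
  neighbouring factorials survive, so the identity is available for every nonvanishing
  \<open>g\<close>. The cases of \<open>q\<close> differ only in how the difference of products on
  the right factors.\<close>

lemma gbracket_rec:
  assumes nz: "\<And>k. 1 \<le> k \<Longrightarrow> k \<le> Suc r + s + Suc t \<Longrightarrow> g k \<noteq> 0"
  shows "g (Suc r + Suc t) * g (Suc s) *
           (gbracket g (Suc r) (Suc s) t - gbracket g r (Suc s) (Suc t)) =
         (g (Suc r + Suc s) * g (Suc t) - g (Suc s + Suc t) * g (Suc r)) *
           gbracket g (Suc r) s (Suc t)"
proof -
  have f: "gfact g n \<noteq> 0" if "n \<le> Suc r + s + Suc t" for n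
    using nz that by (intro gfact_nonzero) auto
  have *: "gfact g r \<noteq> 0" "gfact g s \<noteq> 0" "gfact g t \<noteq> 0" "gfact g (r + s + t) \<noteq> 0"
    "g (Suc r) \<noteq> 0" "g (Suc s) \<noteq> 0" "g (Suc t) \<noteq> 0" "g (Suc (r + s + t)) \<noteq> 0"
    "g (Suc (Suc (r + s + t))) \<noteq> 0"
    by (auto intro!: f simp: nz)
  show ?thesis
    using * by (simp add: gbracket_def divide_simps) (simp add: algebra_simps)
qed

text \<open>The relation that makes the claimed matrix entries satisfy the recurrence imposed by \<open>A\<^sup>*\<close>;
  it involves neither split sequence.\<close>

definition bracket_relation :: "nat \<Rightarrow> (nat \<Rightarrow> 'b::field) \<Rightarrow> (nat \<Rightarrow> nat \<Rightarrow> nat \<Rightarrow> 'b) \<Rightarrow> bool" where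
  "bracket_relation d x br \<longleftrightarrow> (\<forall>r s t. Suc r + s + Suc t = d \<longrightarrow>
     (x d - x s) * (br (Suc r) (Suc s) t - br r (Suc s) (Suc t)) =
     (x (s + Suc t) - x (s + Suc r)) * br (Suc r) s (Suc t))"

section \<open>Closed forms for the third-order recurrence of the dual eigenvalues\<close>

lemma third_order_unique:
  fixes x y :: "nat \<Rightarrow> 'b::field"
  assumes "\<And>i. i + 3 \<le> d \<Longrightarrow> x (i + 3) = x i - c * (x (i + 1) - x (i + 2))"
    and "\<And>i. i + 3 \<le> d \<Longrightarrow> y (i + 3) = y i - c * (y (i + 1) - y (i + 2))"
    and "x 0 = y 0" "x 1 = y 1" "x 2 = y 2"
  shows "i \<le> d \<Longrightarrow> x i = y i"
proof (induction i rule: less_induct)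
  case (less i)
  show ?case
  proof (cases "i < 3")
    case True
    then have "i = 0 \<or> i = 1 \<or> i = 2" by arith
    then show ?thesis using assms(3-5) by auto
  next
    case False
    then obtain k where "i = k + 3" by (metis add.commute le_Suc_ex not_less)
    then show ?thesis
      using less assms(1)[of k] assms(2)[of k] by simp
  qed
qed

text \<open>The characteristic roots are \<open>1\<close>, \<open>q\<close> and
  \<open>inverse q\<close>, distinct under these hypotheses; three initial values then fix the
  coefficients.\<close>

lemma closed_form_generic:
  fixes x :: "nat \<Rightarrow> 'b::field"
  assumes rec: "\<And>i. i + 3 \<le> d \<Longrightarrow> x (i + 3) = x i - (q + inverse q + 1) * (x (i + 1) - x (i + 2))"
    and q: "q \<noteq> 0" "q \<noteq> 1" "q \<noteq> -1"
  obtains a b c where "\<And>i. i \<le> d \<Longrightarrow> x i = a + b * q ^ i + c / q ^ i"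
proof -
  define D0 D1 where "D0 = x 1 - x 0" and "D1 = x 2 - x 1"
  \<comment> \<open>Solution of the linear system that matches the first differences
    \<open>D0\<close> and \<open>D1\<close>; afterwards \<open>a\<close> adjusts the value at
    0.\<close>
  define b c where "b = (q * D1 - D0) / ((q\<^sup>2 - 1) * (q - 1))"
    and "c = (q * D0 - D1) * q\<^sup>2 / ((q\<^sup>2 - 1) * (1 - q))"
  define a where "a = x 0 - b - c"
  have q2: "q\<^sup>2 - 1 \<noteq> 0" "q - 1 \<noteq> 0" "1 - q \<noteq> 0"
    using q by (auto simp: power2_eq_1_iff)
  have e1: "x 1 = a + b * q ^ 1 + c / q ^ 1"
  proof -
    have "b * (q - 1) + c * (1 - q) / q = D0"
      using q2 q(1) unfolding b_def c_def by (simp add: divide_simps) (simp add: algebra_simps power2_eq_square)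
    then show ?thesis
      using q(1) unfolding a_def D0_def by (simp add: field_simps)
  qed
  have e2: "x 2 = a + b * q ^ 2 + c / q ^ 2"
  proof -
    have "b * q * (q - 1) + c * (1 - q) / q\<^sup>2 = D1"
      using q2 q(1) unfolding b_def c_def by (simp add: divide_simps) (simp add: algebra_simps power2_eq_square)
    then have "x 2 = x 1 + b * q * (q - 1) + c * (1 - q) / q\<^sup>2"
      unfolding D1_def by (simp add: algebra_simps)
    then show ?thesis
      using q(1) unfolding e1 by (simp add: divide_simps power2_eq_square) (simp add: algebra_simps)
  qed
  have "x i = a + b * q ^ i + c / q ^ i" if "i \<le> d" for i
  proof (rule third_order_unique[where d = d and c = "q + inverse q + 1" and y = "\<lambda>i. a + b * q ^ i + c / q ^ i"])
    fix i assume "i + 3 \<le> d"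
    show "a + b * q ^ (i + 3) + c / q ^ (i + 3) = a + b * q ^ i + c / q ^ i - (q + inverse q + 1) *
       (a + b * q ^ (i + 1) + c / q ^ (i + 1) - (a + b * q ^ (i + 2) + c / q ^ (i + 2)))"
      using q(1) by (simp add: divide_simps power_add power2_eq_square power3_eq_cube) (simp add: algebra_simps)
  qed (use that rec e1 e2 in \<open>auto simp: a_def\<close>)
  then show ?thesis using that by blast
qed

text \<open>The root \<open>1\<close> is triple. With \<open>i choose 2\<close> in place of the
  square of \<open>i\<close> nothing has to be divided by 2, so the form also serves characteristic
  2.\<close>

lemma closed_form_one:
  fixes x :: "nat \<Rightarrow> 'b::field"
  assumes rec: "\<And>i. i + 3 \<le> d \<Longrightarrow> x (i + 3) = x i - 3 * (x (i + 1) - x (i + 2))"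
  obtains a b c where "\<And>i. i \<le> d \<Longrightarrow> x i = a + b * of_nat i + c * of_nat (i choose 2)"
proof -
  define a b c where "a = x 0" and "b = x 1 - x 0" and "c = x 2 - 2 * x 1 + x 0"
  have ch: "(Suc i choose 2) = (i choose 2) + i" for i
    by (simp add: numeral_2_eq_2)
  have "x i = a + b * of_nat i + c * of_nat (i choose 2)" if "i \<le> d" for i
  proof (rule third_order_unique[where d = d and c = 3 and y = "\<lambda>i. a + b * of_nat i + c * of_nat (i choose 2)"])
    fix i assume "i + 3 \<le> d"
    show "a + b * of_nat (i + 3) + c * of_nat (i + 3 choose 2) =
      a + b * of_nat i + c * of_nat (i choose 2) - 3 *
       (a + b * of_nat (i + 1) + c * of_nat (i + 1 choose 2) - (a + b * of_nat (i + 2) + c * of_nat (i + 2 choose 2)))"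
      by (simp add: ch numeral_3_eq_3 algebra_simps)
  qed (use that rec in \<open>auto simp: a_def b_def c_def algebra_simps binomial_eq_0\<close>)
  then show ?thesis using that by blast
qed

text \<open>The roots are \<open>1\<close> and a double \<open>-1\<close>, which brings in the
  linear factor; solving for the coefficients divides by 2.\<close>

lemma closed_form_minus_one:
  fixes x :: "nat \<Rightarrow> 'b::field"
  assumes rec: "\<And>i. i + 3 \<le> d \<Longrightarrow> x (i + 3) = x i + (x (i + 1) - x (i + 2))"
    and two: "(2::'b) \<noteq> 0"
  obtains a b c where "\<And>i. i \<le> d \<Longrightarrow> x i = a + (-1) ^ i * (b + c * of_nat i)"
proof -
  define c where "c = (x 2 - x 0) / 2"
  define b where "b = (x 0 - x 1 - c) / 2"
  define a where "a = x 0 - b"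
  have "2 * c = x 2 - x 0" "2 * b = x 0 - x 1 - c"
    using two by (auto simp: c_def b_def)
  then have e: "x 2 = x 0 + 2 * c" "x 1 = x 0 - c - 2 * b"
    by (auto simp: algebra_simps)
  have "x i = a + (-1) ^ i * (b + c * of_nat i)" if "i \<le> d" for i
  proof (rule third_order_unique[where d = d and c = "-1" and y = "\<lambda>i. a + (-1) ^ i * (b + c * of_nat i)"])
    fix i assume "i + 3 \<le> d"
    show "a + (-1) ^ (i + 3) * (b + c * of_nat (i + 3)) =
      a + (-1) ^ i * (b + c * of_nat i) - (-1) *
       (a + (-1) ^ (i + 1) * (b + c * of_nat (i + 1)) - (a + (-1) ^ (i + 2) * (b + c * of_nat (i + 2))))"
      by (simp add: power_add algebra_simps)
  qed (use that rec e in \<open>auto simp: a_def algebra_simps\<close>)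
  then show ?thesis using that by blast
qed

section \<open>The bracket relation for each closed form\<close>

text \<open>A difference \<open>x i - x j\<close> is \<open>q ^ i - q ^ j\<close> times a factor
  that depends only on \<open>i + j\<close>. Both differences in the relation have index sum
  \<open>d + s\<close>, so they share this factor, and what remains is \<open>gbracket_rec\<close>.
  Injectivity of \<open>x\<close> excludes \<open>q ^ k = 1\<close>.\<close>

lemma bracket_relation_generic:
  fixes x :: "nat \<Rightarrow> 'b::field"
  assumes x: "\<And>i. i \<le> d \<Longrightarrow> x i = a + b * q ^ i + c / q ^ i"
    and inj: "inj_on x {..d}" and q: "q \<noteq> 0"
  shows "\<And>k. 1 \<le> k \<Longrightarrow> k \<le> d \<Longrightarrow> 1 - q ^ k \<noteq> 0"
    and "bracket_relation d x (gbracket (\<lambda>k. 1 - q ^ k))"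
proof -
  have diff: "x i - x j = (q ^ i - q ^ j) * (b - c / q ^ (i + j))" if "i \<le> d" "j \<le> d" for i j
    using that q by (simp add: x[of i] x[of j] field_simps power_add)
  show nz: "1 - q ^ k \<noteq> 0" if "1 \<le> k" "k \<le> d" for k
  proof
    assume "1 - q ^ k = 0"
    then have "x k - x 0 = 0"
      using that diff[of k 0] by simp
    then show False
      using inj that by (auto dest: inj_onD)
  qed
  show "bracket_relation d x (gbracket (\<lambda>k. 1 - q ^ k))"
    unfolding bracket_relation_def
  proof (intro allI impI)
    fix r s t assume d: "Suc r + s + Suc t = d"
    let ?g = "\<lambda>k. 1 - q ^ k"
    let ?\<Delta> = "gbracket ?g (Suc r) (Suc s) t - gbracket ?g r (Suc s) (Suc t)"
    let ?B = "gbracket ?g (Suc r) s (Suc t)"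
    have rec: "?g (Suc r + Suc t) * ?g (Suc s) * ?\<Delta> =
      (?g (Suc r + Suc s) * ?g (Suc t) - ?g (Suc s + Suc t) * ?g (Suc r)) * ?B"
      by (rule gbracket_rec) (use nz d in auto)
    \<comment> \<open>The factor \<open>1 - q ^ Suc s\<close> splits off here and cancels against
      the one on the left of \<open>rec\<close>.\<close>
    have "?g (Suc r + Suc s) * ?g (Suc t) - ?g (Suc s + Suc t) * ?g (Suc r) =
      (q ^ Suc r - q ^ Suc t) * ?g (Suc s)"
      by (simp add: algebra_simps power_add)
    with rec have "?g (Suc s) * (?g (Suc r + Suc t) * ?\<Delta>) = ?g (Suc s) * ((q ^ Suc r - q ^ Suc t) * ?B)"
      by (simp add: mult_ac)
    then have key: "?g (Suc r + Suc t) * ?\<Delta> = (q ^ Suc r - q ^ Suc t) * ?B"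
      using nz[of "Suc s"] d by (simp del: power_Suc)
    let ?e = "b - c / q ^ (d + s)"
    have "x d - x s = - (q ^ s) * ?g (Suc r + Suc t) * ?e"
      using diff[of d s] d by (simp add: algebra_simps power_add flip: d)
    moreover have "x (s + Suc t) - x (s + Suc r) = - (q ^ s) * (q ^ Suc r - q ^ Suc t) * ?e"
    proof -
      have "s + Suc t + (s + Suc r) = d + s" using d by simp
      then have "x (s + Suc t) - x (s + Suc r) = (q ^ (s + Suc t) - q ^ (s + Suc r)) * ?e"
        using diff[of "s + Suc t" "s + Suc r"] d by (simp only:)
      also have "q ^ (s + Suc t) - q ^ (s + Suc r) = - (q ^ s) * (q ^ Suc r - q ^ Suc t)"
        by (simp add: algebra_simps power_add)
      finally show ?thesis .
    qed
    ultimately have "(x d - x s) * ?\<Delta> = - (q ^ s) * ?e * (?g (Suc r + Suc t) * ?\<Delta>)"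
      and "(x (s + Suc t) - x (s + Suc r)) * ?B = - (q ^ s) * ?e * ((q ^ Suc r - q ^ Suc t) * ?B)"
      by (simp_all only: mult_ac)
    then show "(x d - x s) * ?\<Delta> = (x (s + Suc t) - x (s + Suc r)) * ?B"
      by (simp only: key)
  qed
qed

text \<open>Again a difference of \<open>x\<close> is the index difference times a function of the
  index sum, here after doubling, which clears the binomial coefficient.\<close>

lemma bracket_relation_one:
  fixes x :: "nat \<Rightarrow> 'b::field"
  assumes x: "\<And>i. i \<le> d \<Longrightarrow> x i = a + b * of_nat i + c * of_nat (i choose 2)"
    and inj: "inj_on x {..d}" and two: "(2::'b) \<noteq> 0"
  shows "\<And>k. 1 \<le> k \<Longrightarrow> k \<le> d \<Longrightarrow> of_nat k \<noteq> (0::'b)"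
    and "bracket_relation d x (gbracket of_nat)"
proof -
  have ch: "2 * of_nat (i choose 2) = (of_nat i * (of_nat i - 1) :: 'b)" for i
    by (induction i) (auto simp: numeral_2_eq_2 algebra_simps)
  have diff: "2 * (x i - x j) = (of_nat i - of_nat j) * (2 * b + c * (of_nat (i + j) - 1))"
    if "i \<le> d" "j \<le> d" for i j
  proof -
    have "2 * (x i - x j) = 2 * b * (of_nat i - of_nat j) + c * (2 * of_nat (i choose 2) - 2 * of_nat (j choose 2))"
      using that x by (simp add: algebra_simps)
    also have "\<dots> = (of_nat i - of_nat j) * (2 * b + c * (of_nat (i + j) - 1))"
      unfolding ch by (simp add: algebra_simps)
    finally show ?thesis .
  qed
  show nz: "of_nat k \<noteq> (0::'b)" if "1 \<le> k" "k \<le> d" for k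
  proof
    assume "of_nat k = (0::'b)"
    then have "x k - x 0 = 0"
      using that diff[of k 0] two by simp
    then show False
      using inj that by (auto dest: inj_onD)
  qed
  show "bracket_relation d x (gbracket of_nat)"
    unfolding bracket_relation_def
  proof (intro allI impI)
    fix r s t assume d: "Suc r + s + Suc t = d"
    let ?g = "of_nat :: nat \<Rightarrow> 'b"
    let ?\<Delta> = "gbracket ?g (Suc r) (Suc s) t - gbracket ?g r (Suc s) (Suc t)"
    let ?B = "gbracket ?g (Suc r) s (Suc t)"
    have rec: "?g (Suc r + Suc t) * ?g (Suc s) * ?\<Delta> =
      (?g (Suc r + Suc s) * ?g (Suc t) - ?g (Suc s + Suc t) * ?g (Suc r)) * ?B"
      by (rule gbracket_rec) (use nz d in auto)
    have "?g (Suc r + Suc s) * ?g (Suc t) - ?g (Suc s + Suc t) * ?g (Suc r) =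
      (?g t - ?g r) * ?g (Suc s)"
      by (simp add: algebra_simps)
    with rec have "?g (Suc s) * (?g (Suc r + Suc t) * ?\<Delta>) = ?g (Suc s) * ((?g t - ?g r) * ?B)"
      by (simp only: mult_ac)
    then have key: "?g (Suc r + Suc t) * ?\<Delta> = (?g t - ?g r) * ?B"
      using nz[of "Suc s"] d by (simp del: of_nat_Suc)
    let ?e = "2 * b + c * (of_nat (d + s) - 1)"
    have "2 * (x d - x s) = ?g (Suc r + Suc t) * ?e"
      using diff[of d s] d by (simp flip: d)
    moreover have "2 * (x (s + Suc t) - x (s + Suc r)) = (?g t - ?g r) * ?e"
    proof -
      have "s + Suc t + (s + Suc r) = d + s" using d by simp
      then show ?thesis
        using diff[of "s + Suc t" "s + Suc r"] d by (simp only:) (simp add: algebra_simps)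
    qed
    ultimately have "2 * (x d - x s) * ?\<Delta> = ?e * (?g (Suc r + Suc t) * ?\<Delta>)"
      and "2 * (x (s + Suc t) - x (s + Suc r)) * ?B = ?e * ((?g t - ?g r) * ?B)"
      by (simp_all only: mult_ac)
    then have "2 * ((x d - x s) * ?\<Delta>) = 2 * ((x (s + Suc t) - x (s + Suc r)) * ?B)"
      by (simp only: key mult.assoc)
    then show "(x d - x s) * ?\<Delta> = (x (s + Suc t) - x (s + Suc r)) * ?B"
      using two by simp
  qed
qed

text \<open>For \<open>q = -1\<close> the \<open>q\<close>-integer of an odd number is taken to be \<open>1\<close> and that of \<open>2m\<close> to be \<open>m\<close>.\<close>

definition half_int :: "nat \<Rightarrow> 'b::field" where
  "half_int k = (if odd k then 1 else of_nat (k div 2))"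

lemma gfact_half_int: "gfact half_int n = of_nat (fact (n div 2))"
proof (induction n)
  case (Suc n)
  then show ?case
    by (cases "odd n") (auto simp: half_int_def algebra_simps elim!: oddE evenE)
qed simp

text \<open>Formally, as \<open>q\<close> tends to \<open>-1\<close>, an all-odd triple has two more
  vanishing factors of even index in the numerator than in the denominator. Since
  \<open>half_int\<close> keeps only the finite parts of such factors, the zero is imposed by
  hand.\<close>

definition odd_bracket :: "nat \<Rightarrow> nat \<Rightarrow> nat \<Rightarrow> 'b::field" where
  "odd_bracket r s t = (if odd r \<and> odd s \<and> odd t then 0 else gbracket half_int r s t)"

lemma half_int_double: "(2::'b::field) \<noteq> 0 \<Longrightarrow> even k \<Longrightarrow> half_int k = (of_nat k / 2 :: 'b)"
  by (auto simp: half_int_def elim!: evenE)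

text \<open>The closed form alternates with the parity of the index, so the proof splits by the
  parity of \<open>r + t\<close>, which is that of \<open>d - s\<close>. Doubling
  \<open>half_int\<close> at even arguments gives ordinary integers and removes the
  fractions.\<close>

lemma bracket_relation_minus_one:
  fixes x :: "nat \<Rightarrow> 'b::field"
  assumes x: "\<And>i. i \<le> d \<Longrightarrow> x i = a + (-1) ^ i * (b + c * of_nat i)"
    and inj: "inj_on x {..d}" and two: "(2::'b) \<noteq> 0"
  shows "\<And>k. 1 \<le> k \<Longrightarrow> k \<le> d \<Longrightarrow> half_int k \<noteq> (0::'b)"
    and "bracket_relation d x odd_bracket"
proof -
  show nz: "half_int k \<noteq> (0::'b)" if k: "1 \<le> k" "k \<le> d" for k
  proof
    assume *: "half_int k = (0::'b)"
    then have "even k" by (auto simp: half_int_def split: if_splits)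
    then have "of_nat k = (0::'b)" using * two by (simp add: half_int_double)
    then have "x k - x 0 = 0"
      using k x[of k] x[of 0] \<open>even k\<close> by simp
    then show False
      using inj k by (auto dest: inj_onD)
  qed
  show "bracket_relation d x odd_bracket"
    unfolding bracket_relation_def
  proof (intro allI impI)
    fix r s t assume d: "Suc r + s + Suc t = d"
    let ?g = "half_int :: nat \<Rightarrow> 'b"
    let ?\<Delta>' = "gbracket ?g (Suc r) (Suc s) t - gbracket ?g r (Suc s) (Suc t)"
    let ?\<Delta> = "odd_bracket (Suc r) (Suc s) t - odd_bracket r (Suc s) (Suc t) :: 'b"
    let ?B' = "gbracket ?g (Suc r) s (Suc t)"
    let ?B = "odd_bracket (Suc r) s (Suc t) :: 'b"
    have rec: "?g (Suc r + Suc t) * ?g (Suc s) * ?\<Delta>' =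
      (?g (Suc r + Suc s) * ?g (Suc t) - ?g (Suc s + Suc t) * ?g (Suc r)) * ?B'"
      by (rule gbracket_rec) (use nz d in auto)
    have nz': "?g (Suc r + Suc t) \<noteq> 0" "?g (Suc s) \<noteq> 0"
      by (rule nz; use d in simp)+
    have f: "gfact ?g n \<noteq> 0" if "n \<le> d" for n
      using nz that by (intro gfact_nonzero) auto
    have xd: "x d = a + (-1) ^ d * (b + c * of_nat d)" "x s = a + (-1) ^ s * (b + c * of_nat s)"
      "x (s + Suc t) = a + (-1) ^ (s + Suc t) * (b + c * of_nat (s + Suc t))"
      "x (s + Suc r) = a + (-1) ^ (s + Suc r) * (b + c * of_nat (s + Suc r))"
      by (rule x; use d in simp)+
    have G1: "?g k = 1" if "odd k" for k
      using that by (simp add: half_int_def)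
    have G2: "2 * ?g k = of_nat k" if "even k" for k
      using that two by (simp add: half_int_double)
    \<comment> \<open>This sign lets even and odd \<open>r\<close> share one formula.\<close>
    define \<epsilon> :: 'b where "\<epsilon> = (-1) ^ r"
    have \<epsilon>: "\<epsilon> = (if even r then 1 else -1)" by (simp add: \<epsilon>_def)
    show "(x d - x s) * ?\<Delta> = (x (s + Suc t) - x (s + Suc r)) * ?B"
    proof (cases "even (r + t)")
      case False
      have e: "x (s + Suc t) - x (s + Suc r) = - \<epsilon> * (x d - x s)"
        unfolding xd using False
        by (cases "even r"; cases "even s"; simp add: \<epsilon> algebra_simps flip: d)
      have "?\<Delta> = - \<epsilon> * ?B"
      \<comment> \<open>For even \<open>s\<close> exactly one of the two brackets in the difference
        is all-odd and vanishes; for odd \<open>s\<close> none of the three brackets is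
        all-odd.\<close>
      proof (cases "even s")
        case True
        then show ?thesis
          using False f[of r] f[of s] f[of t] f[of "r + s + t"] d nz[of "Suc r"] nz[of "Suc t"] nz[of d]
          by (cases "even r") (auto simp: \<epsilon> odd_bracket_def gbracket_def G1 simp flip: d)
      next
        case s: False
        have "2 * (?g (Suc r + Suc s) * ?g (Suc t) - ?g (Suc s + Suc t) * ?g (Suc r)) = - \<epsilon> * (2 * ?g (Suc s))"
          using False s by (cases "even r") (simp_all add: \<epsilon> G1 G2 right_diff_distrib mult.assoc[symmetric])
        then have "2 * (?g (Suc r + Suc s) * ?g (Suc t) - ?g (Suc s + Suc t) * ?g (Suc r)) = 2 * (- \<epsilon> * ?g (Suc s))"
          by (simp only: mult_ac)
        then have N: "?g (Suc r + Suc s) * ?g (Suc t) - ?g (Suc s + Suc t) * ?g (Suc r) = - \<epsilon> * ?g (Suc s)"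
          using two by (subst (asm) mult_cancel_left) simp
        have "?g (Suc r + Suc t) = 1" using False by (intro G1) auto
        with rec N have "?g (Suc s) * ?\<Delta>' = ?g (Suc s) * (- \<epsilon> * ?B')"
          by (simp only: mult_ac mult_1_left)
        then have "?\<Delta>' = - \<epsilon> * ?B'" using nz'(2) by (metis mult_left_cancel)
        then show ?thesis using s False by (auto simp: odd_bracket_def)
      qed
      then show ?thesis using e by simp
    next
      case True
      let ?n = "of_nat (Suc r + Suc t) :: 'b"
      let ?m = "- \<epsilon> * (of_nat t - of_nat r) :: 'b"
      have n: "2 * ?g (Suc r + Suc t) = ?n" using True by (intro G2) auto
      then have n0: "?n \<noteq> 0" using two nz' by (metis mult_eq_0_iff)
      have e: "?n * (x (s + Suc t) - x (s + Suc r)) = ?m * (x d - x s)"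
        unfolding xd using True
        by (cases "even r"; cases "even s"; simp add: \<epsilon> algebra_simps flip: d)
      have "?n * ?\<Delta> = ?m * ?B"
      proof (cases "odd s \<and> even r")
        \<comment> \<open>Here \<open>t\<close> is even as well, so the bracket on the right is
          all-odd, hence zero, and the numerator in \<open>rec\<close> is
          \<open>1 - 1\<close>.\<close>
        case sr: True
        with True have "?g (Suc r + Suc s) = 1" "?g (Suc s + Suc t) = 1" "?g (Suc r) = 1" "?g (Suc t) = 1"
          by (auto intro!: G1)
        with rec nz' have "?\<Delta>' = 0" by auto
        with sr True show ?thesis by (auto simp: odd_bracket_def)
      next
        case False
        \<comment> \<open>The factor 4 provides a 2 for each of the two half-integers in a
          product.\<close>
        have N: "4 * (?g (Suc r + Suc s) * ?g (Suc t) - ?g (Suc s + Suc t) * ?g (Suc r)) = ?m * (2 * ?g (Suc s))"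
        proof (cases "even s")
          case s: True
          show ?thesis
          proof (cases "even r")
            case r: True
            have "2 * (2 * ?g (Suc r + Suc s) - 2 * ?g (Suc s + Suc t)) = 2 * (of_nat r - of_nat t)"
              using s True r by (simp add: G2)
            then show ?thesis
              using s True r by (simp add: \<epsilon> G1 algebra_simps)
          next
            case r: False
            have "2 * (2 * ?g (Suc t) - 2 * ?g (Suc r)) = 2 * (of_nat t - of_nat r)"
              using s True r by (simp add: G2)
            then show ?thesis
              using s True r by (simp add: \<epsilon> G1 algebra_simps)
          qed
        next
          case s: False
          with False have r: "odd r" by simp
          have "4 * (?g (Suc r + Suc s) * ?g (Suc t) - ?g (Suc s + Suc t) * ?g (Suc r)) =
            (2 * ?g (Suc r + Suc s)) * (2 * ?g (Suc t)) - (2 * ?g (Suc s + Suc t)) * (2 * ?g (Suc r))"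
            by (simp add: algebra_simps)
          also have "\<dots> = of_nat (Suc r + Suc s) * of_nat (Suc t) - of_nat (Suc s + Suc t) * of_nat (Suc r)"
            using s True r by (simp add: G2 del: of_nat_Suc of_nat_add)
          also have "\<dots> = ?m * of_nat (Suc s)"
            using r by (simp add: \<epsilon> algebra_simps)
          also have "of_nat (Suc s) = 2 * ?g (Suc s)"
            using s by (simp add: G2)
          finally show ?thesis .
        qed
        have "(2 * ?g (Suc s)) * (?n * ?\<Delta>') = 4 * (?g (Suc r + Suc t) * ?g (Suc s) * ?\<Delta>')"
          unfolding n[symmetric] by (simp add: algebra_simps)
        also have "\<dots> = (2 * ?g (Suc s)) * (?m * ?B')"
          unfolding rec mult.assoc[symmetric] N by (simp only: mult_ac)
        finally have "?n * ?\<Delta>' = ?m * ?B'"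
          using two nz'(2) by (subst (asm) mult_cancel_left) auto
        moreover have "?\<Delta> = ?\<Delta>'" "?B = ?B'"
          using False True by (auto simp: odd_bracket_def)
        ultimately show ?thesis by simp
      qed
      then have "?n * ((x d - x s) * ?\<Delta>) = (x d - x s) * (?m * ?B)"
        by (simp only: mult.left_commute[of ?n])
      also have "\<dots> = ?n * ((x (s + Suc t) - x (s + Suc r)) * ?B)"
        using e by (simp only: mult.assoc[symmetric]) (simp only: mult_ac)
      finally have "?n * ((x d - x s) * ?\<Delta>) = ?n * ((x (s + Suc t) - x (s + Suc r)) * ?B)" .
      then show ?thesis using n0 by (metis mult_left_cancel)
    qed
  qed
qed

section \<open>The bracket relation for \<open>q_bracket\<close>\<close>

lemma q_pochhammer_eq_gfact: "q_pochhammer q q n = gfact (\<lambda>k. 1 - q ^ k) n"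
  by (simp add: q_pochhammer_def gfact_def)

lemma q_bracket_eq_1: "r = 0 \<or> s = 0 \<or> t = 0 \<Longrightarrow> q_bracket q r s t = 1"
  by (auto simp: q_bracket_def)

lemma bracket_relation_cong:
  assumes "bracket_relation d x br" and "\<And>r s t. r + s + t = d \<Longrightarrow> br' r s t = br r s t"
  shows "bracket_relation d x br'"
  using assms by (simp add: bracket_relation_def)

lemma two_neq_0_iff_CHAR: "(2 :: 'k::field) = 0 \<longleftrightarrow> CHAR('k) = 2"
proof
  assume "(2::'k) = 0"
  then have "of_nat 2 = (0::'k)" by simp
  then have "CHAR('k) dvd 2" by (simp only: of_nat_eq_0_iff_char_dvd)
  moreover from this have "CHAR('k) \<le> 2" by (rule dvd_imp_le) simp
  moreover have "CHAR('k) \<noteq> 1" by simp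
  moreover have "CHAR('k) \<noteq> 0" using calculation(1) by (metis dvd_0_left_iff zero_neq_numeral)
  ultimately show "CHAR('k) = 2" by linarith
next
  assume "CHAR('k) = 2"
  then show "(2::'k) = 0"
    by (metis of_nat_CHAR of_nat_numeral)
qed

text \<open>The recurrence expresses \<open>[r, s + 1, t - 1]\<close> through brackets with smaller \<open>s\<close> or \<open>r\<close>, so the
  brackets with \<open>r + s + t = d\<close> descend to the base field.\<close>

lemma bracket_relation_descends:
  fixes x :: "nat \<Rightarrow> 'k::field"
  assumes rel: "bracket_relation d (\<lambda>i. to_ac (x i)) br"
    and one: "\<And>r s t. r + s + t = d \<Longrightarrow> r = 0 \<or> s = 0 \<or> t = 0 \<Longrightarrow> br r s t = 1"
    and inj: "inj_on x {..d}"
  shows "r + s + t = d \<Longrightarrow> br r s t \<in> range to_ac"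
proof (induction s arbitrary: r t)
  case 0
  then show ?case using one[of r 0 t] by (metis rangeI to_ac_1)
next
  case (Suc s)
  have "r + Suc s + t = d \<Longrightarrow> br r (Suc s) t \<in> range to_ac" for r t
  proof (induction r arbitrary: t)
    case 0
    then show ?case using one[of 0 "Suc s" t] by (metis rangeI to_ac_1)
  next
    case (Suc r)
    then have d: "Suc r + s + Suc t = d" by simp
    obtain u where u: "br r (Suc s) (Suc t) = to_ac u"
      using Suc.IH[of "Suc t"] d by auto
    obtain v where v: "br (Suc r) s (Suc t) = to_ac v"
      using \<open>\<And>r t. r + s + t = d \<Longrightarrow> br r s t \<in> range to_ac\<close>[of "Suc r" "Suc t"] d by auto
    have ne: "x d - x s \<noteq> 0"
      using inj d by (auto dest: inj_onD)
    let ?w = "u + (x (s + Suc t) - x (s + Suc r)) * v / (x d - x s)"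
    have "(to_ac (x d) - to_ac (x s)) * (br (Suc r) (Suc s) t - to_ac u) =
      (to_ac (x (s + Suc t)) - to_ac (x (s + Suc r))) * to_ac v"
      using rel d unfolding bracket_relation_def by (metis u v)
    moreover have "to_ac (x d) - to_ac (x s) \<noteq> 0"
      using ne by (metis to_ac_diff to_ac_eq_0_iff)
    ultimately have "br (Suc r) (Suc s) t = to_ac ?w"
      by (simp add: field_simps)
    then show ?case by blast
  qed
  then show ?case using Suc.prems by blast
qed

text \<open>The ratio condition amounts to the third-order recurrence with roots \<open>1\<close>,
  \<open>q\<close>, \<open>inverse q\<close>; each branch of \<open>q_bracket\<close> is matched
  with the closed form available for that \<open>q\<close>.\<close>

lemma bracket_relation_q_bracket:
  fixes x :: "nat \<Rightarrow> 'k::field"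
  assumes q: "q \<noteq> 0" and inj: "inj_on x {..d}"
    and adm: "\<And>i. 2 \<le> i \<Longrightarrow> i + 1 \<le> d \<Longrightarrow>
      to_ac ((x (i - 2) - x (i + 1)) / (x (i - 1) - x i)) = q + inverse q + 1"
  shows "bracket_relation d x (q_bracket q)"
proof -
  have rec: "to_ac (x (i + 3)) = to_ac (x i) - (q + inverse q + 1) * (to_ac (x (i + 1)) - to_ac (x (i + 2)))"
    if "i + 3 \<le> d" for i
  proof -
    have "x (i + 1) - x (i + 2) \<noteq> 0"
      using inj that by (auto dest: inj_onD)
    then have "to_ac (x (i + 1) - x (i + 2)) \<noteq> 0" by simp
    moreover have "to_ac ((x i - x (i + 3)) / (x (i + 1) - x (i + 2))) = q + inverse q + 1"
      using adm[of "i + 2"] that by (simp add: numeral_3_eq_3)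
    ultimately have "to_ac (x i - x (i + 3)) = (q + inverse q + 1) * to_ac (x (i + 1) - x (i + 2))"
      unfolding to_ac_divide by (metis nonzero_divide_eq_eq)
    then show ?thesis by (simp add: algebra_simps)
  qed
  \<comment> \<open>In characteristic 2 the scalars \<open>1\<close> and \<open>-1\<close> coincide,
    so \<open>q = -1\<close> is then covered by the last case.\<close>
  consider (small) "d \<le> 2" | (generic) "d > 2" "q \<noteq> 1" "q \<noteq> -1"
    | (one) "d > 2" "q = 1" "(2::'k) \<noteq> 0" | (minus_one) "d > 2" "q = -1" "(2::'k) \<noteq> 0"
    | (two) "d > 2" "q = 1" "(2::'k) = 0"
  proof -
    have "(1 :: 'k alg_closure) = -1" if "(2::'k) = 0"
      using that by (metis add_eq_0_iff one_add_one to_ac_0 to_ac_1 to_ac_add)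
    then show thesis using that by fastforce
  qed
  then show ?thesis
  proof cases
    case small
    show ?thesis
      unfolding bracket_relation_def
    proof (intro allI impI)
      fix r s t assume "Suc r + s + Suc t = d"
      with small have "r = 0" "s = 0" "t = 0" by auto
      then show "(x d - x s) * (q_bracket q (Suc r) (Suc s) t - q_bracket q r (Suc s) (Suc t)) =
        (x (s + Suc t) - x (s + Suc r)) * q_bracket q (Suc r) s (Suc t)"
        by (simp add: q_bracket_eq_1)
    qed
  next
    case generic
    let ?x = "\<lambda>i. to_ac (x i)"
    from closed_form_generic[OF rec q generic(2,3)]
    obtain a b c where x: "\<And>i. i \<le> d \<Longrightarrow> ?x i = a + b * q ^ i + c / q ^ i" by blast
    have inj': "inj_on ?x {..d}"
      using inj by (auto simp: inj_on_def)
    note rel = bracket_relation_generic[OF x inj' q]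
    let ?G = "gbracket (\<lambda>k. 1 - q ^ k)"
    have G1: "?G r s t = 1" if "r + s + t = d" "r = 0 \<or> s = 0 \<or> t = 0" for r s t
      using that rel(1) by (intro gbracket_eq_1) auto
    \<comment> \<open>\<open>of_ac\<close> undoes \<open>to_ac\<close> only on the range of
      \<open>to_ac\<close>; \<open>bracket_relation_descends\<close> shows that the quotient lies
      there.\<close>
    have eq: "to_ac (q_bracket q r s t) = ?G r s t" if "r + s + t = d" for r s t
    proof (cases "r = 0 \<or> s = 0 \<or> t = 0")
      case True
      then show ?thesis using G1[OF that] by (simp add: q_bracket_eq_1)
    next
      case False
      then have "q_bracket q r s t = of_ac (?G r s t)"
        using generic by (simp add: q_bracket_def gbracket_def q_pochhammer_eq_gfact)
      then show ?thesis
        using bracket_relation_descends[OF rel(2) G1 inj that] by (simp add: to_ac_of_ac)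
    qed
    show ?thesis
      unfolding bracket_relation_def
    proof (intro allI impI)
      fix r s t assume d: "Suc r + s + Suc t = d"
      have "to_ac ((x d - x s) * (q_bracket q (Suc r) (Suc s) t - q_bracket q r (Suc s) (Suc t))) =
        to_ac ((x (s + Suc t) - x (s + Suc r)) * q_bracket q (Suc r) s (Suc t))"
        using d rel(2) unfolding to_ac_mult to_ac_diff bracket_relation_def by (simp add: eq)
      then show "(x d - x s) * (q_bracket q (Suc r) (Suc s) t - q_bracket q r (Suc s) (Suc t)) =
        (x (s + Suc t) - x (s + Suc r)) * q_bracket q (Suc r) s (Suc t)"
        by (simp only: to_ac_eq_iff)
    qed
  next
    case one
    have rec': "x (i + 3) = x i - 3 * (x (i + 1) - x (i + 2))" if "i + 3 \<le> d" for i
    proof -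
      have "to_ac (x (i + 3)) = to_ac (x i - 3 * (x (i + 1) - x (i + 2)))"
        using rec[OF that] one(2) by simp
      then show ?thesis by (simp only: to_ac_eq_iff)
    qed
    from closed_form_one[OF rec']
    obtain a b c where x: "\<And>i. i \<le> d \<Longrightarrow> x i = a + b * of_nat i + c * of_nat (i choose 2)" by blast
    note rel = bracket_relation_one[OF x inj one(3)]
    have gf: "gfact of_nat n = (of_nat (fact n) :: 'k)" for n
      by (induction n) (auto simp: algebra_simps)
    show ?thesis
    proof (rule bracket_relation_cong[OF rel(2)])
      fix r s t assume d: "r + s + t = d"
      show "q_bracket q r s t = gbracket of_nat r s t"
      proof (cases "r = 0 \<or> s = 0 \<or> t = 0")
        case True
        then show ?thesis
          using rel(1) d by (subst gbracket_eq_1) (auto simp: q_bracket_eq_1)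
      next
        case False
        then show ?thesis
          using one two_neq_0_iff_CHAR[where 'k='k]
          by (simp add: q_bracket_def gbracket_def gf del: of_nat_fact)
      qed
    qed
  next
    case minus_one
    have ne: "q \<noteq> 1"
    proof
      assume "q = 1"
      then have "to_ac (1 + 1 :: 'k) = 0" using minus_one(2) by (metis add_eq_0_iff to_ac_1 to_ac_add)
      then show False using minus_one(3) by (simp only: to_ac_eq_0_iff one_add_one)
    qed
    have rec': "x (i + 3) = x i + (x (i + 1) - x (i + 2))" if "i + 3 \<le> d" for i
    proof -
      have "to_ac (x (i + 3)) = to_ac (x i + (x (i + 1) - x (i + 2)))"
        using rec[OF that] minus_one(2) by simp
      then show ?thesis by (simp only: to_ac_eq_iff)
    qed
    from closed_form_minus_one[OF rec' minus_one(3)]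
    obtain a b c where x: "\<And>i. i \<le> d \<Longrightarrow> x i = a + (-1) ^ i * (b + c * of_nat i)" by blast
    note rel = bracket_relation_minus_one[OF x inj minus_one(3)]
    show ?thesis
    proof (rule bracket_relation_cong[OF rel(2)])
      fix r s t assume d: "r + s + t = d"
      show "q_bracket q r s t = odd_bracket r s t"
      proof (cases "r = 0 \<or> s = 0 \<or> t = 0")
        case True
        then show ?thesis
          unfolding odd_bracket_def using rel(1) d by (subst gbracket_eq_1) (auto simp: q_bracket_eq_1)
      next
        case False
        then show ?thesis
          using minus_one ne two_neq_0_iff_CHAR[where 'k='k]
          by (simp add: q_bracket_def odd_bracket_def gbracket_def gfact_half_int del: of_nat_fact)
      qed
    qed
  next
    case two
    have three: "(3::'k) = 1"
      using two(3) by (metis add_0 one_plus_numeral one_plus_numeral_commute add_num_simps(2) numeral_plus_one add_num_simps(2) semiring_norm(3))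
    have rec': "x (i + 3) = x i - 3 * (x (i + 1) - x (i + 2))" if "i + 3 \<le> d" for i
    proof -
      have "to_ac (x (i + 3)) = to_ac (x i - 3 * (x (i + 1) - x (i + 2)))"
        using rec[OF that] two(2) by simp
      then show ?thesis by (simp only: to_ac_eq_iff)
    qed
    from closed_form_one[OF rec']
    obtain a b c where x: "\<And>i. i \<le> d \<Longrightarrow> x i = a + b * of_nat i + c * of_nat (i choose 2)" by blast
    have neg: "- y = y" for y :: 'k
      using two(3) by (metis add_eq_0_iff mult_2 mult_zero_left)
    \<comment> \<open>In characteristic 2 both \<open>4\<close> and \<open>4 choose 2 = 6\<close>
      vanish, so for \<open>d \<ge> 4\<close> the closed form would give
      \<open>x 4 = x 0\<close>.\<close>
    have "d = 3"
    proof (rule ccontr)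
      assume "d \<noteq> 3"
      with two have "4 \<le> d" by simp
      moreover have "(4::'k) = 0" "(6::'k) = 0"
        using two(3) by (metis mult_2 numeral_Bit0 mult_zero_left, metis mult_2 numeral_Bit0 mult_zero_left mult_zero_right numeral_times_numeral semiring_norm(13))
      moreover have "(4::nat) choose 2 = 6" by (simp add: choose_two)
      ultimately have "x 4 = x 0"
        using x[of 4] x[of 0] by (simp add: binomial_eq_0)
      with inj \<open>4 \<le> d\<close> show False by (auto dest: inj_onD)
    qed
    have br: "q_bracket q 1 1 1 = (0::'k)"
      using two two_neq_0_iff_CHAR[where 'k='k] by (simp add: q_bracket_def)
    have x3: "x 3 - x 0 = x 2 - x 1"
      using rec'[of 0] \<open>d = 3\<close> three by (simp add: algebra_simps numeral_2_eq_2)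
    show ?thesis
      unfolding bracket_relation_def
    proof (intro allI impI)
      \<comment> \<open>Three triples remain. The bracket at \<open>(1, 1, 1)\<close> is zero, the
        others that occur are one, and signs do not matter in characteristic 2.\<close>
      fix r s t assume "Suc r + s + Suc t = d"
      with \<open>d = 3\<close> have "r = 1 \<and> s = 0 \<and> t = 0 \<or> r = 0 \<and> s = 1 \<and> t = 0 \<or> r = 0 \<and> s = 0 \<and> t = 1"
        by arith
      then show "(x d - x s) * (q_bracket q (Suc r) (Suc s) t - q_bracket q r (Suc s) (Suc t)) =
        (x (s + Suc t) - x (s + Suc r)) * q_bracket q (Suc r) s (Suc t)"
        using br x3 neg[of "x 2 - x 1"] \<open>d = 3\<close>
        by (auto simp: q_bracket_eq_1 numeral_2_eq_2 numeral_3_eq_3)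
    qed
  qed
qed

section \<open>Bidiagonal actions and change of basis\<close>

text \<open>Forward substitution: at the point \<open>i\<close> all members after \<open>p i\<close>
  vanish, and the coefficients before \<open>c i\<close> are zero by induction.\<close>

lemma triangular_independent:
  fixes p :: "nat \<Rightarrow> nat \<Rightarrow> 'k::field"
  assumes low: "\<And>i r. i \<le> d \<Longrightarrow> r < i \<Longrightarrow> p i r = 0" and diag: "\<And>i. i \<le> d \<Longrightarrow> p i i \<noteq> 0"
    and zero: "\<And>r. r \<le> d \<Longrightarrow> (\<Sum>i\<le>d. c i * p i r) = 0"
  shows "i \<le> d \<Longrightarrow> c i = 0"
proof (induction i rule: less_induct)
  case (less i)
  have "c k * p k i = (if k = i then c i * p i i else 0)" if "k \<le> d" for k
    using less.IH[of k] low[of k i] that by (metis less.prems linorder_neqE_nat mult_eq_0_iff)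
  then have "(\<Sum>k\<le>d. c k * p k i) = (\<Sum>k\<le>d. if k = i then c i * p i i else 0)"
    by (intro sum.cong) auto
  then have "(\<Sum>k\<le>d. c k * p k i) = c i * p i i"
    using less.prems by simp
  then show ?case using zero[of i] diag[of i] less.prems by simp
qed

text \<open>Subtracting a multiple of \<open>p j\<close> removes the value at \<open>j\<close>. The
  vanishing of the first coefficients is the source of the lower triangular shape of the
  matrices.\<close>

lemma triangular_expansion:
  fixes p :: "nat \<Rightarrow> nat \<Rightarrow> 'k::field"
  assumes low: "\<And>i r. i \<le> d \<Longrightarrow> r < i \<Longrightarrow> p i r = 0" and diag: "\<And>i. i \<le> d \<Longrightarrow> p i i \<noteq> 0"
    and "\<And>r. r < j \<Longrightarrow> g r = 0"
  obtains c where "\<And>i. i < j \<Longrightarrow> c i = 0" "\<And>r. r \<le> d \<Longrightarrow> g r = (\<Sum>i\<le>d. c i * p i r)"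
proof -
  have "(\<forall>r<j. g r = 0) \<longrightarrow> (\<exists>c. (\<forall>i<j. c i = 0) \<and> (\<forall>r\<le>d. g r = (\<Sum>i\<le>d. c i * p i r)))"
    if "j \<le> Suc d" for g j
    using that
  \<comment> \<open>Downward induction from \<open>Suc d\<close>, where \<open>g\<close> is zero on
    the whole range.\<close>
  proof (induction arbitrary: g rule: inc_induct)
    case base
    then show ?case by (auto intro!: exI[of _ "\<lambda>_. 0"])
  next
    case (step j)
    show ?case
    proof
      assume g: "\<forall>r<j. g r = 0"
      define b where "b = g j / p j j"
      have "\<forall>r<Suc j. g r - b * p j r = 0"
      proof (intro allI impI)
        fix r assume "r < Suc j"
        then show "g r - b * p j r = 0"
          using g diag[of j] low[of j r] step.hyps by (cases "r = j") (simp_all add: b_def)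
      qed
      from step.IH[of "\<lambda>r. g r - b * p j r", rule_format, OF this[rule_format]]
      obtain c where c: "\<forall>i<Suc j. c i = 0"
        "\<forall>r\<le>d. g r - b * p j r = (\<Sum>i\<le>d. c i * p i r)" by auto
      have "g r = (\<Sum>i\<le>d. (c(j := b)) i * p i r)" if "r \<le> d" for r
      proof -
        have "(c(j := b)) i * p i r = c i * p i r + (if i = j then b * p j r else 0)" for i
          using c(1) by auto
        then show ?thesis
          using c(2) that step.hyps by (simp add: sum.distrib sum.delta algebra_simps)
      qed
      then show "\<exists>c. (\<forall>i<j. c i = 0) \<and> (\<forall>r\<le>d. g r = (\<Sum>i\<le>d. c i * p i r))"
        using c(1) by (intro exI[of _ "c(j := b)"]) auto
    qed
  qed
  from this[of j g] assms(3) have "\<exists>c. (\<forall>i<j. c i = 0) \<and> (\<forall>r\<le>d. g r = (\<Sum>i\<le>d. c i * p i r))"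
    if "j \<le> Suc d" using that by blast
  moreover have "\<exists>c. (\<forall>i<j. c i = 0) \<and> (\<forall>r\<le>d. g r = (\<Sum>i\<le>d. c i * p i r))" if "d < j"
    using that assms(3) by (intro exI[of _ "\<lambda>_. 0"]) auto
  ultimately have "\<exists>c. (\<forall>i<j. c i = 0) \<and> (\<forall>r\<le>d. g r = (\<Sum>i\<le>d. c i * p i r))"
    by (cases "d < j") auto
  then show thesis using that by blast
qed

definition mat_app :: "nat \<Rightarrow> (nat \<Rightarrow> nat \<Rightarrow> 'k::field) \<Rightarrow> (nat \<Rightarrow> 'k) \<Rightarrow> nat \<Rightarrow> 'k" where
  "mat_app d T g r = (\<Sum>s\<le>d. T r s * g s)"

lemma mat_app_sum: "mat_app d T (\<lambda>r. \<Sum>i\<in>I. c i * p i r) r = (\<Sum>i\<in>I. c i * mat_app d T (p i) r)"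
  unfolding mat_app_def sum_distrib_left by (subst sum.swap) (simp add: mult_ac)

lemma mat_app_cong: "(\<And>r. r \<le> d \<Longrightarrow> g r = h r) \<Longrightarrow> mat_app d T g = mat_app d T h"
  by (auto simp: mat_app_def fun_eq_iff)

section \<open>Transition between two bases that make \<open>T\<close> bidiagonal\<close>

text \<open>Common shape of both matrices. For the switching element \<open>t\<close>,
  \<open>c\<close>, \<open>e\<close> are \<open>\<theta>s\<close>, \<open>vphi\<close> and the
  reversed \<open>phi\<close>; for its inverse \<open>t\<close> is reversed, and \<open>c\<close>
  and \<open>e\<close> change places.\<close>

definition split_entry ::
  "nat \<Rightarrow> (nat \<Rightarrow> nat \<Rightarrow> nat \<Rightarrow> 'k::field) \<Rightarrow> (nat \<Rightarrow> 'k) \<Rightarrow> (nat \<Rightarrow> 'k) \<Rightarrow> (nat \<Rightarrow> 'k) \<Rightarrow> nat \<Rightarrow> nat \<Rightarrow> 'k" where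
  "split_entry d br t c e i j = (if i < j then 0 else
     br j (i - j) (d - i) * (\<Prod>h=1..j. e h) * poly (tau_poly t (i - j)) (t d) / (\<Prod>h=1..i. c h))"

text \<open>Expanding \<open>y j\<close> in the \<open>p i\<close> and computing
  \<open>T (y j)\<close> in two ways gives a recurrence that determines row \<open>i + 1\<close> of
  the transition matrix from row \<open>i\<close>. Triangularity and \<open>y 0 0 = p 0 0\<close>
  fix row 0, and \<open>bracket_relation\<close> says that the proposed entries obey the
  recurrence.\<close>

lemma split_transition:
  fixes p y :: "nat \<Rightarrow> nat \<Rightarrow> 'k::field"
  assumes low: "\<And>i r. i \<le> d \<Longrightarrow> r < i \<Longrightarrow> p i r = 0" and diag: "\<And>i. i \<le> d \<Longrightarrow> p i i \<noteq> 0"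
    and Tp: "\<And>i r. i \<le> d \<Longrightarrow> r \<le> d \<Longrightarrow>
      mat_app d T (p i) r = t i * p i r + (if i = 0 then 0 else c i * p (i - 1) r)"
    and ylow: "\<And>j r. j \<le> d \<Longrightarrow> r < j \<Longrightarrow> y j r = 0" and y0: "y 0 0 = p 0 0"
    and Ty: "\<And>j r. j \<le> d \<Longrightarrow> r \<le> d \<Longrightarrow>
      mat_app d T (y j) r = t (d - j) * y j r + (if j = 0 then 0 else e j * y (j - 1) r)"
    and c: "\<And>i. 1 \<le> i \<Longrightarrow> i \<le> d \<Longrightarrow> c i \<noteq> 0"
    and rel: "bracket_relation d t br"
    and one: "\<And>r s u. r + s + u = d \<Longrightarrow> r = 0 \<or> s = 0 \<or> u = 0 \<Longrightarrow> br r s u = 1"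
  shows "j \<le> d \<Longrightarrow> r \<le> d \<Longrightarrow> y j r = (\<Sum>i\<le>d. split_entry d br t c e i j * p i r)"
proof -
  have "\<exists>N. (\<forall>i<j. N i = 0) \<and> (\<forall>r\<le>d. y j r = (\<Sum>i\<le>d. N i * p i r))" if "j \<le> d" for j
    using triangular_expansion[where p = p and d = d and j = j and g = "y j", OF low diag ylow[OF that]] by metis
  then obtain N where Nlow: "\<And>i j. j \<le> d \<Longrightarrow> i < j \<Longrightarrow> N j i = 0"
    and Ny: "\<And>j r. j \<le> d \<Longrightarrow> r \<le> d \<Longrightarrow> y j r = (\<Sum>i\<le>d. N j i * p i r)"
    by metis
  have N0: "N 0 0 = 1"
  proof -
    have "y 0 0 = (\<Sum>i\<le>d. N 0 i * p i 0)" using Ny by simp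
    also have "\<dots> = (\<Sum>i\<in>{0}. N 0 i * p i 0)"
      by (rule sum.mono_neutral_right) (use low in auto)
    finally show ?thesis using y0 diag[of 0] by simp
  qed
  have Nrec: "c (Suc i) * N j (Suc i) = (t (d - j) - t i) * N j i + (if j = 0 then 0 else e j * N (j - 1) i)"
    if "i < d" "j \<le> d" for i j
  proof -
    \<comment> \<open>Coefficient of \<open>p i\<close> in \<open>T (y j)\<close> according to
      \<open>Tp\<close>, minus the one prescribed by \<open>Ty\<close>; independence of the
      \<open>p i\<close> makes it zero. The contribution of \<open>p (Suc i)\<close> stops at
      \<open>i = d\<close>.\<close>
    define b where "b i = t i * N j i + (if i < d then c (Suc i) * N j (Suc i) else 0)
      - t (d - j) * N j i - (if j = 0 then 0 else e j * N (j - 1) i)" for i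
    have "(\<Sum>i\<le>d. b i * p i r) = 0" if r: "r \<le> d" for r
    proof -
      have "mat_app d T (y j) r = (\<Sum>i\<le>d. N j i * mat_app d T (p i) r)"
        using Ny[OF \<open>j \<le> d\<close>] by (subst mat_app_sum[symmetric]) (auto cong: mat_app_cong)
      also have "\<dots> = (\<Sum>i\<le>d. t i * N j i * p i r) + (\<Sum>i\<le>d. if i = 0 then 0 else c i * N j i * p (i - 1) r)"
        using r by (simp add: Tp sum.distrib[symmetric] algebra_simps cong: if_cong)
          (rule sum.cong, auto simp: algebra_simps)
      also have "(\<Sum>i\<le>d. if i = 0 then 0 else c i * N j i * p (i - 1) r) =
        (\<Sum>i<d. c (Suc i) * N j (Suc i) * p i r)"
        by (subst lessThan_Suc_atMost[symmetric], subst sum.lessThan_Suc_shift) simp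
      also have "\<dots> = (\<Sum>i\<le>d. (if i < d then c (Suc i) * N j (Suc i) else 0) * p i r)"
        by (rule sum.mono_neutral_cong_left) auto
      finally have 1: "mat_app d T (y j) r = (\<Sum>i\<le>d. t i * N j i * p i r) +
        (\<Sum>i\<le>d. (if i < d then c (Suc i) * N j (Suc i) else 0) * p i r)" .
      have 2: "(if j = 0 then 0 else e j * y (j - 1) r) = (\<Sum>i\<le>d. (if j = 0 then 0 else e j * N (j - 1) i) * p i r)"
        using Ny[of "j - 1" r] that r \<open>j \<le> d\<close> by (simp add: sum_distrib_left mult.assoc)
      have 3: "t (d - j) * y j r = (\<Sum>i\<le>d. t (d - j) * N j i * p i r)"
        using Ny[of j r] r \<open>j \<le> d\<close> by (simp add: sum_distrib_left mult.assoc)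
      show ?thesis
        using Ty[OF \<open>j \<le> d\<close> r] unfolding 1 2 3 b_def
        by (simp add: left_diff_distrib distrib_right sum.distrib sum_subtractf)
    qed
    then have "b i = 0"
      using triangular_independent[where p = p and d = d and c = b and i = i, OF low diag] that by simp
    then show ?thesis using that by (simp add: b_def algebra_simps)
  qed
  have "N j i = split_entry d br t c e i j" if "i \<le> d" "j \<le> d" for i j
    using that
  proof (induction i arbitrary: j)
    case 0
    then show ?case
      using N0 Nlow one by (cases "j = 0") (auto simp: split_entry_def tau_poly_def)
  next
    case (Suc i)
    have c0: "c (Suc i) \<noteq> 0" using c Suc.prems by simp
    have cP: "(\<Prod>h=1..i. c h) \<noteq> 0" using c Suc.prems by simp
    let ?M = "split_entry d br t c e"
    have "c (Suc i) * N j (Suc i) = (t (d - j) - t i) * ?M i j + (if j = 0 then 0 else e j * ?M i (j - 1))"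
      using Nrec[of i j] Suc by auto
    also have "\<dots> = c (Suc i) * ?M (Suc i) j"
    proof -
      have tau: "poly (tau_poly t (Suc n)) x = poly (tau_poly t n) x * (x - t n)" for n x
        by (simp add: tau_poly_def algebra_simps)
      \<comment> \<open>For \<open>j = 0\<close> all brackets are one and \<open>tau_poly\<close>
        gains a factor; above the diagonal both sides vanish; at the new diagonal entry only the
        term with \<open>j - 1\<close> survives. The last case carries the content.\<close>
      consider "j = 0" | "j > Suc i" | "j = Suc i" | "j \<noteq> 0" "j \<le> i" by linarith
      then show ?thesis
      proof cases
        case 1
        then show ?thesis
          using c0 cP one Suc.prems by (simp add: split_entry_def tau)
      next
        case 2
        then show ?thesis by (auto simp: split_entry_def)
      next
        case 3
        then show ?thesis
          using c0 cP one Suc.prems by (simp add: split_entry_def tau_poly_def)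
      next
        case jle: 4
        \<comment> \<open>Together with \<open>u\<close> this is the triple \<open>(k, m, u)\<close>
          at which the bracket relation is read.\<close>
        define k m where "k = j - 1" and "m = i - j"
        with jle have 4: "j = Suc k" "i = j + m" by auto
        define u where "u = d - Suc i"
        with Suc.prems have u: "d = i + Suc u" by simp
        have sum_d: "Suc k + m + Suc u = d" using 4 u by simp
        have "(t d - t m) * (br (Suc k) (Suc m) u - br k (Suc m) (Suc u)) =
          (t (m + Suc u) - t (m + Suc k)) * br (Suc k) m (Suc u)"
          by (rule rel[unfolded bracket_relation_def, rule_format, OF sum_d])
        moreover have "d - j = m + Suc u" "i = m + Suc k" "d - i = Suc u" "d - Suc i = u" "i - k = Suc m"
          "Suc i - j = Suc m" "i - j = m"
          using 4 u by auto
        ultimately have key: "(t (d - j) - t i) * br j (i - j) (d - i) =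
            (t d - t m) * (br j (Suc i - j) (d - Suc i) - br k (i - k) (d - i))"
          using 4(1) by (simp only:)
        let ?E = "\<Prod>h=1..k. e h" and ?C = "\<Prod>h=1..i. c h" and ?Q = "poly (tau_poly t m) (t d)"
        have M: "?M i j = br j (i - j) (d - i) * (?E * e j) * ?Q / ?C"
          "?M i (j - 1) = br k (i - k) (d - i) * ?E * (?Q * (t d - t m)) / ?C"
          "?M (Suc i) j = br j (Suc i - j) (d - Suc i) * (?E * e j) * (?Q * (t d - t m)) / (?C * c (Suc i))"
          using 4 by (simp_all add: split_entry_def tau)
        have "(t (d - j) - t i) * ?M i j + e j * ?M i (j - 1) =
          ((t (d - j) - t i) * br j (i - j) (d - i) + (t d - t m) * br k (i - k) (d - i)) * (?E * e j * ?Q / ?C)"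
          unfolding M by (simp add: algebra_simps add_divide_distrib diff_divide_distrib)
        also have "\<dots> = (t d - t m) * br j (Suc i - j) (d - Suc i) * (?E * e j * ?Q / ?C)"
          unfolding key by (simp add: algebra_simps)
        also have "\<dots> = c (Suc i) * ?M (Suc i) j"
          unfolding M using c0 by (simp add: mult_ac)
        finally show ?thesis using 4(1) by simp
      qed
    qed
    finally show ?case using c0 by simp
  qed
  then show "j \<le> d \<Longrightarrow> r \<le> d \<Longrightarrow> y j r = (\<Sum>i\<le>d. split_entry d br t c e i j * p i r)"
    using Ny by simp
qed

section \<open>Duality by Lagrange interpolation\<close>

text \<open>A polynomial of degree at most \<open>d\<close> equals its Lagrange interpolant at
  \<open>d + 1\<close> nodes; the sum is the coefficient of degree \<open>d\<close> of that
  interpolant.\<close>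

lemma sum_Lagrange_weights:
  fixes p :: "'k::field poly"
  assumes inj: "inj_on \<theta> {..d}" and deg: "Polynomial.degree p \<le> d"
  shows "(\<Sum>r\<le>d. poly p (\<theta> r) / (\<Prod>s\<in>{..d} - {r}. \<theta> r - \<theta> s)) = Polynomial.coeff p d"
proof -
  define w where "w r = (\<Prod>s\<in>{..d} - {r}. \<theta> r - \<theta> s)" for r
  define B where "B r = (\<Prod>s\<in>{..d} - {r}. [:- \<theta> s, 1:])" for r
  define L where "L = (\<Sum>r\<le>d. Polynomial.smult (poly p (\<theta> r) / w r) (B r))"
  have w: "w r \<noteq> 0" if "r \<le> d" for r
    using inj that by (auto simp: w_def inj_on_def)
  have Bdeg: "Polynomial.degree (B r) = d" "Polynomial.coeff (B r) d = 1" if "r \<le> d" for r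
  proof -
    have "Polynomial.degree (B r) = (\<Sum>s\<in>{..d} - {r}. Polynomial.degree [:- \<theta> s, 1:])"
      unfolding B_def by (rule degree_prod_sum_eq) auto
    then show d: "Polynomial.degree (B r) = d" using that by simp
    have "monic (B r)" unfolding B_def by (rule monic_prod) auto
    then show "Polynomial.coeff (B r) d = 1" using d by simp
  qed
  have "p = L"
  proof (rule poly_eqI_degree[where A = "\<theta> ` {..d}"])
    have card: "card (\<theta> ` {..d}) = Suc d" using inj by (simp add: card_image)
    then show "Polynomial.degree p < card (\<theta> ` {..d})" using deg by simp
    have "Polynomial.degree L \<le> d"
      unfolding L_def by (intro degree_sum_le) (auto intro: order.trans[OF degree_smult_le] simp: Bdeg)
    then show "Polynomial.degree L < card (\<theta> ` {..d})" using card by simp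
    fix x assume "x \<in> \<theta> ` {..d}"
    then obtain k where k: "k \<le> d" "x = \<theta> k" by auto
    have "poly (B r) (\<theta> k) = (if r = k then w k else 0)" if "r \<le> d" for r
      using k that by (auto simp: B_def w_def poly_prod)
    then have "poly L x = (\<Sum>r\<le>d. if r = k then poly p (\<theta> r) else 0)"
      unfolding L_def poly_sum k by (intro sum.cong) (auto simp: w k)
    then show "poly p x = poly L x" using k by (simp add: sum.delta)
  qed
  then have "Polynomial.coeff p d = Polynomial.coeff L d" by (rule arg_cong)
  also have "\<dots> = (\<Sum>r\<le>d. poly p (\<theta> r) / w r * Polynomial.coeff (B r) d)"
    by (simp add: L_def Polynomial.coeff_sum)
  finally show ?thesis by (simp add: Bdeg w_def)
qed

section \<open>The switching element as a multiplication operator on functions\<close>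

text \<open>What is kept of a Leonard system once \<open>V\<close> is identified with functions on
  \<open>{..d}\<close>: \<open>T\<close> stands for \<open>As\<close>, and the two families of
  polynomials make it bidiagonal with the same diagonal. \<open>split_pair_T\<close> supplies the
  instance.\<close>

locale split_pair =
  fixes d :: nat and T :: "nat \<Rightarrow> nat \<Rightarrow> 'k::field" and \<theta> \<theta>s vphi phi :: "nat \<Rightarrow> 'k"
  assumes inj: "inj_on \<theta> {..d}"
    and tridiagonal: "\<And>r s. r \<le> d \<Longrightarrow> s \<le> d \<Longrightarrow> Suc r < s \<or> Suc s < r \<Longrightarrow> T r s = 0"
    and T_tau: "\<And>i r. i \<le> d \<Longrightarrow> r \<le> d \<Longrightarrow> mat_app d T (\<lambda>s. poly (tau_poly \<theta> i) (\<theta> s)) r =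
      \<theta>s i * poly (tau_poly \<theta> i) (\<theta> r) + (if i = 0 then 0 else vphi i * poly (tau_poly \<theta> (i - 1)) (\<theta> r))"
    and T_eta: "\<And>i r. i \<le> d \<Longrightarrow> r \<le> d \<Longrightarrow> mat_app d T (\<lambda>s. poly (eta_poly d \<theta> i) (\<theta> s)) r =
      \<theta>s i * poly (eta_poly d \<theta> i) (\<theta> r) + (if i = 0 then 0 else phi i * poly (eta_poly d \<theta> (i - 1)) (\<theta> r))"
    and vphi: "\<And>i. 1 \<le> i \<Longrightarrow> i \<le> d \<Longrightarrow> vphi i \<noteq> 0"
    and phi: "\<And>i. 1 \<le> i \<Longrightarrow> i \<le> d \<Longrightarrow> phi i \<noteq> 0"
begin

definition \<tau> :: "nat \<Rightarrow> nat \<Rightarrow> 'k" where "\<tau> i r = poly (tau_poly \<theta> i) (\<theta> r)"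
definition \<eta> :: "nat \<Rightarrow> nat \<Rightarrow> 'k" where "\<eta> i r = poly (eta_poly d \<theta> i) (\<theta> r)"
definition sw :: "nat \<Rightarrow> 'k" where "sw r = (\<Prod>h<r. phi (d - h)) / (\<Prod>h=1..r. vphi h)"
definition wt :: "nat \<Rightarrow> 'k" where "wt r = 1 / (\<Prod>s\<in>{..d} - {r}. \<theta> r - \<theta> s)"

lemma \<theta>_eq_iff: "r \<le> d \<Longrightarrow> s \<le> d \<Longrightarrow> \<theta> r = \<theta> s \<longleftrightarrow> r = s"
  using inj by (auto dest: inj_onD)

lemma \<tau>_low: "r < i \<Longrightarrow> \<tau> i r = 0"
  by (auto simp: \<tau>_def tau_poly_def poly_prod)

lemma \<tau>_diag: "i \<le> d \<Longrightarrow> \<tau> i i \<noteq> 0"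
  by (auto simp: \<tau>_def tau_poly_def poly_prod \<theta>_eq_iff)

lemma \<eta>_high: "r \<le> d \<Longrightarrow> d < r + i \<Longrightarrow> \<eta> i r = 0"
  by (auto simp: \<eta>_def eta_poly_def poly_prod intro!: bexI[of _ "d - r"])

lemma \<eta>_diag: "i \<le> d \<Longrightarrow> \<eta> i (d - i) \<noteq> 0"
  by (auto simp: \<eta>_def eta_poly_def poly_prod \<theta>_eq_iff)

lemma sw_nonzero: "r \<le> d \<Longrightarrow> sw r \<noteq> 0"
  using vphi phi by (auto simp: sw_def)

lemma sw_Suc: "sw (Suc r) = sw r * phi (d - r) / vphi (Suc r)"
  by (simp add: sw_def)

text \<open>The nodes before \<open>r\<close> give \<open>\<tau> r r\<close>; those after it, taken
  from \<open>d\<close> downwards, give \<open>\<eta> (d - r) r\<close>.\<close>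

lemma wt_eq:
  assumes "r \<le> d"
  shows "wt r = 1 / (\<tau> r r * \<eta> (d - r) r)"
proof -
  have *: "{..d} - {r} = {..<r} \<union> {Suc r..d}" using assms by auto
  have "(\<Prod>s\<in>{..d} - {r}. \<theta> r - \<theta> s) = (\<Prod>s<r. \<theta> r - \<theta> s) * (\<Prod>s\<in>{Suc r..d}. \<theta> r - \<theta> s)"
    unfolding * by (rule prod.union_disjoint) auto
  also have "(\<Prod>s\<in>{Suc r..d}. \<theta> r - \<theta> s) = (\<Prod>h<d - r. \<theta> r - \<theta> (d - h))"
    by (rule prod.reindex_bij_witness[of _ "\<lambda>h. d - h" "\<lambda>s. d - s"]) (use assms in auto)
  finally show ?thesis
    by (simp add: wt_def \<tau>_def \<eta>_def tau_poly_def eta_poly_def poly_prod)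
qed

lemma wt_nonzero: "r \<le> d \<Longrightarrow> wt r \<noteq> 0"
  by (auto simp: wt_def \<theta>_eq_iff)

text \<open>The product polynomial is monic of degree \<open>i + j\<close>, so up to
  \<open>i + j = d\<close> interpolation reads off its coefficient of degree \<open>d\<close>.
  Beyond that the two functions have disjoint supports.\<close>

lemma sum_wt_\<tau>_\<eta>:
  assumes "i \<le> d" "j \<le> d"
  shows "(\<Sum>r\<le>d. wt r * (\<tau> j r * \<eta> i r)) = (if i + j = d then 1 else 0)"
proof (cases "i + j \<le> d")
  case True
  let ?p = "tau_poly \<theta> j * eta_poly d \<theta> i"
  have deg: "Polynomial.degree (tau_poly \<theta> j) = j" "Polynomial.degree (eta_poly d \<theta> i) = i"
    unfolding tau_poly_def eta_poly_def by (subst degree_prod_sum_eq; simp)+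
  have mon: "monic (tau_poly \<theta> j)" "monic (eta_poly d \<theta> i)"
    unfolding tau_poly_def eta_poly_def by (auto intro!: monic_prod)
  then have m: "monic ?p" by (rule monic_mult)
  have dp: "Polynomial.degree ?p = i + j"
    using mon deg by (subst degree_mult_eq) auto
  have "(\<Sum>r\<le>d. wt r * (\<tau> j r * \<eta> i r)) = Polynomial.coeff ?p d"
    using sum_Lagrange_weights[OF inj, of ?p] True dp
    by (simp add: wt_def \<tau>_def \<eta>_def)
  then show ?thesis
    using True m dp by (auto simp: coeff_eq_0)
next
  case False
  then have "\<tau> j r * \<eta> i r = 0" if "r \<le> d" for r
    using that \<tau>_low[of r j] \<eta>_high[of r i] by (cases "r < j") auto
  then have "(\<Sum>r\<le>d. wt r * (\<tau> j r * \<eta> i r)) = 0"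
    by (intro sum.neutral) auto
  then show ?thesis using False by simp
qed

lemma mat_app_\<tau>: "i \<le> d \<Longrightarrow> r \<le> d \<Longrightarrow>
    mat_app d T (\<tau> i) r = \<theta>s i * \<tau> i r + (if i = 0 then 0 else vphi i * \<tau> (i - 1) r)"
  using T_tau unfolding \<tau>_def .

lemma mat_app_\<eta>: "i \<le> d \<Longrightarrow> r \<le> d \<Longrightarrow>
    mat_app d T (\<eta> i) r = \<theta>s i * \<eta> i r + (if i = 0 then 0 else phi i * \<eta> (i - 1) r)"
  using T_eta unfolding \<eta>_def .

text \<open>Row \<open>r\<close> of \<open>T\<close> meets the support of
  \<open>\<tau> (Suc r)\<close> only in column \<open>Suc r\<close>, so the known action on
  \<open>\<tau> (Suc r)\<close> reveals this entry; \<open>T_sub\<close> does the same below the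
  diagonal with \<open>\<eta>\<close>.\<close>

lemma T_super:
  assumes "Suc r \<le> d"
  shows "T r (Suc r) * \<tau> (Suc r) (Suc r) = vphi (Suc r) * \<tau> r r"
proof -
  have "mat_app d T (\<tau> (Suc r)) r = (\<Sum>s\<in>{Suc r}. T r s * \<tau> (Suc r) s)"
    unfolding mat_app_def
  proof (rule sum.mono_neutral_right; (intro ballI)?)
    fix s assume "s \<in> {..d} - {Suc r}"
    then show "T r s * \<tau> (Suc r) s = 0"
      using assms tridiagonal[of r s] \<tau>_low[of s "Suc r"] by (cases s "Suc r" rule: linorder_cases) auto
  qed (use assms in auto)
  then show ?thesis
    using mat_app_\<tau>[of "Suc r" r] assms \<tau>_low[of r "Suc r"] by simp
qed

lemma T_sub:
  assumes "Suc r \<le> d"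
  shows "T (Suc r) r * \<eta> (d - r) r = phi (d - r) * \<eta> (d - Suc r) (Suc r)"
proof -
  have "mat_app d T (\<eta> (d - r)) (Suc r) = (\<Sum>s\<in>{r}. T (Suc r) s * \<eta> (d - r) s)"
    unfolding mat_app_def
  proof (rule sum.mono_neutral_right; (intro ballI)?)
    fix s assume "s \<in> {..d} - {r}"
    then show "T (Suc r) s * \<eta> (d - r) s = 0"
      using assms tridiagonal[of "Suc r" s] \<eta>_high[of s "d - r"] by (cases s r rule: linorder_cases) auto
  qed (use assms in auto)
  then show ?thesis
    using mat_app_\<eta>[of "d - r" "Suc r"] assms \<eta>_high[of "Suc r" "d - r"] by simp
qed

text \<open>\<open>T\<close> is self-adjoint for the bilinear form with weights \<open>wt r / sw r\<close>; for this form
  the dual basis of the \<open>\<eta>\<close>'s consists of the \<open>\<tau>\<close>'s multiplied by the switching element.\<close>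

lemma T_symmetrised:
  assumes "r \<le> d" "s \<le> d"
  shows "wt r / sw r * T r s = wt s / sw s * T s r"
proof -
  \<comment> \<open>The ratio of the two neighbouring entries is balanced by \<open>wt_eq\<close>
    and by the quotient \<open>phi (d - r) / vphi (Suc r)\<close> of consecutive values of
    \<open>sw\<close>; this is how the switching element enters the form.\<close>
  have adj: "wt r / sw r * T r (Suc r) = wt (Suc r) / sw (Suc r) * T (Suc r) r" if r: "Suc r \<le> d" for r
  proof -
    let ?a = "\<tau> r r" and ?b = "\<tau> (Suc r) (Suc r)" and ?c = "\<eta> (d - r) r" and ?e = "\<eta> (d - Suc r) (Suc r)"
    have nz: "?a \<noteq> 0" "?b \<noteq> 0" "?c \<noteq> 0" "?e \<noteq> 0" "sw r \<noteq> 0" "phi (d - r) \<noteq> 0" "vphi (Suc r) \<noteq> 0"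
      using r \<tau>_diag \<eta>_diag[of "d - r"] \<eta>_diag[of "d - Suc r"] sw_nonzero phi vphi by auto
    have T: "T r (Suc r) = vphi (Suc r) * ?a / ?b" "T (Suc r) r = phi (d - r) * ?e / ?c"
      using T_super[OF r] T_sub[OF r] nz by (auto simp: field_simps)
    show ?thesis
      using nz r by (simp add: T sw_Suc wt_eq)
  qed
  show ?thesis
  proof (cases "Suc r < s \<or> Suc s < r")
    case True
    then show ?thesis using assms tridiagonal[of r s] tridiagonal[of s r] by auto
  next
    case False
    then have "r = s \<or> s = Suc r \<or> r = Suc s" by auto
    then show ?thesis using adj assms by metis
  qed
qed

text \<open>Pairing with \<open>\<eta> i\<close> moves \<open>T\<close> onto
  \<open>\<eta> i\<close>, where its action is known, and duality evaluates the sums. The diagonal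
  comes out reversed because \<open>\<tau> j\<close> pairs with
  \<open>\<eta> (d - j)\<close>.\<close>

lemma mat_app_sw_\<tau>:
  assumes j: "j \<le> d" and r: "r \<le> d"
  shows "mat_app d T (\<lambda>s. sw s * \<tau> j s) r =
    \<theta>s (d - j) * (sw r * \<tau> j r) + (if j = 0 then 0 else phi (Suc d - j) * (sw r * \<tau> (j - 1) r))"
proof -
  define g where "g r = \<theta>s (d - j) * (sw r * \<tau> j r) + (if j = 0 then 0 else phi (Suc d - j) * (sw r * \<tau> (j - 1) r))" for r
  \<comment> \<open>Weighted difference of the two sides; it will be shown orthogonal to every
    \<open>\<eta>\<close>, hence zero.\<close>
  define D where "D r = wt r / sw r * (mat_app d T (\<lambda>s. sw s * \<tau> j s) r - g r)" for r
  have "(\<Sum>r\<le>d. D r * \<eta> (d - k) r) = 0" if "k \<le> d" for k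
  proof -
    define i where "i = d - k"
    have i: "i \<le> d" by (simp add: i_def)
    have g: "wt r / sw r * g r * \<eta> i r = \<theta>s (d - j) * (wt r * (\<tau> j r * \<eta> i r)) +
      (if j = 0 then 0 else phi (Suc d - j) * (wt r * (\<tau> (j - 1) r * \<eta> i r)))" if "r \<le> d" for r
      using sw_nonzero[OF that] by (simp add: g_def field_simps)
    have "(\<Sum>r\<le>d. wt r / sw r * g r * \<eta> i r) = \<theta>s (d - j) * (\<Sum>r\<le>d. wt r * (\<tau> j r * \<eta> i r)) +
      (if j = 0 then 0 else phi (Suc d - j) * (\<Sum>r\<le>d. wt r * (\<tau> (j - 1) r * \<eta> i r)))"
      by (subst sum.cong[OF refl g]) (auto simp: sum.distrib sum_distrib_left)
    also have "\<dots> = (if i + j = d then \<theta>s (d - j) else 0) + (if j \<noteq> 0 \<and> i + j = Suc d then phi (Suc d - j) else 0)"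
      using i j by (auto simp: sum_wt_\<tau>_\<eta>)
    finally have G: "(\<Sum>r\<le>d. wt r / sw r * g r * \<eta> i r) = \<dots>" .
    have "(\<Sum>r\<le>d. wt r / sw r * mat_app d T (\<lambda>s. sw s * \<tau> j s) r * \<eta> i r) =
      (\<Sum>r\<le>d. \<Sum>s\<le>d. (wt r / sw r * T r s) * (sw s * \<tau> j s) * \<eta> i r)"
      by (simp add: mat_app_def sum_distrib_left sum_distrib_right mult.assoc)
    also have "\<dots> = (\<Sum>r\<le>d. \<Sum>s\<le>d. (wt s / sw s * T s r) * (sw s * \<tau> j s) * \<eta> i r)"
      by (intro sum.cong refl) (simp only: T_symmetrised atMost_iff)
    also have "\<dots> = (\<Sum>s\<le>d. \<Sum>r\<le>d. (wt s / sw s * T s r) * (sw s * \<tau> j s) * \<eta> i r)"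
      by (rule sum.swap)
    also have "\<dots> = (\<Sum>s\<le>d. wt s * \<tau> j s * mat_app d T (\<eta> i) s)"
      unfolding mat_app_def sum_distrib_left
      by (intro sum.cong refl) (use sw_nonzero in \<open>auto simp: field_simps\<close>)
    also have "\<dots> = (\<Sum>s\<le>d. \<theta>s i * (wt s * (\<tau> j s * \<eta> i s)) + (if i = 0 then 0 else phi i * (wt s * (\<tau> j s * \<eta> (i - 1) s))))"
      using i by (intro sum.cong refl) (auto simp: mat_app_\<eta> algebra_simps)
    also have "\<dots> = \<theta>s i * (\<Sum>s\<le>d. wt s * (\<tau> j s * \<eta> i s)) + (if i = 0 then 0 else phi i * (\<Sum>s\<le>d. wt s * (\<tau> j s * \<eta> (i - 1) s)))"
      by (simp add: sum.distrib sum_distrib_left)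
    also have "\<dots> = (if i + j = d then \<theta>s (d - j) else 0) + (if j \<noteq> 0 \<and> i + j = Suc d then phi (Suc d - j) else 0)"
      using i j by (auto simp: sum_wt_\<tau>_\<eta>)
    finally show ?thesis
      using G unfolding D_def i_def[symmetric]
      by (simp add: right_diff_distrib left_diff_distrib sum_subtractf)
  qed
  then have "D r = 0"
  \<comment> \<open>Since \<open>\<eta> (d - k) r\<close> vanishes for \<open>k < r\<close>, the
    family is triangular when \<open>r\<close> numbers its members and \<open>k\<close> its
    points.\<close>
  proof (intro triangular_independent[where p = "\<lambda>r k. \<eta> (d - k) r" and d = d and c = D and i = r])
    show "\<eta> (d - k) i = 0" if "i \<le> d" "k < i" for i k
      using that by (intro \<eta>_high) auto
    show "\<eta> (d - i) i \<noteq> 0" if "i \<le> d" for i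
      using that \<eta>_diag[of "d - i"] by simp
  qed (use r in auto)
  then show ?thesis
    using r wt_nonzero sw_nonzero by (auto simp: D_def g_def)
qed

lemma sw_0: "sw 0 = 1"
  by (simp add: sw_def)

lemma sw_\<tau>_expansion:
  assumes rel: "bracket_relation d \<theta>s br"
    and one: "\<And>r s u. r + s + u = d \<Longrightarrow> r = 0 \<or> s = 0 \<or> u = 0 \<Longrightarrow> br r s u = 1"
    and "j \<le> d" "r \<le> d"
  shows "sw r * \<tau> j r = (\<Sum>i\<le>d. split_entry d br \<theta>s vphi (\<lambda>h. phi (Suc d - h)) i j * \<tau> i r)"
  by (rule split_transition[where p = \<tau> and y = "\<lambda>j r. sw r * \<tau> j r" and T = T])
    (use assms in \<open>auto simp: \<tau>_low \<tau>_diag mat_app_\<tau> mat_app_sw_\<tau> sw_0 vphi intro: one\<close>)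

text \<open>With exchanged roles the diagonal on \<open>sw r * \<tau> i r\<close> is
  \<open>\<theta>s (d - i)\<close>, and the diagonal on \<open>\<tau>\<close> is the reversal of
  that, as \<open>split_transition\<close> requires.\<close>

lemma \<tau>_expansion_sw:
  assumes rel: "bracket_relation d (\<lambda>i. \<theta>s (d - i)) br"
    and one: "\<And>r s u. r + s + u = d \<Longrightarrow> r = 0 \<or> s = 0 \<or> u = 0 \<Longrightarrow> br r s u = 1"
    and "j \<le> d" "r \<le> d"
  shows "\<tau> j r = (\<Sum>i\<le>d. split_entry d br (\<lambda>i. \<theta>s (d - i)) (\<lambda>h. phi (Suc d - h)) vphi i j * (sw r * \<tau> i r))"
  by (rule split_transition[where p = "\<lambda>j r. sw r * \<tau> j r" and y = \<tau> and T = T])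
    (use assms in \<open>auto simp: \<tau>_low \<tau>_diag mat_app_\<tau> mat_app_sw_\<tau> sw_0 vphi phi sw_nonzero intro: one\<close>)

end

section \<open>Diagonal matrix representations\<close>

lemma trace_mult_commute:
  fixes M N :: "'k::field mat"
  assumes "M \<in> carrier_mat n n" "N \<in> carrier_mat n n"
  shows "(\<Sum>i<n. (M * N) $$ (i, i)) = (\<Sum>i<n. (N * M) $$ (i, i))"
proof -
  have "(\<Sum>i<n. (M * N) $$ (i, i)) = (\<Sum>i<n. \<Sum>k<n. M $$ (i, k) * N $$ (k, i))"
    using assms by (intro sum.cong refl) (auto simp: scalar_prod_def atLeast0LessThan)
  also have "\<dots> = (\<Sum>k<n. \<Sum>i<n. N $$ (k, i) * M $$ (i, k))"
    by (subst sum.swap) (simp add: mult.commute)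
  also have "\<dots> = (\<Sum>i<n. (N * M) $$ (i, i))"
    using assms by (intro sum.cong refl) (auto simp: scalar_prod_def atLeast0LessThan)
  finally show ?thesis .
qed

context matrix_algebra
begin

lemma rho_carrier [simp]: "\<rho> x \<in> carrier_mat (d + 1) (d + 1)"
  using rho_bij by (auto simp: bij_betw_def)

lemma rho_carrier_Suc [simp]: "\<rho> x \<in> carrier_mat (Suc d) (Suc d)"
  using rho_carrier[of x] by simp

lemma rho_dim [simp]: "dim_row (\<rho> x) = d + 1" "dim_col (\<rho> x) = d + 1"
  by (rule carrier_matD[OF rho_carrier])+

lemma rho_eq_iff: "\<rho> x = \<rho> y \<longleftrightarrow> x = y"
  using rho_bij by (auto simp: bij_betw_def inj_on_def)

lemma rho_surj: "M \<in> carrier_mat (d + 1) (d + 1) \<Longrightarrow> \<exists>x. \<rho> x = M"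
  using rho_bij unfolding bij_betw_def by (metis imageE)

lemma rho_diff: "\<rho> (x - y) = \<rho> x - \<rho> y"
proof -
  have "\<rho> x = \<rho> (x - y) + \<rho> y" by (simp flip: rho_add)
  then show ?thesis
    by (intro eq_matI) auto
qed

lemma rho_zero: "\<rho> 0 = 0\<^sub>m (d + 1) (d + 1)"
proof -
  have "\<rho> 0 = \<rho> 0 - \<rho> 0" using rho_diff[of 0 0] by simp
  also have "\<dots> = 0\<^sub>m (d + 1) (d + 1)" by (rule minus_r_inv_mat) simp
  finally show ?thesis .
qed

lemma rho_entry_mult: "i \<le> d \<Longrightarrow> j \<le> d \<Longrightarrow> \<rho> (x * y) $$ (i, j) = (\<Sum>k\<le>d. \<rho> x $$ (i, k) * \<rho> y $$ (k, j))"
  by (simp add: rho_mult scalar_prod_def atLeast0LessThan lessThan_Suc_atMost)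

lemma rho_eqI: "(\<And>i j. i \<le> d \<Longrightarrow> j \<le> d \<Longrightarrow> \<rho> x $$ (i, j) = \<rho> y $$ (i, j)) \<Longrightarrow> x = y"
  by (subst rho_eq_iff[symmetric], rule eq_matI) auto

lemma rho_entry_add: "i \<le> d \<Longrightarrow> j \<le> d \<Longrightarrow> \<rho> (x + y) $$ (i, j) = \<rho> x $$ (i, j) + \<rho> y $$ (i, j)"
  by (simp add: rho_add)

lemma rho_entry_scale: "i \<le> d \<Longrightarrow> j \<le> d \<Longrightarrow> \<rho> (scaleA c x) $$ (i, j) = c * \<rho> x $$ (i, j)"
  by (simp add: rho_scale)

lemma rho_entry_one: "i \<le> d \<Longrightarrow> j \<le> d \<Longrightarrow> \<rho> 1 $$ (i, j) = (if i = j then 1 else 0)"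
  by (simp add: rho_one)

lemma rho_entry_zero: "i \<le> d \<Longrightarrow> j \<le> d \<Longrightarrow> \<rho> 0 $$ (i, j) = 0"
  by (simp add: rho_zero)

lemma rho_entry_sum: "i \<le> d \<Longrightarrow> j \<le> d \<Longrightarrow> \<rho> (\<Sum>r\<in>I. f r) $$ (i, j) = (\<Sum>r\<in>I. \<rho> (f r) $$ (i, j))"
  by (induction I rule: infinite_finite_induct) (auto simp: rho_entry_zero rho_entry_add)

lemma rho_entry_diag_prod_list:
  assumes A: "\<And>i j. i \<le> d \<Longrightarrow> j \<le> d \<Longrightarrow> \<rho> A $$ (i, j) = (if i = j then \<theta> i else 0)"
    and "i \<le> d" "j \<le> d"
  shows "\<rho> (\<Prod>k\<leftarrow>ks. scaleA (c k) (A - scaleA (t k) 1)) $$ (i, j) =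
    (if i = j then (\<Prod>k\<leftarrow>ks. c k * (\<theta> i - t k)) else 0)"
  using assms(2-)
proof (induction ks arbitrary: j)
  case (Cons k ks)
  have f: "\<rho> (scaleA (c k) (A - scaleA (t k) 1)) $$ (i, l) = (if l = i then c k * (\<theta> i - t k) else 0)" if "l \<le> d" for l
    using that Cons.prems by (auto simp: rho_entry_scale rho_diff rho_entry_one A)
  have "\<rho> (\<Prod>k\<leftarrow>k # ks. scaleA (c k) (A - scaleA (t k) 1)) $$ (i, j) =
    (\<Sum>l\<le>d. (if l = i then c k * (\<theta> i - t k) else 0) * \<rho> (\<Prod>k\<leftarrow>ks. scaleA (c k) (A - scaleA (t k) 1)) $$ (l, j))"
    using Cons.prems f by (simp add: rho_entry_mult)
  also have "\<dots> = c k * (\<theta> i - t k) * \<rho> (\<Prod>k\<leftarrow>ks. scaleA (c k) (A - scaleA (t k) 1)) $$ (i, j)"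
    using Cons.prems by (subst sum.remove[of _ i]) (auto intro!: sum.neutral)
  finally show ?case using Cons by simp
qed (simp add: rho_entry_one)

text \<open>Values of a Lagrange basis polynomial at the nodes; they make primitive idempotents
  diagonal matrix units once the element is diagonal.\<close>

lemma prod_list_interpolation:
  fixes \<theta> :: "nat \<Rightarrow> 'k"
  assumes inj: "inj_on \<theta> {..d}" and "i \<le> d" "r \<le> d"
  shows "(\<Prod>k\<leftarrow>filter (\<lambda>j. j \<noteq> r) [0..<d + 1]. inverse (\<theta> r - \<theta> k) * (\<theta> i - \<theta> k)) =
    (if i = r then 1 else 0)"
proof -
  let ?ks = "filter (\<lambda>j. j \<noteq> r) [0..<d + 1]"
  let ?f = "\<lambda>i k. inverse (\<theta> r - \<theta> k) * (\<theta> i - \<theta> k)"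
  show ?thesis
  proof (cases "i = r")
    case True
    have "?f r k = 1" if "k \<in> set ?ks" for k
    proof -
      have "\<theta> r - \<theta> k \<noteq> 0"
        using that inj assms(3) by (auto simp del: upt_Suc dest: inj_onD)
      then show ?thesis by simp
    qed
    then have "map (?f r) ?ks = map (\<lambda>_. 1) ?ks" by (intro map_cong refl) auto
    then show ?thesis unfolding True by (simp only: map_replicate_const) (simp add: prod_list_replicate)
  next
    case False
    then have "i \<in> set ?ks" using assms(2) by (simp del: upt_Suc)
    then have "?f i i \<in> set (map (?f i) ?ks)" unfolding set_map by (rule imageI)
    then have "0 \<in> set (map (?f i) ?ks)" by simp
    then show ?thesis using False by (simp only: prod_list_zero_iff if_False)
  qed
qed

lemma rho_entry_primitive_idempotent:
  assumes A: "\<And>i j. i \<le> d \<Longrightarrow> j \<le> d \<Longrightarrow> \<rho> A $$ (i, j) = (if i = j then \<theta> i else 0)"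
    and inj: "inj_on \<theta> {..d}" and "i \<le> d" "j \<le> d" "r \<le> d"
  shows "\<rho> (primitive_idempotent d scaleA A \<theta> r) $$ (i, j) = (if i = j \<and> i = r then 1 else 0)"
proof -
  have "\<rho> (primitive_idempotent d scaleA A \<theta> r) $$ (i, j) = (if i = j then
    (\<Prod>k\<leftarrow>filter (\<lambda>j. j \<noteq> r) [0..<d + 1]. inverse (\<theta> r - \<theta> k) * (\<theta> i - \<theta> k)) else 0)"
    unfolding primitive_idempotent_def
    by (rule rho_entry_diag_prod_list) (use assms in auto)
  then show ?thesis
    unfolding prod_list_interpolation[OF inj assms(3,5)] by auto
qed

lemma rho_prod_list_eigenvector:
  assumes v: "v \<in> carrier_vec (d + 1)" and Av: "\<rho> A *\<^sub>v v = \<theta> \<cdot>\<^sub>v v"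
  shows "\<rho> (\<Prod>k\<leftarrow>ks. scaleA (c k) (A - scaleA (t k) 1)) *\<^sub>v v = (\<Prod>k\<leftarrow>ks. c k * (\<theta> - t k)) \<cdot>\<^sub>v v"
proof (induction ks)
  case Nil
  then show ?case using v by (simp add: rho_one)
next
  case (Cons k ks)
  let ?a = "scaleA (c k) (A - scaleA (t k) 1)" and ?b = "\<Prod>k\<leftarrow>ks. scaleA (c k) (A - scaleA (t k) 1)"
  let ?\<pi> = "\<Prod>k\<leftarrow>ks. c k * (\<theta> - t k)"
  have a: "\<rho> ?a *\<^sub>v v = (c k * (\<theta> - t k)) \<cdot>\<^sub>v v"
  proof (rule eq_vecI)
    fix i assume "i < dim_vec ((c k * (\<theta> - t k)) \<cdot>\<^sub>v v)"
    then have i: "i < d + 1" using v by simp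
    have s: "(\<rho> x *\<^sub>v v) $ i = (\<Sum>j\<le>d. \<rho> x $$ (i, j) * v $ j)" for x
      using i v by (simp add: scalar_prod_def atLeast0LessThan lessThan_Suc_atMost)
    have "(\<rho> ?a *\<^sub>v v) $ i = (\<Sum>j\<le>d. c k * (\<rho> A $$ (i, j) * v $ j) - (if j = i then c k * t k * v $ i else 0))"
      unfolding s using i by (intro sum.cong) (auto simp: rho_scale rho_diff rho_one algebra_simps)
    also have "\<dots> = c k * (\<rho> A *\<^sub>v v) $ i - c k * t k * v $ i"
      unfolding s using i by (simp add: sum_subtractf sum_distrib_left)
    also have "\<dots> = ((c k * (\<theta> - t k)) \<cdot>\<^sub>v v) $ i"
      unfolding Av using i v by (simp add: algebra_simps)
    finally show "(\<rho> ?a *\<^sub>v v) $ i = ((c k * (\<theta> - t k)) \<cdot>\<^sub>v v) $ i" .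
  qed (use v in simp)
  have "\<rho> (?a * ?b) *\<^sub>v v = \<rho> ?a *\<^sub>v (\<rho> ?b *\<^sub>v v)"
    unfolding rho_mult by (rule assoc_mult_mat_vec[OF rho_carrier rho_carrier v])
  also have "\<dots> = ?\<pi> \<cdot>\<^sub>v (\<rho> ?a *\<^sub>v v)"
    unfolding Cons by (rule mult_mat_vec[OF rho_carrier v])
  also have "\<dots> = (c k * (\<theta> - t k) * ?\<pi>) \<cdot>\<^sub>v v"
    unfolding a by (simp add: smult_smult_assoc mult.commute)
  finally show ?case by simp
qed

text \<open>Conjugation by a matrix of eigenvectors gives another isomorphism onto the matrix
  algebra, and it preserves traces.\<close>

lemma diagonal_representation:
  assumes ord: "eigenvalue_ordering d \<rho> A \<theta>"
  obtains \<sigma> where "matrix_algebra scaleA d \<sigma>"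
    "\<And>i j. i \<le> d \<Longrightarrow> j \<le> d \<Longrightarrow> \<sigma> A $$ (i, j) = (if i = j then \<theta> i else 0)"
    "\<And>x. alg_trace \<rho> x = (\<Sum>i\<le>d. \<sigma> x $$ (i, i))"
proof -
  let ?n = "d + 1"
  have inj: "inj_on \<theta> {..d}" using ord by (simp add: eigenvalue_ordering_def bij_betw_def atLeast0AtMost)
  have "\<exists>v. eigenvector (\<rho> A) v (\<theta> i)" if "i \<le> d" for i
    using ord that unfolding eigenvalue_ordering_def bij_betw_def eigenvalue_def by auto
  then obtain v where v: "\<And>i. i \<le> d \<Longrightarrow> eigenvector (\<rho> A) (v i) (\<theta> i)" by metis
  define P where "P = mat ?n ?n (\<lambda>(r, i). v i $ r)"
  have P: "P \<in> carrier_mat ?n ?n" by (simp add: P_def)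
  have vc: "v i \<in> carrier_vec ?n" "v i \<noteq> 0\<^sub>v ?n" "\<rho> A *\<^sub>v v i = \<theta> i \<cdot>\<^sub>v v i" if "i \<le> d" for i
    using v[OF that] by (auto simp: eigenvector_def)
  define D where "D = mat ?n ?n (\<lambda>(i, j). if i = j then \<theta> i else 0)"
  have D: "D \<in> carrier_mat ?n ?n" by (simp add: D_def)
  have colP: "col P i = v i" if "i \<le> d" for i
    using that vc(1)[OF that] by (intro eq_vecI) (auto simp: P_def)
  have AP: "\<rho> A * P = P * D"
  proof (rule eq_matI)
    fix r i assume "r < dim_row (P * D)" "i < dim_col (P * D)"
    then have ri: "r < ?n" "i \<le> d" using P D by auto
    have "(\<rho> A * P) $$ (r, i) = (\<rho> A *\<^sub>v v i) $ r"
      using ri P colP by simp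
    also have "\<dots> = \<theta> i * P $$ (r, i)"
      using ri vc[of i] by (simp add: P_def)
    also have "\<dots> = (\<Sum>k\<in>{0..<?n}. P $$ (r, k) * D $$ (k, i))"
      using ri by (subst sum.remove[of _ i]) (auto simp: D_def intro!: sum.neutral)
    also have "\<dots> = (P * D) $$ (r, i)"
      using ri P D by (simp add: scalar_prod_def)
    finally show "(\<rho> A * P) $$ (r, i) = (P * D) $$ (r, i)" .
  qed (use P D in auto)
  have "det P \<noteq> 0"
  proof
    assume "det P = 0"
    then obtain c where c: "c \<in> carrier_vec ?n" "c \<noteq> 0\<^sub>v ?n" "P *\<^sub>v c = 0\<^sub>v ?n"
      using det_0_iff_vec_prod_zero_field[OF P] by auto
    \<comment> \<open>The primitive idempotent for \<open>\<theta> k\<close> kills every eigenvector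
      except \<open>v k\<close>; applied to the vanishing \<open>P *\<^sub>v c\<close> it isolates
      \<open>c $ k\<close>.\<close>
    have "c $ k = 0" if k: "k \<le> d" for k
    proof -
      let ?x = "primitive_idempotent d scaleA A \<theta> k"
      define U where "U = mat ?n ?n (\<lambda>(i, j). if i = j \<and> i = k then 1 else (0::'k))"
      have U: "U \<in> carrier_mat ?n ?n" by (simp add: U_def)
      have xv: "\<rho> ?x *\<^sub>v v i = (if i = k then 1 else 0) \<cdot>\<^sub>v v i" if "i \<le> d" for i
        unfolding primitive_idempotent_def
        by (subst rho_prod_list_eigenvector[OF vc(1)[OF that] vc(3)[OF that]])
          (simp only: prod_list_interpolation[OF inj that k])
      have xP: "\<rho> ?x * P = P * U"
      proof (rule eq_matI)
        fix r i assume "r < dim_row (P * U)" "i < dim_col (P * U)"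
        then have ri: "r < ?n" "i \<le> d" using P U by auto
        have "(\<rho> ?x * P) $$ (r, i) = (\<rho> ?x *\<^sub>v v i) $ r"
          using ri P colP by simp
        also have "\<dots> = P $$ (r, i) * U $$ (i, i)"
          using ri xv[of i] vc(1)[of i] by (simp add: P_def U_def)
        also have "\<dots> = (\<Sum>l\<in>{0..<?n}. P $$ (r, l) * U $$ (l, i))"
          using ri by (subst sum.remove[of _ i]) (auto simp: U_def intro!: sum.neutral)
        also have "\<dots> = (P * U) $$ (r, i)"
          using ri P U by (simp add: scalar_prod_def)
        finally show "(\<rho> ?x * P) $$ (r, i) = (P * U) $$ (r, i)" .
      qed (use P U in auto)
      have Uc: "U *\<^sub>v c = c $ k \<cdot>\<^sub>v unit_vec ?n k"
      proof (rule eq_vecI)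
        fix i assume "i < dim_vec (c $ k \<cdot>\<^sub>v unit_vec ?n k)"
        then have i: "i < ?n" by simp
        have "(U *\<^sub>v c) $ i = (\<Sum>l\<in>{0..<?n}. (if i = l \<and> i = k then 1 else 0) * c $ l)"
          using i c(1) by (simp add: U_def scalar_prod_def)
        also have "\<dots> = (if i = k then c $ k else 0)"
          using i by (subst sum.remove[of _ i]) (auto intro!: sum.neutral)
        finally show "(U *\<^sub>v c) $ i = (c $ k \<cdot>\<^sub>v unit_vec ?n k) $ i"
          using i k by simp
      qed (use U in simp)
      have "0\<^sub>v ?n = \<rho> ?x *\<^sub>v (P *\<^sub>v c)" unfolding c(3) by (intro eq_vecI) (auto simp: scalar_prod_def)
      also have "\<dots> = (P * U) *\<^sub>v c"
        unfolding xP[symmetric] by (rule assoc_mult_mat_vec[symmetric, OF rho_carrier P c(1)])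
      also have "\<dots> = P *\<^sub>v (U *\<^sub>v c)" by (rule assoc_mult_mat_vec[OF P U c(1)])
      also have "\<dots> = c $ k \<cdot>\<^sub>v (P *\<^sub>v unit_vec ?n k)"
        unfolding Uc by (rule mult_mat_vec[OF P]) simp
      also have "P *\<^sub>v unit_vec ?n k = v k"
        using k P vc(1)[OF k] by (intro eq_vecI) (auto simp: P_def scalar_prod_right_unit)
      finally have *: "0\<^sub>v ?n = c $ k \<cdot>\<^sub>v v k" .
      obtain i where i: "i < ?n" "v k $ i \<noteq> 0"
        using vc(1,2)[OF k] by (metis carrier_vecD eq_vecI index_zero_vec)
      have "(c $ k \<cdot>\<^sub>v v k) $ i = 0" unfolding *[symmetric] using i by simp
      then show ?thesis using i vc(1)[OF k] by simp
    qed
    then have "c = 0\<^sub>v ?n" using c(1) by (intro eq_vecI) auto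
    then show False using c(2) by simp
  qed
  then obtain Q where Q: "Q \<in> carrier_mat ?n ?n" "Q * P = 1\<^sub>m ?n" "P * Q = 1\<^sub>m ?n"
    using det_non_zero_imp_unit[OF P] by (auto simp: Units_def ring_mat_def)
  define \<sigma> where "\<sigma> x = Q * \<rho> x * P" for x
  define n where "n = ?n"
  note rc = rho_carrier[folded n_def] and P' = P[folded n_def] and Q' = Q[folded n_def] and D' = D[folded n_def]
  have assoc: "X1 * X2 * X3 = X1 * (X2 * X3)"
    if "X1 \<in> carrier_mat n n" "X2 \<in> carrier_mat n n" "X3 \<in> carrier_mat n n" for X1 X2 X3 :: "'k mat"
    using that by (rule assoc_mult_mat)
  have mc [simp]: "X1 * X2 \<in> carrier_mat n n"
    if "X1 \<in> carrier_mat n n" "X2 \<in> carrier_mat n n" for X1 X2 :: "'k mat"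
    using that by (rule mult_carrier_mat)
  have cancel: "P * (Q * M) = M" "Q * (P * M) = M" if "M \<in> carrier_mat n n" for M :: "'k mat"
    using that P' Q' by (simp_all flip: assoc)
  note one = left_mult_one_mat[of _ n n] right_mult_one_mat[of _ n n]
  have \<sigma>c: "\<sigma> x \<in> carrier_mat n n" for x
    unfolding \<sigma>_def using P' Q' rc by simp
  have rho_\<sigma>: "P * \<sigma> x * Q = \<rho> x" for x
    unfolding \<sigma>_def using P' Q' rc[of x] by (simp add: assoc cancel one)
  have "matrix_algebra scaleA d \<sigma>"
  proof
    show "bij_betw \<sigma> UNIV (carrier_mat ?n ?n)"
      unfolding n_def[symmetric]
    proof (rule bij_betwI')
      show "\<sigma> x = \<sigma> y \<longleftrightarrow> x = y" for x y
        using rho_\<sigma> rho_eq_iff by metis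
      show "\<sigma> x \<in> carrier_mat n n" for x by (rule \<sigma>c)
      fix M :: "'k mat" assume M: "M \<in> carrier_mat n n"
      then have "P * M * Q \<in> carrier_mat n n" using P' Q' by simp
      then obtain x where x: "\<rho> x = P * M * Q" using rho_surj unfolding n_def by blast
      have "\<sigma> x = M"
        unfolding \<sigma>_def x using P' Q' M by (simp add: assoc cancel one)
      then show "\<exists>x\<in>UNIV. M = \<sigma> x" by auto
    qed
    show "\<sigma> (x + y) = \<sigma> x + \<sigma> y" for x y
      unfolding \<sigma>_def rho_add using P' Q' rc
      by (simp add: mult_add_distrib_mat[of _ n n _ n] add_mult_distrib_mat[of _ n n _ _ n])
    show "\<sigma> (x * y) = \<sigma> x * \<sigma> y" for x y
      unfolding \<sigma>_def rho_mult using P' Q' rc[of x] rc[of y] by (simp add: assoc cancel one)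
    show "\<sigma> 1 = 1\<^sub>m ?n"
      unfolding \<sigma>_def rho_one n_def[symmetric] using P' Q' by simp
    show "\<sigma> (scaleA c x) = c \<cdot>\<^sub>m \<sigma> x" for c x
      unfolding \<sigma>_def rho_scale using P' Q' rc[of x]
      by (simp add: mult_smult_distrib[of _ n n _ n] mult_smult_assoc_mat[of _ n n _ n])
  qed
  moreover have "\<sigma> A = D"
    unfolding \<sigma>_def using P' Q' rc[of A] D' by (simp add: assoc AP cancel one)
  then have "\<And>i j. i \<le> d \<Longrightarrow> j \<le> d \<Longrightarrow> \<sigma> A $$ (i, j) = (if i = j then \<theta> i else 0)"
    by (simp add: D_def)
  moreover have "alg_trace \<rho> x = (\<Sum>i\<le>d. \<sigma> x $$ (i, i))" for x
  proof -
    have "(\<Sum>i<n. \<sigma> x $$ (i, i)) = (\<Sum>i<n. (P * (Q * \<rho> x)) $$ (i, i))"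
      unfolding \<sigma>_def by (rule trace_mult_commute) (use P' Q' rc in auto)
    then show ?thesis
      using P' Q' rc[of x] by (simp add: cancel one alg_trace_def lessThan_Suc_atMost n_def)
  qed
  ultimately show thesis using that by blast
qed

end

section \<open>Tridiagonal matrices with polynomial eigenfunctions\<close>

lemma degree_tau_poly: "Polynomial.degree (tau_poly \<theta> i) = i"
  unfolding tau_poly_def by (subst degree_prod_sum_eq) auto

lemma poly_tau_poly: "poly (tau_poly \<theta> i) x = (\<Prod>h<i. x - \<theta> h)"
  by (simp add: tau_poly_def poly_prod)

lemma poly_tau_poly_zero: "h < i \<Longrightarrow> poly (tau_poly \<theta> i) (\<theta> h) = 0"
  by (auto simp: poly_tau_poly)

lemma eta_poly_eq_tau_poly: "eta_poly d \<theta> = tau_poly (\<lambda>i. \<theta> (d - i))"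
  by (simp add: fun_eq_iff eta_poly_def tau_poly_def)

text \<open>A multiple of \<open>P (Suc i)\<close> removes the top coefficient, which lowers the
  degree.\<close>

lemma poly_expansion_graded:
  fixes P :: "nat \<Rightarrow> 'k::field poly"
  assumes deg: "\<And>i. i \<le> d \<Longrightarrow> Polynomial.degree (P i) = i" "\<And>i. i \<le> d \<Longrightarrow> P i \<noteq> 0"
  shows "i \<le> d \<Longrightarrow> Polynomial.degree p \<le> i \<Longrightarrow> \<exists>c. p = (\<Sum>k\<le>i. Polynomial.smult (c k) (P k))"
proof (induction i arbitrary: p)
  case 0
  then obtain a b where "p = [:a:]" "P 0 = [:b:]" "b \<noteq> 0"
    using deg[of 0] by (metis degree_eq_zeroE le_zero_eq pCons_0_0)
  then show ?case by (intro exI[of _ "\<lambda>_. a / b"]) simp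
next
  case (Suc i)
  define a where "a = Polynomial.coeff p (Suc i) / Polynomial.coeff (P (Suc i)) (Suc i)"
  let ?q = "p - Polynomial.smult a (P (Suc i))"
  have "Polynomial.coeff (P (Suc i)) (Suc i) \<noteq> 0"
    using deg[of "Suc i"] Suc.prems leading_coeff_neq_0[of "P (Suc i)"] by simp
  then have "Polynomial.coeff ?q (Suc i) = 0" by (simp add: a_def)
  moreover have "Polynomial.degree ?q \<le> Suc i"
    using Suc.prems deg(1)[of "Suc i"] by (intro degree_diff_le) (auto intro: order.trans[OF degree_smult_le])
  ultimately have "Polynomial.degree ?q \<le> i"
    by (metis eq_zero_or_degree_less le_SucE leading_coeff_0_iff degree_0 le0)
  then obtain c where c: "?q = (\<Sum>k\<le>i. Polynomial.smult (c k) (P k))"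
    using Suc.IH[of ?q] Suc.prems by auto
  have "p = (\<Sum>k\<le>Suc i. Polynomial.smult ((c(Suc i := a)) k) (P k))"
    using c by (simp add: algebra_simps)
  then show ?case by blast
qed

text \<open>The eigenfunctions of \<open>T\<close> being polynomials of increasing degree, \<open>T - \<theta>s i\<close> lowers the degree of
  \<open>\<tau>\<^sub>i\<close>; tridiagonality keeps all its zeros but one.\<close>

lemma tridiagonal_split:
  fixes P :: "nat \<Rightarrow> 'k::field poly"
  assumes inj: "inj_on \<theta> {..d}"
    and tridiagonal: "\<And>r s. r \<le> d \<Longrightarrow> s \<le> d \<Longrightarrow> Suc r < s \<or> Suc s < r \<Longrightarrow> T r s = 0"
    and deg: "\<And>i. i \<le> d \<Longrightarrow> Polynomial.degree (P i) = i" "\<And>i. i \<le> d \<Longrightarrow> P i \<noteq> 0"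
    and TP: "\<And>i r. i \<le> d \<Longrightarrow> r \<le> d \<Longrightarrow> mat_app d T (\<lambda>s. poly (P i) (\<theta> s)) r = \<theta>s i * poly (P i) (\<theta> r)"
    and i: "i \<le> d"
  obtains c where "\<And>r. r \<le> d \<Longrightarrow> mat_app d T (\<lambda>s. poly (tau_poly \<theta> i) (\<theta> s)) r =
      \<theta>s i * poly (tau_poly \<theta> i) (\<theta> r) + (if i = 0 then 0 else c * poly (tau_poly \<theta> (i - 1)) (\<theta> r))"
proof -
  obtain a where a: "tau_poly \<theta> i = (\<Sum>k\<le>i. Polynomial.smult (a k) (P k))"
    using poly_expansion_graded[where P = P and d = d and p = "tau_poly \<theta> i" and i = i, OF deg i] degree_tau_poly[of \<theta> i] by auto
  \<comment> \<open>What is left of the image of \<open>tau_poly \<theta> i\<close> after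
    \<open>\<theta>s i\<close> times it is taken away. The term \<open>k = i\<close> cancels, so the
    degree drops below \<open>i\<close>.\<close>
  define R where "R = (\<Sum>k<i. Polynomial.smult (a k * (\<theta>s k - \<theta>s i)) (P k))"
  have TR: "mat_app d T (\<lambda>s. poly (tau_poly \<theta> i) (\<theta> s)) r = \<theta>s i * poly (tau_poly \<theta> i) (\<theta> r) + poly R (\<theta> r)"
    if r: "r \<le> d" for r
  proof -
    have "mat_app d T (\<lambda>s. poly (tau_poly \<theta> i) (\<theta> s)) r = (\<Sum>k\<le>i. a k * (\<theta>s k * poly (P k) (\<theta> r)))"
      unfolding a poly_sum poly_smult by (subst mat_app_sum) (use TP r i in simp)
    also have "\<dots> = \<theta>s i * (\<Sum>k\<le>i. a k * poly (P k) (\<theta> r)) + (\<Sum>k\<le>i. a k * (\<theta>s k - \<theta>s i) * poly (P k) (\<theta> r))"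
      by (simp add: sum_distrib_left sum.distrib[symmetric] algebra_simps)
    also have "\<dots> = \<theta>s i * poly (tau_poly \<theta> i) (\<theta> r) + poly R (\<theta> r)"
      unfolding a R_def poly_sum poly_smult by (simp add: lessThan_Suc_atMost[symmetric])
    finally show ?thesis .
  qed
  show thesis
  proof (cases "i = 0")
    case True
    then show ?thesis using TR that[of 0] by (simp add: R_def)
  next
    case False
    then obtain m where m: "i = Suc m" by (cases i) auto
    have degR: "Polynomial.degree R \<le> m"
      unfolding R_def by (intro degree_sum_le) (use deg(1) i m in \<open>auto intro: order.trans[OF degree_smult_le]\<close>)
    \<comment> \<open>Row \<open>r\<close> of \<open>T\<close> reaches at most
      \<open>Suc r < i\<close>, where \<open>tau_poly \<theta> i\<close> is zero.\<close>
    have zero: "poly R (\<theta> r) = 0" if "r < m" for r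
    proof -
      have "mat_app d T (\<lambda>s. poly (tau_poly \<theta> i) (\<theta> s)) r = 0"
        unfolding mat_app_def
      proof (intro sum.neutral ballI)
        fix s assume "s \<in> {..d}"
        then show "T r s * poly (tau_poly \<theta> i) (\<theta> s) = 0"
          using tridiagonal[of r s] that i m by (cases "s < i") (auto simp: poly_tau_poly_zero)
      qed
      moreover have "poly (tau_poly \<theta> i) (\<theta> r) = 0" using that m by (auto simp: poly_tau_poly)
      ultimately show ?thesis using TR[of r] that i m by simp
    qed
    have nz: "poly (tau_poly \<theta> m) (\<theta> m) \<noteq> 0"
      using inj i m by (auto simp: poly_tau_poly dest: inj_onD)
    define c where "c = poly R (\<theta> m) / poly (tau_poly \<theta> m) (\<theta> m)"
    \<comment> \<open>Both polynomials have degree at most \<open>m\<close> and agree at the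
      \<open>m + 1\<close> nodes up to \<open>\<theta> m\<close>.\<close>
    have "R = Polynomial.smult c (tau_poly \<theta> m)"
    proof (rule poly_eqI_degree[where A = "\<theta> ` {..m}"])
      have "card (\<theta> ` {..m}) = Suc m"
        using inj i m by (subst card_image) (auto intro: inj_on_subset)
      then show "Polynomial.degree R < card (\<theta> ` {..m})"
        "Polynomial.degree (Polynomial.smult c (tau_poly \<theta> m)) < card (\<theta> ` {..m})"
        using degR degree_smult_le[of c "tau_poly \<theta> m"] degree_tau_poly[of \<theta> m] by auto
      fix x assume "x \<in> \<theta> ` {..m}"
      then obtain r where r: "r \<le> m" "x = \<theta> r" by auto
      show "poly R x = poly (Polynomial.smult c (tau_poly \<theta> m)) x"
      proof (cases "r = m")
        case True
        then show ?thesis using nz r by (simp add: c_def)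
      next
        case False
        then have "r < m" using r by simp
        then have "poly (tau_poly \<theta> m) x = 0" using r by (auto simp: poly_tau_poly)
        then show ?thesis using zero[OF \<open>r < m\<close>] r by simp
      qed
    qed
    then show ?thesis using TR that[of c] m by simp
  qed
qed

text \<open>Reversing the order of the nodes turns \<open>eta_poly\<close> into
  \<open>tau_poly\<close> and keeps \<open>T\<close> tridiagonal.\<close>

lemma tridiagonal_split_reverse:
  fixes P :: "nat \<Rightarrow> 'k::field poly"
  assumes inj: "inj_on \<theta> {..d}"
    and tridiagonal: "\<And>r s. r \<le> d \<Longrightarrow> s \<le> d \<Longrightarrow> Suc r < s \<or> Suc s < r \<Longrightarrow> T r s = 0"
    and deg: "\<And>i. i \<le> d \<Longrightarrow> Polynomial.degree (P i) = i" "\<And>i. i \<le> d \<Longrightarrow> P i \<noteq> 0"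
    and TP: "\<And>i r. i \<le> d \<Longrightarrow> r \<le> d \<Longrightarrow> mat_app d T (\<lambda>s. poly (P i) (\<theta> s)) r = \<theta>s i * poly (P i) (\<theta> r)"
    and i: "i \<le> d"
  obtains c where "\<And>r. r \<le> d \<Longrightarrow> mat_app d T (\<lambda>s. poly (eta_poly d \<theta> i) (\<theta> s)) r =
      \<theta>s i * poly (eta_poly d \<theta> i) (\<theta> r) + (if i = 0 then 0 else c * poly (eta_poly d \<theta> (i - 1)) (\<theta> r))"
proof -
  let ?T = "\<lambda>r s. T (d - r) (d - s)" and ?\<theta> = "\<lambda>r. \<theta> (d - r)"
  have rev: "mat_app d ?T (\<lambda>s. g (?\<theta> s)) r = mat_app d T (\<lambda>s. g (\<theta> s)) (d - r)" for g :: "'k \<Rightarrow> 'k" and r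
    unfolding mat_app_def by (rule sum.reindex_bij_witness[of _ "\<lambda>s. d - s" "\<lambda>s. d - s"]) auto
  have "inj_on ?\<theta> {..d}"
    using inj by (intro inj_onI) (auto dest!: inj_onD)
  then obtain c where c: "\<And>r. r \<le> d \<Longrightarrow> mat_app d ?T (\<lambda>s. poly (tau_poly ?\<theta> i) (?\<theta> s)) r =
      \<theta>s i * poly (tau_poly ?\<theta> i) (?\<theta> r) + (if i = 0 then 0 else c * poly (tau_poly ?\<theta> (i - 1)) (?\<theta> r))"
  proof (rule tridiagonal_split[where T = ?T and P = P and \<theta>s = \<theta>s and i = i])
    show "?T r s = 0" if "r \<le> d" "s \<le> d" "Suc r < s \<or> Suc s < r" for r s
      using that by (intro tridiagonal) auto
    show "mat_app d ?T (\<lambda>s. poly (P i) (?\<theta> s)) r = \<theta>s i * poly (P i) (?\<theta> r)" if "i \<le> d" for i r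
      unfolding rev using that by (simp add: TP)
  qed (use deg i in auto)
  show thesis
  proof (rule that[of c])
    fix r assume "r \<le> d"
    then show "mat_app d T (\<lambda>s. poly (eta_poly d \<theta> i) (\<theta> s)) r =
      \<theta>s i * poly (eta_poly d \<theta> i) (\<theta> r) + (if i = 0 then 0 else c * poly (eta_poly d \<theta> (i - 1)) (\<theta> r))"
      using c[of "d - r"] unfolding rev eta_poly_eq_tau_poly by simp
  qed
qed

section \<open>The module of a Leonard system\<close>

context left_module_over_algebra
begin

lemma act_zero_left [simp]: "act 0 v = 0"
  using act_add_left[of 0 0 v] by simp

lemma act_zero_right [simp]: "act x 0 = 0"
  using act_add_right[of x 0 0] by simp

lemma act_sum_left: "act (\<Sum>i\<in>I. f i) v = (\<Sum>i\<in>I. act (f i) v)"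
  by (induction I rule: infinite_finite_induct) (auto simp: act_add_left)

lemma act_sum_right: "act x (\<Sum>i\<in>I. f i) = (\<Sum>i\<in>I. act x (f i))"
  by (induction I rule: infinite_finite_induct) (auto simp: act_add_right)

text \<open>A scalar acts as the central element \<open>scaleA c 1\<close>.\<close>

lemma act_scale_right: "act x (scaleV c v) = scaleV c (act x v)"
proof -
  have "act x (scaleV c v) = act x (act (scaleA c 1) v)" by (simp add: act_scale act_one)
  also have "\<dots> = act (scaleA c x) v"
    by (simp add: act_mult[symmetric] alg.scale_mult_right)
  finally show ?thesis by (simp add: act_scale)
qed

end

lemma (in vector_space) indexed_basisI:
  assumes zero: "\<And>c i. (\<Sum>i\<le>d. scale (c i) (u i)) = 0 \<Longrightarrow> i \<le> d \<Longrightarrow> c i = 0"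
    and span: "\<And>v. \<exists>c. v = (\<Sum>i\<le>d. scale (c i) (u i))"
  shows "indexed_basis d u"
  unfolding indexed_basis_def atLeast0AtMost
proof (intro conjI)
  show inj: "inj_on u {..d}"
  proof (rule inj_onI, rule ccontr)
    fix i j assume ij: "i \<in> {..d}" "j \<in> {..d}" "u i = u j" "i \<noteq> j"
    let ?c = "\<lambda>k. if k = i then (1::'a) else if k = j then -1 else 0"
    have "(\<Sum>k\<le>d. scale (?c k) (u k)) = (\<Sum>k\<in>{i, j}. scale (?c k) (u k))"
      using ij by (intro sum.mono_neutral_right) auto
    also have "\<dots> = 0" using ij by simp
    finally have "?c i = 0" using zero[of ?c i] ij by auto
    then show False by simp
  qed
  show "independent (u ` {..d})"
  proof (rule independent_if_scalars_zero)
    fix f x assume "(\<Sum>x\<in>u ` {..d}. scale (f x) x) = 0" "x \<in> u ` {..d}"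
    then show "f x = 0" using zero[of "\<lambda>i. f (u i)"] by (auto simp: sum.reindex[OF inj])
  qed simp
  show "span (u ` {..d}) = UNIV"
  proof (intro subset_antisym subset_UNIV subsetI)
    fix v
    obtain c where v: "v = (\<Sum>i\<le>d. scale (c i) (u i))" using span by blast
    show "v \<in> span (u ` {..d})"
      unfolding v by (intro span_sum span_scale span_base imageI) simp
  qed
qed

section \<open>The eigenbasis of \<open>As\<close> in the simple module\<close>

text \<open>In the representation \<open>\<sigma>\<close> the element \<open>As\<close> is diagonal;
  \<open>A\<close> is not assumed diagonal there, so its idempotents enter through relations that
  hold in the algebra itself.\<close>

locale leonard_module =
  matrix_algebra scaleA d \<sigma> + simple_left_module scaleA scaleV act
  for scaleA :: "'k::field \<Rightarrow> 'a::ring_1 \<Rightarrow> 'a" and d \<sigma>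
    and scaleV :: "'k \<Rightarrow> 'v::ab_group_add \<Rightarrow> 'v" and act +
  fixes A As :: 'a and E Es :: "nat \<Rightarrow> 'a" and \<theta> \<theta>s :: "nat \<Rightarrow> 'k" and v0 :: 'v
  assumes \<sigma>_As: "\<And>i j. i \<le> d \<Longrightarrow> j \<le> d \<Longrightarrow> \<sigma> As $$ (i, j) = (if i = j then \<theta>s i else 0)"
    and \<sigma>_Es: "\<And>i j r. i \<le> d \<Longrightarrow> j \<le> d \<Longrightarrow> r \<le> d \<Longrightarrow> \<sigma> (Es r) $$ (i, j) = (if i = j \<and> i = r then 1 else 0)"
    and E_mult: "\<And>r s. r \<le> d \<Longrightarrow> s \<le> d \<Longrightarrow> E r * E s = (if r = s then E r else 0)"
    and E_sum: "(\<Sum>r\<le>d. E r) = 1"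
    and A_E: "\<And>r. r \<le> d \<Longrightarrow> A * E r = scaleA (\<theta> r) (E r)"
    and E_nonzero: "\<And>r. r \<le> d \<Longrightarrow> E r \<noteq> 0"
    and inj_\<theta>: "inj_on \<theta> {..d}" and inj_\<theta>s: "inj_on \<theta>s {..d}"
    and E_tridiagonal: "\<And>r s. r \<le> d \<Longrightarrow> s \<le> d \<Longrightarrow> Suc r < s \<or> Suc s < r \<Longrightarrow> E r * As * E s = 0"
    and Es_tridiagonal: "\<And>r s. r \<le> d \<Longrightarrow> s \<le> d \<Longrightarrow> Suc r < s \<or> Suc s < r \<Longrightarrow> Es r * A * Es s = 0"
    and Es_irreducible: "\<And>r s. r \<le> d \<Longrightarrow> s \<le> d \<Longrightarrow> s = Suc r \<or> r = Suc s \<Longrightarrow> Es r * A * Es s \<noteq> 0"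
    and v0: "act (Es 0) v0 = v0" "v0 \<noteq> 0"
begin

text \<open>Matrix units, pulled back along \<open>\<sigma>\<close>.\<close>

definition U :: "nat \<Rightarrow> nat \<Rightarrow> 'a" where
  "U k l = (SOME x. \<sigma> x = mat (d + 1) (d + 1) (\<lambda>(i, j). if i = k \<and> j = l then 1 else 0))"

lemma \<sigma>_U: "i \<le> d \<Longrightarrow> j \<le> d \<Longrightarrow> \<sigma> (U k l) $$ (i, j) = (if i = k \<and> j = l then 1 else 0)"
proof -
  have "\<exists>x. \<sigma> x = mat (d + 1) (d + 1) (\<lambda>(i, j). if i = k \<and> j = l then 1 else 0)"
    by (rule rho_surj) simp
  then have "\<sigma> (U k l) = mat (d + 1) (d + 1) (\<lambda>(i, j). if i = k \<and> j = l then 1 else 0)"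
    unfolding U_def by (rule someI_ex)
  then show "i \<le> d \<Longrightarrow> j \<le> d \<Longrightarrow> \<sigma> (U k l) $$ (i, j) = (if i = k \<and> j = l then 1 else 0)" by simp
qed

lemma Es_eq_U: "r \<le> d \<Longrightarrow> Es r = U r r"
  by (rule rho_eqI) (auto simp: \<sigma>_Es \<sigma>_U)

lemma mult_U: "j \<le> d \<Longrightarrow> x * U j l = (\<Sum>i\<le>d. scaleA (\<sigma> x $$ (i, j)) (U i l))"
proof (rule rho_eqI)
  fix m n assume j: "j \<le> d" and mn: "m \<le> d" "n \<le> d"
  have "\<sigma> (x * U j l) $$ (m, n) = (\<Sum>k\<le>d. if k = j then (if n = l then \<sigma> x $$ (m, j) else 0) else 0)"
    unfolding rho_entry_mult[OF mn] using mn by (intro sum.cong refl) (auto simp: \<sigma>_U)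
  also have "\<dots> = (\<Sum>i\<le>d. if i = m then (if n = l then \<sigma> x $$ (i, j) else 0) else 0)"
    using j mn by simp
  also have "\<dots> = \<sigma> (\<Sum>i\<le>d. scaleA (\<sigma> x $$ (i, j)) (U i l)) $$ (m, n)"
    unfolding rho_entry_sum[OF mn] using mn by (intro sum.cong refl) (auto simp: rho_entry_scale \<sigma>_U)
  finally show "\<sigma> (x * U j l) $$ (m, n) = \<dots>" .
qed

lemma \<sigma>_Es_mult:
  assumes "r \<le> d" "m \<le> d" "n \<le> d"
  shows "\<sigma> (Es r * x) $$ (m, n) = (if m = r then \<sigma> x $$ (r, n) else 0)"
proof -
  have "\<sigma> (Es r * x) $$ (m, n) = (\<Sum>l\<le>d. if l = m then (if m = r then \<sigma> x $$ (r, n) else 0) else 0)"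
    unfolding rho_entry_mult[OF assms(2,3)] using assms by (intro sum.cong refl) (auto simp: \<sigma>_Es)
  then show ?thesis using assms by simp
qed

lemma \<sigma>_mult_Es:
  assumes "r \<le> d" "m \<le> d" "n \<le> d"
  shows "\<sigma> (x * Es r) $$ (m, n) = (if n = r then \<sigma> x $$ (m, r) else 0)"
proof -
  have "\<sigma> (x * Es r) $$ (m, n) = (\<Sum>l\<le>d. if l = n then (if n = r then \<sigma> x $$ (m, r) else 0) else 0)"
    unfolding rho_entry_mult[OF assms(2,3)] using assms by (intro sum.cong refl) (auto simp: \<sigma>_Es)
  then show ?thesis using assms by simp
qed

lemma \<sigma>_Es_mult_Es: "r \<le> d \<Longrightarrow> s \<le> d \<Longrightarrow> Es r * x * Es s = scaleA (\<sigma> x $$ (r, s)) (U r s)"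
  by (rule rho_eqI) (auto simp: \<sigma>_Es_mult \<sigma>_mult_Es rho_entry_scale \<sigma>_U)

definition B :: "nat \<Rightarrow> nat \<Rightarrow> 'k" where "B i j = \<sigma> A $$ (i, j)"

lemma B_tridiagonal: "r \<le> d \<Longrightarrow> s \<le> d \<Longrightarrow> Suc r < s \<or> Suc s < r \<Longrightarrow> B r s = 0"
  using Es_tridiagonal[of r s] \<sigma>_Es_mult_Es[of r s A] rho_entry_scale[of r s "\<sigma> A $$ (r, s)" "U r s"]
  by (auto simp: B_def \<sigma>_U rho_entry_zero)

lemma B_irreducible: "r \<le> d \<Longrightarrow> s \<le> d \<Longrightarrow> s = Suc r \<or> r = Suc s \<Longrightarrow> B r s \<noteq> 0"
  using Es_irreducible[of r s] \<sigma>_Es_mult_Es[of r s A]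
  by (auto simp: B_def)

text \<open>The matrix units of column 0 carry \<open>v0\<close> to an eigenbasis of
  \<open>As\<close> in which every \<open>x\<close> acts by the matrix
  \<open>\<sigma> x\<close>.\<close>

definition es :: "nat \<Rightarrow> 'v" where "es i = act (U i 0) v0"

lemma es_0: "es 0 = v0"
  using v0 by (simp add: es_def Es_eq_U flip: Es_eq_U)

lemma act_es: "j \<le> d \<Longrightarrow> act x (es j) = (\<Sum>i\<le>d. scaleV (\<sigma> x $$ (i, j)) (es i))"
  unfolding es_def act_mult[symmetric] by (simp add: mult_U act_sum_left act_scale)

text \<open>The linear combinations form a submodule that contains \<open>v0\<close>, so simplicity
  applies.\<close>

lemma es_span: "\<exists>c. v = (\<Sum>i\<le>d. scaleV (c i) (es i))"
proof -
  let ?W = "range (\<lambda>c. \<Sum>i\<le>d. scaleV (c i) (es i))"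
  have "submodule_of act ?W"
    unfolding submodule_of_def
  proof (intro conjI ballI allI)
    have "(\<Sum>i\<le>d. scaleV ((\<lambda>_. 0) i) (es i)) \<in> ?W" by (rule rangeI)
    then show "0 \<in> ?W" by simp
    fix v assume "v \<in> ?W"
    then obtain c where c: "v = (\<Sum>i\<le>d. scaleV (c i) (es i))" by auto
    show "v + w \<in> ?W" if w: "w \<in> ?W" for w
    proof -
      obtain e where e: "w = (\<Sum>i\<le>d. scaleV (e i) (es i))" using w by auto
      have "v + w = (\<Sum>i\<le>d. scaleV ((\<lambda>i. c i + e i) i) (es i))"
        unfolding c e by (simp add: vs.scale_left_distrib sum.distrib)
      then show ?thesis by (rule range_eqI[where x = "\<lambda>i. c i + e i"])
    qed
    fix x
    have "act x v = (\<Sum>j\<le>d. \<Sum>i\<le>d. scaleV (c j * \<sigma> x $$ (i, j)) (es i))"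
      unfolding c by (simp add: act_sum_right act_scale_right act_es vs.scale_sum_right)
    also have "\<dots> = (\<Sum>i\<le>d. scaleV ((\<lambda>i. \<Sum>j\<le>d. c j * \<sigma> x $$ (i, j)) i) (es i))"
      by (subst sum.swap) (simp add: vs.scale_sum_left)
    finally show "act x v \<in> ?W"
      by (rule range_eqI[where x = "\<lambda>i. \<Sum>j\<le>d. c j * \<sigma> x $$ (i, j)"])
  qed
  moreover have "?W \<noteq> {0}"
  proof -
    have "v0 = (\<Sum>i\<le>d. scaleV ((\<lambda>i. if i = 0 then 1 else 0) i) (es i))"
      by (simp add: if_distrib[of "\<lambda>c. scaleV c _"] es_0 cong: if_cong)
    then have "v0 \<in> ?W" by (rule range_eqI[where x = "\<lambda>i. if i = 0 then 1 else 0"])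
    then show ?thesis using v0 by auto
  qed
  ultimately have "?W = UNIV" using simple by blast
  then show ?thesis by (metis (no_types, lifting) UNIV_I imageE)
qed

text \<open>Applying \<open>U 0 k\<close> to the relation leaves \<open>c k\<close> times
  \<open>v0\<close>.\<close>

lemma es_independent:
  assumes "(\<Sum>i\<le>d. scaleV (c i) (es i)) = 0" "k \<le> d"
  shows "c k = 0"
proof -
  have U: "act (U 0 k) (es i) = (if i = k then v0 else 0)" if "i \<le> d" for i
  proof -
    have "act (U 0 k) (es i) = (\<Sum>j\<le>d. if j = 0 then (if i = k then v0 else 0) else 0)"
      unfolding act_es[OF that] using that by (intro sum.cong refl) (auto simp: \<sigma>_U es_0)
    then show ?thesis by simp
  qed
  have "0 = act (U 0 k) (\<Sum>i\<le>d. scaleV (c i) (es i))" unfolding assms(1) by simp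
  also have "\<dots> = (\<Sum>i\<le>d. if i = k then scaleV (c k) v0 else 0)"
    unfolding act_sum_right act_scale_right by (intro sum.cong refl) (auto simp: U)
  also have "\<dots> = scaleV (c k) v0" using assms(2) by simp
  finally show ?thesis using v0 by (metis vs.scale_eq_0_iff)
qed

text \<open>Combined with \<open>trace_mult_Es_0\<close>, this turns the traces in the split
  sequences into components along \<open>v0\<close>.\<close>

lemma act_Es_0_act: "act (Es 0) (act x v0) = scaleV (\<sigma> x $$ (0, 0)) v0"
proof -
  have "act (Es 0) (act x (es 0)) = (\<Sum>i\<le>d. scaleV (\<sigma> (Es 0 * x) $$ (i, 0)) (es i))"
    unfolding act_mult[symmetric] by (rule act_es) simp
  also have "\<dots> = (\<Sum>i\<le>d. if i = 0 then scaleV (\<sigma> x $$ (0, 0)) v0 else 0)"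
  proof (intro sum.cong refl)
    fix i assume i: "i \<in> {..d}"
    then show "scaleV (\<sigma> (Es 0 * x) $$ (i, 0)) (es i) = (if i = 0 then scaleV (\<sigma> x $$ (0, 0)) v0 else 0)"
      by (simp add: es_0 \<sigma>_Es_mult)
  qed
  finally show ?thesis by (simp add: es_0)
qed

lemma trace_mult_Es_0: "(\<Sum>i\<le>d. \<sigma> (x * Es 0) $$ (i, i)) = \<sigma> x $$ (0, 0)"
proof -
  have "(\<Sum>i\<le>d. \<sigma> (x * Es 0) $$ (i, i)) = (\<Sum>i\<le>d. if i = 0 then \<sigma> x $$ (0, 0) else 0)"
    by (intro sum.cong refl) (auto simp: \<sigma>_mult_Es)
  then show ?thesis by simp
qed

lemma act_Es_0_es: "i \<le> d \<Longrightarrow> act (Es 0) (es i) = (if i = 0 then v0 else 0)"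
proof -
  assume i: "i \<le> d"
  have "act (Es 0) (es i) = (\<Sum>k\<le>d. if k = 0 then (if i = 0 then v0 else 0) else 0)"
    unfolding act_es[OF i] by (intro sum.cong refl) (use i in \<open>auto simp: \<sigma>_Es es_0\<close>)
  then show ?thesis by simp
qed

lemma act_As_es: "i \<le> d \<Longrightarrow> act As (es i) = scaleV (\<theta>s i) (es i)"
proof -
  assume i: "i \<le> d"
  have "act As (es i) = (\<Sum>k\<le>d. if k = i then scaleV (\<theta>s i) (es i) else 0)"
    unfolding act_es[OF i] by (intro sum.cong refl) (use i in \<open>auto simp: \<sigma>_As\<close>)
  then show ?thesis using i by simp
qed

lemma act_A_es: "j \<le> d \<Longrightarrow> act A (es j) = (\<Sum>i\<le>d. scaleV (B i j) (es i))"
  by (simp add: act_es B_def)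

text \<open>Row \<open>m\<close> of the eigenvalue equation determines coordinate
  \<open>m + 1\<close> from the earlier ones, because the superdiagonal of \<open>B\<close> has no
  zeros.\<close>

lemma eigenvector_component_0:
  assumes u: "act A u = scaleV t u" and "act (Es 0) u = 0"
  shows "u = 0"
proof -
  obtain g where g: "u = (\<Sum>i\<le>d. scaleV (g i) (es i))" using es_span by blast
  have coeff: "(\<Sum>j\<le>d. B i j * g j) = t * g i" if i: "i \<le> d" for i
  proof -
    have "act A u = (\<Sum>j\<le>d. \<Sum>i\<le>d. scaleV (g j * B i j) (es i))"
      unfolding g by (simp add: act_sum_right act_scale_right act_A_es vs.scale_sum_right)
    also have "\<dots> = (\<Sum>i\<le>d. scaleV (\<Sum>j\<le>d. B i j * g j) (es i))"
      by (subst sum.swap) (simp add: vs.scale_sum_left mult.commute)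
    finally have "(\<Sum>i\<le>d. scaleV ((\<Sum>j\<le>d. B i j * g j) - t * g i) (es i)) = 0"
      using u unfolding g by (simp add: vs.scale_left_diff_distrib sum_subtractf vs.scale_sum_right)
    from es_independent[OF this i] show ?thesis by simp
  qed
  have "scaleV (g 0) v0 = 0"
  proof -
    have "act (Es 0) u = (\<Sum>i\<le>d. scaleV (g i) (act (Es 0) (es i)))"
      unfolding g by (simp add: act_sum_right act_scale_right)
    also have "\<dots> = (\<Sum>i\<le>d. if i = 0 then scaleV (g 0) v0 else 0)"
      by (intro sum.cong refl) (auto simp: act_Es_0_es)
    finally show ?thesis using assms(2) by simp
  qed
  then have g0: "g 0 = 0" using v0 by simp
  have "i \<le> d \<Longrightarrow> g i = 0" for i
  proof (induction i rule: less_induct)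
    case (less i)
    show ?case
    proof (cases i)
      case (Suc m)
      have "(\<Sum>j\<le>d. B m j * g j) = (\<Sum>j\<in>{i}. B m j * g j)"
      proof (rule sum.mono_neutral_right; (intro ballI)?)
        fix j assume "j \<in> {..d} - {i}"
        then show "B m j * g j = 0"
          using less Suc B_tridiagonal[of m j] by (cases "j < i") auto
      qed (use less in auto)
      then have "B m i * g i = 0" using coeff[of m] less Suc by simp
      then show ?thesis using B_irreducible[of m i] less Suc by simp
    qed (use g0 in simp)
  qed
  then show ?thesis unfolding g by (intro sum.neutral) auto
qed

section \<open>Coordinates given by the idempotents of \<open>A\<close>\<close>

definition y :: "nat \<Rightarrow> 'v" where "y r = act (E r) v0"

text \<open>The vector with coordinate function \<open>g\<close>; existence and uniqueness of
  coordinates on \<open>{..d}\<close> are \<open>\<Psi>_surj\<close> and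
  \<open>\<Psi>_eqD\<close>.\<close>

definition \<Psi> :: "(nat \<Rightarrow> 'k) \<Rightarrow> 'v" where "\<Psi> g = (\<Sum>r\<le>d. scaleV (g r) (y r))"

lemma \<Psi>_cong: "(\<And>r. r \<le> d \<Longrightarrow> g r = h r) \<Longrightarrow> \<Psi> g = \<Psi> h"
  by (simp add: \<Psi>_def)

lemma \<Psi>_scale: "scaleV c (\<Psi> g) = \<Psi> (\<lambda>r. c * g r)"
  by (simp add: \<Psi>_def vs.scale_sum_right)

lemma \<Psi>_add: "\<Psi> g + \<Psi> h = \<Psi> (\<lambda>r. g r + h r)"
  by (simp add: \<Psi>_def vs.scale_left_distrib sum.distrib)

lemma \<Psi>_diff: "\<Psi> g - \<Psi> h = \<Psi> (\<lambda>r. g r - h r)"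
  by (simp add: \<Psi>_def vs.scale_left_diff_distrib sum_subtractf)

lemma \<Psi>_sum: "(\<Sum>i\<in>I. \<Psi> (g i)) = \<Psi> (\<lambda>r. \<Sum>i\<in>I. g i r)"
  unfolding \<Psi>_def by (subst sum.swap) (simp add: vs.scale_sum_left)

lemma act_E_\<Psi>: "r \<le> d \<Longrightarrow> act (E r) (\<Psi> g) = scaleV (g r) (y r)"
proof -
  assume r: "r \<le> d"
  have "act (E r) (\<Psi> g) = (\<Sum>s\<le>d. if s = r then scaleV (g r) (y r) else 0)"
    unfolding \<Psi>_def act_sum_right act_scale_right y_def act_mult[symmetric]
    by (intro sum.cong refl) (use r in \<open>auto simp: E_mult\<close>)
  then show ?thesis using r by simp
qed

lemma act_diagonal_\<Psi>: "act (\<Sum>r\<le>d. scaleA (f r) (E r)) (\<Psi> g) = \<Psi> (\<lambda>r. f r * g r)"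
  unfolding act_sum_left by (simp add: act_scale act_E_\<Psi>) (simp add: \<Psi>_def)

lemma \<Psi>_one: "\<Psi> (\<lambda>_. 1) = v0"
  unfolding \<Psi>_def y_def by (simp add: act_sum_left[symmetric] E_sum act_one)

lemma alg_poly_eq: "alg_poly scaleA p A = (\<Sum>r\<le>d. scaleA (poly p (\<theta> r)) (E r))"
proof -
  have pow: "A ^ n * E r = scaleA (\<theta> r ^ n) (E r)" if "r \<le> d" for n r
    by (induction n) (simp_all add: mult.assoc that A_E scale_mult_right mult.commute)
  have "alg_poly scaleA p A = (\<Sum>r\<le>d. alg_poly scaleA p A * E r)"
    by (simp add: E_sum flip: sum_distrib_left)
  also have "\<dots> = (\<Sum>r\<le>d. scaleA (poly p (\<theta> r)) (E r))"
  proof (intro sum.cong refl)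
    fix r assume "r \<in> {..d}"
    then have r: "r \<le> d" by simp
    have "alg_poly scaleA p A * E r = (\<Sum>n\<le>Polynomial.degree p. scaleA (Polynomial.coeff p n * \<theta> r ^ n) (E r))"
      unfolding alg_poly_def sum_distrib_right by (simp add: scale_mult_left pow r)
    also have "\<dots> = scaleA (poly p (\<theta> r)) (E r)"
      by (simp add: poly_altdef scale_sum_left)
    finally show "alg_poly scaleA p A * E r = scaleA (poly p (\<theta> r)) (E r)" .
  qed
  finally show ?thesis .
qed

lemma act_alg_poly_\<Psi>: "act (alg_poly scaleA p A) (\<Psi> g) = \<Psi> (\<lambda>r. poly p (\<theta> r) * g r)"
  unfolding alg_poly_eq by (rule act_diagonal_\<Psi>)

lemma act_alg_poly_v0: "act (alg_poly scaleA p A) v0 = \<Psi> (\<lambda>r. poly p (\<theta> r))"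
  using act_alg_poly_\<Psi>[of p "\<lambda>_. 1"] by (simp add: \<Psi>_one)

lemma act_A_\<Psi>: "act A (\<Psi> g) = \<Psi> (\<lambda>r. \<theta> r * g r)"
proof -
  have "A = (\<Sum>r\<le>d. A * E r)" by (simp add: E_sum flip: sum_distrib_left)
  also have "\<dots> = (\<Sum>r\<le>d. scaleA (\<theta> r) (E r))" by (simp add: A_E)
  finally show ?thesis using act_diagonal_\<Psi>[of \<theta> g] by simp
qed

text \<open>Column \<open>m\<close> of the tridiagonal \<open>B\<close> expresses
  \<open>es (Suc m)\<close>, with a nonzero coefficient, through \<open>act A (es m)\<close> and
  earlier vectors, so each step raises the degree by one.\<close>

lemma es_polynomial: "i \<le> d \<Longrightarrow> \<exists>p. Polynomial.degree p = i \<and> p \<noteq> 0 \<and> es i = \<Psi> (\<lambda>r. poly p (\<theta> r))"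
proof (induction i rule: less_induct)
  case (less i)
  show ?case
  proof (cases i)
    case 0
    then show ?thesis by (intro exI[of _ 1]) (simp add: es_0 \<Psi>_one)
  next
    case (Suc m)
    have "\<exists>p. Polynomial.degree p = k \<and> p \<noteq> 0 \<and> es k = \<Psi> (\<lambda>r. poly p (\<theta> r))" if "k \<le> m" for k
      using less that Suc by auto
    then obtain P where P: "\<And>k. k \<le> m \<Longrightarrow> Polynomial.degree (P k) = k" "\<And>k. k \<le> m \<Longrightarrow> P k \<noteq> 0"
      "\<And>k. k \<le> m \<Longrightarrow> es k = \<Psi> (\<lambda>r. poly (P k) (\<theta> r))" by metis
    define b where "b = B i m"
    have b: "b \<noteq> 0" using B_irreducible[of i m] less.prems Suc by (simp add: b_def)
    define Q where "Q = (\<Sum>k\<le>m. Polynomial.smult (B k m) (P k))"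
    define p where "p = Polynomial.smult (1 / b) (pCons 0 (P m) - Q)"
    have "act A (es m) = (\<Sum>k\<le>d. scaleV (B k m) (es k))"
      using act_A_es less.prems Suc by simp
    also have "\<dots> = (\<Sum>k\<le>i. scaleV (B k m) (es k))"
      by (rule sum.mono_neutral_right) (use less.prems Suc B_tridiagonal[of _ m] in auto)
    also have "\<dots> = scaleV b (es i) + (\<Sum>k\<le>m. scaleV (B k m) (es k))"
      using Suc by (simp add: b_def add.commute)
    also have "(\<Sum>k\<le>m. scaleV (B k m) (es k)) = \<Psi> (\<lambda>r. poly Q (\<theta> r))"
      by (simp add: P(3) \<Psi>_scale \<Psi>_sum Q_def poly_sum)
    finally have "scaleV b (es i) = act A (es m) - \<Psi> (\<lambda>r. poly Q (\<theta> r))" by simp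
    also have "\<dots> = \<Psi> (\<lambda>r. poly (pCons 0 (P m) - Q) (\<theta> r))"
      by (simp add: P(3) act_A_\<Psi> \<Psi>_diff)
    finally have "scaleV (1 / b) (scaleV b (es i)) = \<Psi> (\<lambda>r. poly p (\<theta> r))"
      by (simp add: \<Psi>_scale p_def)
    then have es: "es i = \<Psi> (\<lambda>r. poly p (\<theta> r))" using b by simp
    have "Polynomial.degree Q \<le> m"
      unfolding Q_def by (intro degree_sum_le) (use P(1) in \<open>auto intro: order.trans[OF degree_smult_le]\<close>)
    moreover have "Polynomial.degree (pCons 0 (P m)) = i"
      using P(1,2)[of m] Suc by simp
    ultimately have "Polynomial.degree (pCons 0 (P m) + (- Q)) = i"
      using Suc by (subst degree_add_eq_left) auto
    then have "Polynomial.degree p = i" using b by (simp add: p_def)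
    moreover from this have "p \<noteq> 0" using Suc by auto
    ultimately show ?thesis using es by blast
  qed
qed

definition P :: "nat \<Rightarrow> 'k poly" where
  "P i = (SOME p. Polynomial.degree p = i \<and> p \<noteq> 0 \<and> es i = \<Psi> (\<lambda>r. poly p (\<theta> r)))"

lemma P:
  assumes "i \<le> d"
  shows "Polynomial.degree (P i) = i" "P i \<noteq> 0" "es i = \<Psi> (\<lambda>r. poly (P i) (\<theta> r))"
  using someI_ex[OF es_polynomial[OF assms]] unfolding P_def by blast+

lemma \<Psi>_surj: "\<exists>g. v = \<Psi> g"
proof -
  obtain c where "v = (\<Sum>i\<le>d. scaleV (c i) (es i))" using es_span by blast
  then have "v = \<Psi> (\<lambda>r. \<Sum>i\<le>d. c i * poly (P i) (\<theta> r))"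
    by (simp add: P(3) \<Psi>_scale \<Psi>_sum)
  then show ?thesis by blast
qed

text \<open>Otherwise \<open>E r\<close> would kill all of \<open>V\<close> by
  \<open>\<Psi>_surj\<close>, but the action is faithful.\<close>

lemma y_nonzero:
  assumes r: "r \<le> d"
  shows "y r \<noteq> 0"
proof
  assume "y r = 0"
  then have zero: "act (E r) v = 0" for v
    using act_E_\<Psi>[OF r] \<Psi>_surj[of v] by auto
  have "\<sigma> (E r) $$ (i, j) = \<sigma> 0 $$ (i, j)" if "i \<le> d" "j \<le> d" for i j
    using es_independent[of "\<lambda>i. \<sigma> (E r) $$ (i, j)" i] act_es[of j "E r"] zero that
    by (simp add: rho_entry_zero)
  then have "E r = 0" by (rule rho_eqI)
  then show False using E_nonzero r by simp
qed

lemma \<Psi>_eq_0: "\<Psi> g = 0 \<Longrightarrow> r \<le> d \<Longrightarrow> g r = 0"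
  using act_E_\<Psi>[of r g] y_nonzero[of r] by simp

lemma \<Psi>_eqD: "\<Psi> g = \<Psi> h \<Longrightarrow> r \<le> d \<Longrightarrow> g r = h r"
  using \<Psi>_eq_0[of "\<lambda>r. g r - h r" r] \<Psi>_diff[of g h] by simp

text \<open>Matrix of \<open>As\<close> in the basis \<open>y\<close>: column \<open>s\<close>
  consists of the coordinates of \<open>act As (y s)\<close>.\<close>

definition T :: "nat \<Rightarrow> nat \<Rightarrow> 'k" where
  "T r s = (SOME g. act As (y s) = \<Psi> g) r"

lemma act_As_y: "act As (y s) = \<Psi> (\<lambda>r. T r s)"
  unfolding T_def using someI_ex[OF \<Psi>_surj[of "act As (y s)"]] by simp

lemma act_As_\<Psi>: "act As (\<Psi> g) = \<Psi> (mat_app d T g)"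
proof -
  have "act As (\<Psi> g) = (\<Sum>s\<le>d. \<Psi> (\<lambda>r. g s * T r s))"
    unfolding \<Psi>_def[of g] by (simp add: act_sum_right act_scale_right act_As_y \<Psi>_scale)
  then show ?thesis unfolding \<Psi>_sum by (simp add: mat_app_def[abs_def] mult.commute)
qed

lemma T_tridiagonal:
  assumes "r \<le> d" "s \<le> d" "Suc r < s \<or> Suc s < r"
  shows "T r s = 0"
proof -
  have "act (E r * As * E s) v0 = scaleV (T r s) (y r)"
    using assms by (simp add: act_mult y_def[symmetric] act_As_y act_E_\<Psi>)
  then show ?thesis using E_tridiagonal[OF assms] y_nonzero assms by simp
qed

lemma T_P:
  assumes "i \<le> d" "r \<le> d"
  shows "mat_app d T (\<lambda>s. poly (P i) (\<theta> s)) r = \<theta>s i * poly (P i) (\<theta> r)"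
proof -
  have "\<Psi> (mat_app d T (\<lambda>s. poly (P i) (\<theta> s))) = \<Psi> (\<lambda>r. \<theta>s i * poly (P i) (\<theta> r))"
    using act_As_es[OF assms(1)] by (simp add: P(3)[OF assms(1)] act_As_\<Psi> \<Psi>_scale)
  then show ?thesis using assms(2) by (rule \<Psi>_eqD)
qed

text \<open>Applying \<open>Es 0\<close>, which absorbs \<open>As\<close> as the scalar
  \<open>\<theta>s 0\<close>, to the bidiagonal relation gives a two-term recurrence for the
  components \<open>t i\<close>; its coefficient is therefore the quotient that defines a split
  sequence. The polynomials \<open>tau_poly\<close> are treated with \<open>k = d\<close> and
  \<open>eta_poly\<close> with \<open>k = 0\<close>.\<close>

lemma split_coefficient:
  fixes Q :: "nat \<Rightarrow> 'k poly"
  assumes TQ: "\<And>i r. i \<le> d \<Longrightarrow> r \<le> d \<Longrightarrow> mat_app d T (\<lambda>s. poly (Q i) (\<theta> s)) r =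
      \<theta>s i * poly (Q i) (\<theta> r) + (if i = 0 then 0 else c i * poly (Q (i - 1)) (\<theta> r))"
    and k: "k \<le> d" "poly (Q d) (\<theta> k) \<noteq> 0" "\<And>r. r \<le> d \<Longrightarrow> r \<noteq> k \<Longrightarrow> poly (Q d) (\<theta> r) = 0"
    and i: "1 \<le> i" "i \<le> d"
  defines "t \<equiv> \<lambda>i. \<sigma> (alg_poly scaleA (Q i) A) $$ (0, 0)"
  shows "c i \<noteq> 0" "c i = (\<theta>s 0 - \<theta>s i) * (t i / t (i - 1))"
proof -
  let ?u = "\<lambda>i. act (alg_poly scaleA (Q i) A) v0"
  have t: "act (Es 0) (?u i) = scaleV (t i) v0" for i
    unfolding t_def by (rule act_Es_0_act)
  have rec: "t i * (\<theta>s 0 - \<theta>s i) = c i * t (i - 1)" if i: "1 \<le> i" "i \<le> d" for i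
  proof -
    have EA: "Es 0 * As = scaleA (\<theta>s 0) (Es 0)"
      by (rule rho_eqI) (auto simp: \<sigma>_Es_mult \<sigma>_As \<sigma>_Es rho_entry_scale)
    have "act As (?u i) = scaleV (\<theta>s i) (?u i) + scaleV (c i) (?u (i - 1))"
      unfolding act_alg_poly_v0 act_As_\<Psi> \<Psi>_scale \<Psi>_add
      by (rule \<Psi>_cong) (use TQ i in auto)
    then have "act (Es 0) (act As (?u i)) = scaleV (\<theta>s i * t i + c i * t (i - 1)) v0"
      by (simp add: act_add_right act_scale_right t vs.scale_left_distrib)
    moreover have "act (Es 0) (act As (?u i)) = scaleV (\<theta>s 0 * t i) v0"
    proof -
      have "act (Es 0) (act As (?u i)) = act (Es 0 * As) (?u i)" by (rule act_mult[symmetric])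
      then show ?thesis unfolding EA by (simp add: act_scale t)
    qed
    ultimately have "\<theta>s i * t i + c i * t (i - 1) = \<theta>s 0 * t i"
      using v0(2) by (metis vs.scale_right_imp_eq)
    then show ?thesis by (simp add: algebra_simps)
  qed
  \<comment> \<open>\<open>Q d\<close> vanishes at every eigenvalue except
    \<open>\<theta> k\<close>, so \<open>?u d\<close> is a nonzero eigenvector of \<open>A\<close>
    and has a component along \<open>v0\<close>. The recurrence then carries nonvanishing down to
    all smaller indices.\<close>
  have "t d \<noteq> 0"
  proof
    assume "t d = 0"
    have "act A (?u d) = scaleV (\<theta> k) (?u d)"
      unfolding act_alg_poly_v0 act_A_\<Psi> \<Psi>_scale
      by (rule \<Psi>_cong) (use k in \<open>metis mult_zero_right\<close>)
    moreover have "act (Es 0) (?u d) = 0" using t[of d] \<open>t d = 0\<close> by simp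
    ultimately have "\<Psi> (\<lambda>r. poly (Q d) (\<theta> r)) = 0"
      unfolding act_alg_poly_v0 by (rule eigenvector_component_0)
    from \<Psi>_eq_0[OF this k(1)] k(2) show False by simp
  qed
  have ne: "\<theta>s 0 - \<theta>s i \<noteq> 0" if "1 \<le> i" "i \<le> d" for i
    using inj_\<theta>s that by (auto dest: inj_onD)
  have tn: "t i \<noteq> 0" if "i \<le> d" for i
    using that
  proof (induction rule: inc_induct)
    case (step n)
    then show ?case using rec[of "Suc n"] ne[of "Suc n"] by auto
  qed (rule \<open>t d \<noteq> 0\<close>)
  show "c i \<noteq> 0" using rec[OF i] ne[OF i] tn[of i] i by auto
  show "c i = (\<theta>s 0 - \<theta>s i) * (t i / t (i - 1))"
    using rec[OF i] tn[of "i - 1"] i by (simp add: field_simps)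
qed

end

section \<open>Matrices with respect to the split basis\<close>

lemma (in left_module_over_algebra) matrix_wrt_eqI:
  assumes zero: "\<And>c i. (\<Sum>i\<le>d. scaleV (c i) (u i)) = 0 \<Longrightarrow> i \<le> d \<Longrightarrow> c i = 0"
    and span: "\<And>v. \<exists>c. v = (\<Sum>i\<le>d. scaleV (c i) (u i))"
    and M: "\<And>j. j \<le> d \<Longrightarrow> act x (u j) = (\<Sum>i\<le>d. scaleV (M i j) (u i))"
  shows "matrix_wrt d scaleV act u x = mat (d + 1) (d + 1) (\<lambda>(i, j). M i j)"
  unfolding matrix_wrt_def
proof (rule the_equality)
  have "vs.indexed_basis d u" by (rule vs.indexed_basisI) (fact zero, fact span)
  then show "represents d scaleV act u (mat (d + 1) (d + 1) (\<lambda>(i, j). M i j)) x"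
    using M by (simp add: represents_def atLeast0AtMost)
next
  fix Y assume Y: "represents d scaleV act u Y x"
  then have c: "Y \<in> carrier_mat (d + 1) (d + 1)" by (simp add: represents_def)
  show "Y = mat (d + 1) (d + 1) (\<lambda>(i, j). M i j)"
  proof (rule eq_matI)
    fix i j assume "i < dim_row (mat (d + 1) (d + 1) (\<lambda>(i, j). M i j))"
      "j < dim_col (mat (d + 1) (d + 1) (\<lambda>(i, j). M i j))"
    then have ij: "i \<le> d" "j \<le> d" by auto
    have "(\<Sum>i\<le>d. scaleV (Y $$ (i, j)) (u i)) = (\<Sum>i\<le>d. scaleV (M i j) (u i))"
      using Y ij M[of j] by (simp add: represents_def atLeast0AtMost)
    then have "(\<Sum>i\<le>d. scaleV (Y $$ (i, j) - M i j) (u i)) = 0"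
      by (simp add: vs.scale_left_diff_distrib sum_subtractf)
    from zero[OF this ij(1)] show "Y $$ (i, j) = mat (d + 1) (d + 1) (\<lambda>(i, j). M i j) $$ (i, j)"
      using ij by simp
  qed (use c in auto)
qed

lemma alg_inverse_eqI: "x * y = 1 \<Longrightarrow> y * x = 1 \<Longrightarrow> alg_inverse x = y"
  unfolding alg_inverse_def by (rule the_equality) (auto, metis mult.assoc mult_1_left mult_1_right)

context leonard_module
begin

text \<open>Tridiagonality provides some bidiagonal coefficients; \<open>split_coefficient\<close>
  identifies them with the split sequences and shows that they do not vanish.\<close>

lemma split_pair_T:
  assumes vphi: "\<And>i. 1 \<le> i \<Longrightarrow> i \<le> d \<Longrightarrow> vphi i = (\<theta>s 0 - \<theta>s i) *
      (\<sigma> (alg_poly scaleA (tau_poly \<theta> i) A) $$ (0, 0) / \<sigma> (alg_poly scaleA (tau_poly \<theta> (i - 1)) A) $$ (0, 0))"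
    and phi: "\<And>i. 1 \<le> i \<Longrightarrow> i \<le> d \<Longrightarrow> phi i = (\<theta>s 0 - \<theta>s i) *
      (\<sigma> (alg_poly scaleA (eta_poly d \<theta> i) A) $$ (0, 0) / \<sigma> (alg_poly scaleA (eta_poly d \<theta> (i - 1)) A) $$ (0, 0))"
  shows "split_pair d T \<theta> \<theta>s vphi phi"
proof -
  have tau_ex: "\<exists>c. \<forall>r\<le>d. mat_app d T (\<lambda>s. poly (tau_poly \<theta> i) (\<theta> s)) r =
      \<theta>s i * poly (tau_poly \<theta> i) (\<theta> r) + (if i = 0 then 0 else c * poly (tau_poly \<theta> (i - 1)) (\<theta> r))"
    if i: "i \<le> d" for i
    by (rule tridiagonal_split[where P = P, OF inj_\<theta> T_tridiagonal P(1,2) T_P i]) auto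
  then obtain c where c: "\<And>i r. i \<le> d \<Longrightarrow> r \<le> d \<Longrightarrow> mat_app d T (\<lambda>s. poly (tau_poly \<theta> i) (\<theta> s)) r =
      \<theta>s i * poly (tau_poly \<theta> i) (\<theta> r) + (if i = 0 then 0 else c i * poly (tau_poly \<theta> (i - 1)) (\<theta> r))"
    by metis
  have eta_ex: "\<exists>c. \<forall>r\<le>d. mat_app d T (\<lambda>s. poly (eta_poly d \<theta> i) (\<theta> s)) r =
      \<theta>s i * poly (eta_poly d \<theta> i) (\<theta> r) + (if i = 0 then 0 else c * poly (eta_poly d \<theta> (i - 1)) (\<theta> r))"
    if i: "i \<le> d" for i
    by (rule tridiagonal_split_reverse[where P = P, OF inj_\<theta> T_tridiagonal P(1,2) T_P i]) auto
  then obtain c' where c': "\<And>i r. i \<le> d \<Longrightarrow> r \<le> d \<Longrightarrow> mat_app d T (\<lambda>s. poly (eta_poly d \<theta> i) (\<theta> s)) r =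
      \<theta>s i * poly (eta_poly d \<theta> i) (\<theta> r) + (if i = 0 then 0 else c' i * poly (eta_poly d \<theta> (i - 1)) (\<theta> r))"
    by metis
  have \<theta>_ne: "\<theta> r \<noteq> \<theta> s" if "r \<le> d" "s \<le> d" "r \<noteq> s" for r s
    using inj_\<theta> that by (auto dest: inj_onD)
  have tau_d: "poly (tau_poly \<theta> d) (\<theta> d) \<noteq> 0"
    using \<theta>_ne by (auto simp: poly_tau_poly)
  have tau_d': "poly (tau_poly \<theta> d) (\<theta> r) = 0" if "r \<le> d" "r \<noteq> d" for r
    using that by (simp add: poly_tau_poly_zero)
  have eta_d: "poly (eta_poly d \<theta> d) (\<theta> 0) \<noteq> 0"
    using \<theta>_ne[of 0] by (auto simp: eta_poly_eq_tau_poly poly_tau_poly)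
  have eta_d': "poly (eta_poly d \<theta> d) (\<theta> r) = 0" if "r \<le> d" "r \<noteq> 0" for r
    using poly_tau_poly_zero[of "d - r" d "\<lambda>i. \<theta> (d - i)"] that by (simp add: eta_poly_eq_tau_poly)
  note tau = split_coefficient[where Q = "tau_poly \<theta>" and c = c and k = d, OF c order_refl tau_d tau_d']
  note eta = split_coefficient[where Q = "eta_poly d \<theta>" and c = c' and k = 0, OF c' le0 eta_d eta_d']
  have cv: "c i = vphi i" "vphi i \<noteq> 0" "c' i = phi i" "phi i \<noteq> 0" if "1 \<le> i" "i \<le> d" for i
    using tau[of i] eta[of i] vphi[OF that] phi[OF that] that by auto
  show ?thesis
  proof
    show "mat_app d T (\<lambda>s. poly (tau_poly \<theta> i) (\<theta> s)) r =
      \<theta>s i * poly (tau_poly \<theta> i) (\<theta> r) + (if i = 0 then 0 else vphi i * poly (tau_poly \<theta> (i - 1)) (\<theta> r))"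
      if "i \<le> d" "r \<le> d" for i r
      using c[OF that] cv(1)[of i] that by (cases "i = 0") auto
    show "mat_app d T (\<lambda>s. poly (eta_poly d \<theta> i) (\<theta> s)) r =
      \<theta>s i * poly (eta_poly d \<theta> i) (\<theta> r) + (if i = 0 then 0 else phi i * poly (eta_poly d \<theta> (i - 1)) (\<theta> r))"
      if "i \<le> d" "r \<le> d" for i r
      using c'[OF that] cv(3)[of i] that by (cases "i = 0") auto
  qed (use inj_\<theta> T_tridiagonal cv in auto)
qed

lemma diagonal_mult:
  "(\<Sum>r\<le>d. scaleA (f r) (E r)) * (\<Sum>r\<le>d. scaleA (g r) (E r)) = (\<Sum>r\<le>d. scaleA (f r * g r) (E r))"
proof -
  have "(\<Sum>r\<le>d. scaleA (f r) (E r)) * (\<Sum>s\<le>d. scaleA (g s) (E s)) =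
    (\<Sum>r\<le>d. \<Sum>s\<le>d. if s = r then scaleA (f r * g r) (E r) else 0)"
    unfolding sum_product
    by (intro sum.cong refl) (auto simp: scale_mult_left scale_mult_right E_mult mult.commute)
  then show ?thesis by simp
qed

text \<open>A combination of the idempotents multiplies coordinate functions by \<open>f\<close>,
  and the basis vectors have the coordinates \<open>\<tau> i\<close>, so the matrix is an expansion
  of functions.\<close>

lemma natural_matrix:
  assumes sp: "split_pair d T \<theta> \<theta>s vphi phi"
    and expand: "\<And>j r. j \<le> d \<Longrightarrow> r \<le> d \<Longrightarrow>
      f r * poly (tau_poly \<theta> j) (\<theta> r) = (\<Sum>i\<le>d. M i j * poly (tau_poly \<theta> i) (\<theta> r))"
  shows "matrix_wrt d scaleV act (\<lambda>i. act (alg_poly scaleA (tau_poly \<theta> i) A) v0) (\<Sum>r\<le>d. scaleA (f r) (E r)) =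
    mat (d + 1) (d + 1) (\<lambda>(i, j). M i j)"
proof (rule matrix_wrt_eqI)
  interpret split_pair d T \<theta> \<theta>s vphi phi by (rule sp)
  let ?u = "\<lambda>i. act (alg_poly scaleA (tau_poly \<theta> i) A) v0"
  have u: "(\<Sum>i\<le>d. scaleV (c i) (?u i)) = \<Psi> (\<lambda>r. \<Sum>i\<le>d. c i * \<tau> i r)" for c
    unfolding act_alg_poly_v0 \<Psi>_scale \<Psi>_sum \<tau>_def ..
  show "c i = 0" if "(\<Sum>i\<le>d. scaleV (c i) (?u i)) = 0" "i \<le> d" for c i
    by (rule triangular_independent[where p = \<tau> and d = d])
      (use that \<tau>_low \<tau>_diag \<Psi>_eq_0 in \<open>auto simp: u\<close>)
  show "\<exists>c. v = (\<Sum>i\<le>d. scaleV (c i) (?u i))" for v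
  proof -
    obtain g where g: "v = \<Psi> g" using \<Psi>_surj by blast
    obtain c where "\<And>r. r \<le> d \<Longrightarrow> g r = (\<Sum>i\<le>d. c i * \<tau> i r)"
      by (rule triangular_expansion[where p = \<tau> and d = d and j = 0 and g = g])
        (use \<tau>_low \<tau>_diag in auto)
    then have "v = (\<Sum>i\<le>d. scaleV (c i) (?u i))"
      unfolding u g by (intro \<Psi>_cong)
    then show ?thesis by blast
  qed
  show "act (\<Sum>r\<le>d. scaleA (f r) (E r)) (?u j) = (\<Sum>i\<le>d. scaleV (M i j) (?u i))" if "j \<le> d" for j
    unfolding u unfolding act_alg_poly_v0 act_diagonal_\<Psi>
    by (rule \<Psi>_cong) (use expand[OF that] in \<open>simp add: \<tau>_def\<close>)
qed

lemma natural_switching_element: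
  assumes sp: "split_pair d T \<theta> \<theta>s vphi phi"
    and rel: "bracket_relation d \<theta>s br" "bracket_relation d (\<lambda>i. \<theta>s (d - i)) br"
    and one: "\<And>r s u. r + s + u = d \<Longrightarrow> r = 0 \<or> s = 0 \<or> u = 0 \<Longrightarrow> br r s u = 1"
  defines "S \<equiv> switching_element d scaleA E vphi phi"
    and "u \<equiv> \<lambda>i. act (alg_poly scaleA (tau_poly \<theta> i) A) v0"
  shows "matrix_wrt d scaleV act u S = mat (d + 1) (d + 1)
      (\<lambda>(i, j). split_entry d br \<theta>s vphi (\<lambda>h. phi (Suc d - h)) i j)"
    and "matrix_wrt d scaleV act u (alg_inverse S) = mat (d + 1) (d + 1)
      (\<lambda>(i, j). split_entry d br (\<lambda>i. \<theta>s (d - i)) (\<lambda>h. phi (Suc d - h)) vphi i j)"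
proof -
  interpret split_pair d T \<theta> \<theta>s vphi phi by (rule sp)
  have S: "S = (\<Sum>r\<le>d. scaleA (sw r) (E r))"
    by (simp add: S_def switching_element_def sw_def atLeast0AtMost)
  let ?S' = "\<Sum>r\<le>d. scaleA (1 / sw r) (E r)"
  have "(\<Sum>r\<le>d. scaleA (sw r * (1 / sw r)) (E r)) = 1"
    unfolding E_sum[symmetric] by (intro sum.cong refl) (simp add: sw_nonzero)
  then have "alg_inverse S = ?S'"
    unfolding S by (intro alg_inverse_eqI) (simp_all only: diagonal_mult mult.commute)
  moreover have "matrix_wrt d scaleV act u ?S' = mat (d + 1) (d + 1)
      (\<lambda>(i, j). split_entry d br (\<lambda>i. \<theta>s (d - i)) (\<lambda>h. phi (Suc d - h)) vphi i j)"
    unfolding u_def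
  proof (rule natural_matrix[OF sp])
    fix j r assume jr: "j \<le> d" "r \<le> d"
    let ?M = "\<lambda>i. split_entry d br (\<lambda>i. \<theta>s (d - i)) (\<lambda>h. phi (Suc d - h)) vphi i j"
    have "\<tau> j r = sw r * (\<Sum>i\<le>d. ?M i * \<tau> i r)"
      using \<tau>_expansion_sw[OF rel(2) one jr] by (simp add: sum_distrib_left mult_ac)
    then have "1 / sw r * \<tau> j r = (\<Sum>i\<le>d. ?M i * \<tau> i r)"
      using sw_nonzero[OF jr(2)] by simp
    then show "1 / sw r * poly (tau_poly \<theta> j) (\<theta> r) = (\<Sum>i\<le>d. ?M i * poly (tau_poly \<theta> i) (\<theta> r))"
      by (simp only: \<tau>_def)
  qed
  ultimately show "matrix_wrt d scaleV act u (alg_inverse S) = mat (d + 1) (d + 1)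
      (\<lambda>(i, j). split_entry d br (\<lambda>i. \<theta>s (d - i)) (\<lambda>h. phi (Suc d - h)) vphi i j)" by simp
  show "matrix_wrt d scaleV act u S = mat (d + 1) (d + 1)
      (\<lambda>(i, j). split_entry d br \<theta>s vphi (\<lambda>h. phi (Suc d - h)) i j)"
    unfolding u_def S
    by (rule natural_matrix[OF sp]) (use sw_\<tau>_expansion[OF rel(1) one] in \<open>simp add: \<tau>_def\<close>)
qed

end

section \<open>Assembly for \<open>q_bracket\<close> and the given Leonard system\<close>

text \<open>Reversal of \<open>\<theta>s\<close> exchanges \<open>i\<close> with
  \<open>d - i + 1\<close> and negates both numerator and denominator of the ratio, so the same
  \<open>q\<close> serves both orders.\<close>

lemma bracket_relation_admissible:
  fixes \<theta>s :: "nat \<Rightarrow> 'k::field"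
  assumes adm: "admissible_q d \<theta> \<theta>s q" and inj: "inj_on \<theta>s {..d}"
  shows "bracket_relation d \<theta>s (q_bracket q)" "bracket_relation d (\<lambda>i. \<theta>s (d - i)) (q_bracket q)"
proof -
  have q: "q \<noteq> 0" using adm by (simp add: admissible_q_def)
  have ratio: "to_ac ((\<theta>s (i - 2) - \<theta>s (i + 1)) / (\<theta>s (i - 1) - \<theta>s i)) = q + inverse q + 1"
    if "2 \<le> i" "i + 1 \<le> d" for i
    using adm that by (simp only: admissible_q_def)
  show "bracket_relation d \<theta>s (q_bracket q)"
    by (rule bracket_relation_q_bracket[OF q inj ratio])
  show "bracket_relation d (\<lambda>i. \<theta>s (d - i)) (q_bracket q)"
  proof (rule bracket_relation_q_bracket[OF q])
    show "inj_on (\<lambda>i. \<theta>s (d - i)) {..d}"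
      using inj by (intro inj_onI) (auto dest!: inj_onD)
    fix i assume i: "2 \<le> i" "i + 1 \<le> d"
    let ?k = "d - i + 1"
    have "(\<theta>s (d - (i - 2)) - \<theta>s (d - (i + 1))) / (\<theta>s (d - (i - 1)) - \<theta>s (d - i)) =
      (\<theta>s (?k + 1) - \<theta>s (?k - 2)) / (\<theta>s ?k - \<theta>s (?k - 1))"
    proof -
      have "d - (i - 2) = ?k + 1" "d - (i + 1) = ?k - 2" "d - (i - 1) = ?k" "d - i = ?k - 1"
        using i by auto
      then show ?thesis by (simp only:)
    qed
    also have "\<dots> = (\<theta>s (?k - 2) - \<theta>s (?k + 1)) / (\<theta>s (?k - 1) - \<theta>s ?k)"
      by (metis minus_diff_eq minus_divide_divide)
    finally show "to_ac ((\<theta>s (d - (i - 2)) - \<theta>s (d - (i + 1))) / (\<theta>s (d - (i - 1)) - \<theta>s (d - i))) = q + inverse q + 1"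
      using ratio[of ?k] i by simp
  qed
qed

theorem theorem12p6:
  fixes d :: nat
    and scaleA :: "'k::field \<Rightarrow> 'a::ring_1 \<Rightarrow> 'a"
    and \<rho> :: "'a \<Rightarrow> 'k mat"
    and scaleV :: "'k \<Rightarrow> 'v::ab_group_add \<Rightarrow> 'v"
    and act :: "'a \<Rightarrow> 'v \<Rightarrow> 'v"
    and A As :: 'a
    and E Es :: "nat \<Rightarrow> 'a"
    and \<theta> \<theta>s vphi phi :: "nat \<Rightarrow> 'k"
    and q :: "'k alg_closure"
    and v0 :: 'v
  assumes "matrix_algebra scaleA d \<rho>"
    and "simple_left_module scaleA scaleV act"
    and "leonard_system d scaleA \<rho> A E As Es"
    and "parameter_array d scaleA \<rho> A E As Es \<theta> \<theta>s vphi phi"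
    and "admissible_q d \<theta> \<theta>s q"
    and "v0 \<in> range (act (Es 0))" and "v0 \<noteq> 0"
  shows
    "let S = switching_element d scaleA E vphi phi;
         natural = matrix_wrt d scaleV act (\<lambda>i. act (alg_poly scaleA (tau_poly \<theta> i) A) v0)
     in lower_triangular_mat (natural S) \<and>
        lower_triangular_mat (natural (alg_inverse S)) \<and>
        (\<forall>i\<le>d. \<forall>j\<le>i.
           natural S $$ (i, j) =
             q_bracket q j (i - j) (d - i) * (\<Prod>h<j. phi (d - h)) *
               poly (tau_poly \<theta>s (i - j)) (\<theta>s d) / (\<Prod>h=1..i. vphi h) \<and>
           natural (alg_inverse S) $$ (i, j) =
             q_bracket q j (i - j) (d - i) * (\<Prod>h=1..j. vphi h) *
               poly (eta_poly d \<theta>s (i - j)) (\<theta>s 0) / (\<Prod>h<i. phi (d - h)))"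
proof -
  interpret R: matrix_algebra scaleA d \<rho> by (rule assms(1))
  interpret V: simple_left_module scaleA scaleV act by (rule assms(2))
  have ordA: "eigenvalue_ordering d \<rho> A \<theta>" and E: "\<And>i. i \<le> d \<Longrightarrow> E i = primitive_idempotent d scaleA A \<theta> i"
    and ordAs: "eigenvalue_ordering d \<rho> As \<theta>s" and Es: "\<And>i. i \<le> d \<Longrightarrow> Es i = primitive_idempotent d scaleA As \<theta>s i"
    using assms(4) by (auto simp: parameter_array_def idempotents_for_def)
  have inj: "inj_on \<theta> {..d}" "inj_on \<theta>s {..d}"
    using ordA ordAs by (auto simp: eigenvalue_ordering_def bij_betw_def atLeast0AtMost)
  \<comment> \<open>Two representations are used: \<open>\<kappa>\<close> diagonalises
    \<open>A\<close> and proves the relations among the \<open>E r\<close>, while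
    \<open>\<sigma>\<close> diagonalises \<open>As\<close> and is the one passed to
    \<open>leonard_module\<close>.\<close>
  obtain \<kappa> where \<kappa>: "matrix_algebra scaleA d \<kappa>"
    and \<kappa>_A: "\<And>i j. i \<le> d \<Longrightarrow> j \<le> d \<Longrightarrow> \<kappa> A $$ (i, j) = (if i = j then \<theta> i else 0)"
    by (rule R.diagonal_representation[OF ordA]) blast
  obtain \<sigma> where \<sigma>: "matrix_algebra scaleA d \<sigma>"
    and \<sigma>_As: "\<And>i j. i \<le> d \<Longrightarrow> j \<le> d \<Longrightarrow> \<sigma> As $$ (i, j) = (if i = j then \<theta>s i else 0)"
    and trace: "\<And>x. alg_trace \<rho> x = (\<Sum>i\<le>d. \<sigma> x $$ (i, i))"
    by (rule R.diagonal_representation[OF ordAs]) blast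
  interpret K: matrix_algebra scaleA d \<kappa> by (rule \<kappa>)
  interpret L: matrix_algebra scaleA d \<sigma> by (rule \<sigma>)
  have \<kappa>_E: "\<kappa> (E r) $$ (i, j) = (if i = j \<and> i = r then 1 else 0)" if "i \<le> d" "j \<le> d" "r \<le> d" for i j r
    unfolding E[OF that(3)] by (rule K.rho_entry_primitive_idempotent) (use \<kappa>_A inj that in auto)
  have \<sigma>_Es: "\<sigma> (Es r) $$ (i, j) = (if i = j \<and> i = r then 1 else 0)" if "i \<le> d" "j \<le> d" "r \<le> d" for i j r
    unfolding Es[OF that(3)] by (rule L.rho_entry_primitive_idempotent) (use \<sigma>_As inj that in auto)
  have \<kappa>_mult_E: "\<kappa> (x * E r) $$ (i, j) = (if j = r then \<kappa> x $$ (i, r) else 0)" if "i \<le> d" "j \<le> d" "r \<le> d" for x i j r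
  proof -
    have "\<kappa> (x * E r) $$ (i, j) = (\<Sum>l\<le>d. if l = j then (if j = r then \<kappa> x $$ (i, r) else 0) else 0)"
      unfolding K.rho_entry_mult[OF that(1,2)] using that by (intro sum.cong refl) (auto simp: \<kappa>_E)
    then show ?thesis using that by simp
  qed
  have Es0: "Es 0 * Es 0 = Es 0"
  proof (rule L.rho_eqI)
    fix i j assume ij: "i \<le> d" "j \<le> d"
    have "\<sigma> (Es 0 * Es 0) $$ (i, j) = (\<Sum>l\<le>d. if l = j then (if i = 0 \<and> j = 0 then 1 else 0) else 0)"
      unfolding L.rho_entry_mult[OF ij] using ij by (intro sum.cong refl) (auto simp: \<sigma>_Es)
    then show "\<sigma> (Es 0 * Es 0) $$ (i, j) = \<sigma> (Es 0) $$ (i, j)"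
      using ij by (auto simp: \<sigma>_Es)
  qed
  have leonard: "E i * As * E j = 0 \<and> Es i * A * Es j = 0" if "i \<le> d" "j \<le> d" "\<bar>int i - int j\<bar> > 1" for i j
    using assms(3) that unfolding leonard_system_def by blast
  have leonard': "Es i * A * Es j \<noteq> 0" if "i \<le> d" "j \<le> d" "\<bar>int i - int j\<bar> = 1" for i j
    using assms(3) that unfolding leonard_system_def by blast
  interpret leonard_module scaleA d \<sigma> scaleV act A As E Es \<theta> \<theta>s v0
  proof
    show "E r * E s = (if r = s then E r else 0)" if "r \<le> d" "s \<le> d" for r s
      by (rule K.rho_eqI) (use that in \<open>auto simp: \<kappa>_mult_E \<kappa>_E K.rho_entry_zero\<close>)
    show "(\<Sum>r\<le>d. E r) = 1"
    proof (rule K.rho_eqI)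
      fix i j assume ij: "i \<le> d" "j \<le> d"
      have "\<kappa> (\<Sum>r\<le>d. E r) $$ (i, j) = (\<Sum>r\<le>d. if r = i then (if i = j then 1 else 0) else 0)"
        unfolding K.rho_entry_sum[OF ij] using ij by (intro sum.cong refl) (auto simp: \<kappa>_E)
      then show "\<kappa> (\<Sum>r\<le>d. E r) $$ (i, j) = \<kappa> 1 $$ (i, j)"
        using ij by (simp add: K.rho_entry_one)
    qed
    show "A * E r = scaleA (\<theta> r) (E r)" if "r \<le> d" for r
      by (rule K.rho_eqI) (use that in \<open>auto simp: \<kappa>_mult_E \<kappa>_E \<kappa>_A K.rho_entry_scale\<close>)
    show "E r \<noteq> 0" if "r \<le> d" for r
      using \<kappa>_E[OF that that that] K.rho_entry_zero[OF that that] by auto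
    show "E r * As * E s = 0" "Es r * A * Es s = 0" if "r \<le> d" "s \<le> d" "Suc r < s \<or> Suc s < r" for r s
      using leonard[OF that(1,2)] that(3) by auto
    show "Es r * A * Es s \<noteq> 0" if "r \<le> d" "s \<le> d" "s = Suc r \<or> r = Suc s" for r s
      using leonard'[OF that(1,2)] that(3) by auto
    \<comment> \<open>A vector in the image of an idempotent is fixed by it.\<close>
    obtain w where "v0 = act (Es 0) w" using assms(6) by auto
    then show "act (Es 0) v0 = v0" by (simp add: Es0 flip: V.act_mult)
  qed (use \<sigma>_As \<sigma>_Es inj assms(7) in auto)
  have sp: "split_pair d T \<theta> \<theta>s vphi phi"
    by (rule split_pair_T) (use assms(4) in \<open>auto simp: parameter_array_def trace trace_mult_Es_0\<close>)
  let ?S = "switching_element d scaleA E vphi phi"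
    and ?u = "\<lambda>i. act (alg_poly scaleA (tau_poly \<theta> i) A) v0"
  have nat: "matrix_wrt d scaleV act ?u ?S = mat (d + 1) (d + 1)
      (\<lambda>(i, j). split_entry d (q_bracket q) \<theta>s vphi (\<lambda>h. phi (Suc d - h)) i j)"
    "matrix_wrt d scaleV act ?u (alg_inverse ?S) = mat (d + 1) (d + 1)
      (\<lambda>(i, j). split_entry d (q_bracket q) (\<lambda>i. \<theta>s (d - i)) (\<lambda>h. phi (Suc d - h)) vphi i j)"
    by (rule natural_switching_element[OF sp bracket_relation_admissible[OF assms(5) inj(2)]];
        simp add: q_bracket_eq_1)+
  \<comment> \<open>Shifts the index between \<open>split_entry\<close>, which counts from 1, and
    the stated products, which count from 0. The other translation is that \<open>eta_poly\<close>
    at \<open>\<theta>s 0\<close> is \<open>tau_poly\<close> of the reversed sequence at its last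
    member.\<close>
  have prod_phi: "(\<Prod>h=1..i. phi (Suc d - h)) = (\<Prod>h<i. phi (d - h))" for i
    by (rule prod.reindex_bij_witness[of _ Suc "\<lambda>h. h - 1"]) auto
  show ?thesis
    unfolding Let_def nat lower_triangular_mat_def
    by (auto simp: split_entry_def prod_phi[simplified] eta_poly_eq_tau_poly)
qed

end
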